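(* Fix a real number $c>0$. For integers $N\ge 1$ and real $q$ with $1\le q<\infty$ put $$P_N(t)=\frac{1}{\sqrt N}\sum_{n\le N}\mu(n)e^{2\pi i n t},\qquad \mathcal M_{q,c}(N)=\left(\frac{N}{2c}\int_{-c/N}^{c/N}|P_N(t)|^q\,dt\right)^{1/q}.$$ The following assertions are equivalent: (i) The Riemann hypothesis holds. (ii) For every $\eta>0$ and every finite $q\ge 1$, $\mathcal M_{q,c}(N)=O_{\eta,q,c}(N^{\eta})$. (iii) For every $\eta>0$ there is an unbounded set $Q_\eta\subseteq[1,\infty)$ (which may depend on $\eta$) such that $\mathcal M_{q,c}(N)=O_{\eta,q,c}(N^{\eta})$ for every $q\in Q_\eta$.
   Context: $\mu$ is the Möbius function: $\mu(n)=0$ if $n$ is divisible by the square of a prime, and $\mu(n)=(-1)^k$ if $n$ is a product of $k$ distinct primes (so $\mu(1)=1$). The sum over $n\le N$ runs over integers $1\le n\le N$. The notation $F(N)=O_{\eta,q,c}(N^\eta)$ means that there is a constant $C$ depending only on $\eta,q,c$ with $|F(N)|\le C N^{\eta}$ for all integers $N\ge1$. The Riemann hypothesis is the assertion that all nontrivial zeros of the Riemann zeta function lie on the line $\Re s=1/2$. *)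

theory Defs
  imports "HOL-Complex_Analysis.Complex_Analysis" "HOL-Computational_Algebra.Primes"
begin

definition is_zeta_continuation :: "(complex \<Rightarrow> complex) \<Rightarrow> bool" where
  "is_zeta_continuation Z \<longleftrightarrow>
     Z holomorphic_on - {1} \<and>
     (\<forall>s. Re s > 1 \<longrightarrow> (\<lambda>n. 1 / of_nat (Suc n) powr s) sums Z s)"

text \<open>Existence of the continuation: for \<open>Re s > 1\<close>, sum over \<open>m \<ge> 1\<close> the Taylor expansion of
  \<open>(m + 1) powr (1 - s) - m powr (1 - s)\<close> in powers of \<open>1 / m\<close>. The left side telescopes to \<open>-1\<close>,
  and the result expresses \<open>(s - 1) * zeta s\<close> by the values of \<open>(z - 1) * zeta z\<close> at \<open>z = s + i\<close>, \<open>i \<ge> 1\<close>,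
  plus a remainder series converging in a larger half-plane.\<close>

abbreviation zeta_series :: "complex \<Rightarrow> complex" where "zeta_series s \<equiv> (\<Sum>n. 1 / of_nat (Suc n) powr s)"

lemma summable_zeta_series:
  assumes "Re s > 1"
  shows "summable (\<lambda>n. 1 / of_nat (Suc n) powr s)"
proof (rule summable_comparison_test)
  have "norm (1 / of_nat (Suc n) powr s) = real (Suc n) powr (- Re s)" for n
    by (simp add: norm_divide norm_powr_real_powr powr_minus field_simps flip: of_nat_Suc)
  thus "\<exists>N. \<forall>n\<ge>N. norm (1 / of_nat (Suc n) powr s) \<le> real (Suc n) powr (- Re s)" by auto
  show "summable (\<lambda>n. real (Suc n) powr (- Re s))"
    using assms by (subst summable_Suc_iff) (simp add: summable_real_powr_iff)
qed

definition zeta_taylor_rem :: "nat \<Rightarrow> nat \<Rightarrow> complex \<Rightarrow> complex" where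
  "zeta_taylor_rem K n s = of_nat (Suc (Suc n)) powr (1 - s) -
     (\<Sum>j\<le>K. ((1 - s) gchoose j) * of_nat (Suc n) powr (1 - s - of_nat j))"

lemma zeta_taylor_rem_holo [holomorphic_intros]: "zeta_taylor_rem K n holomorphic_on A"
  unfolding zeta_taylor_rem_def gbinomial_prod_rev
  by (intro holomorphic_intros) (auto simp: complex_nonpos_Reals_iff simp flip: of_nat_Suc)

lemma powr_taylor_bound:
  fixes a :: complex and x :: real
  assumes "0 \<le> x" "x \<le> 1"
  shows "norm ((1 + of_real x) powr a - (\<Sum>j\<le>K. (a gchoose j) * of_real x ^ j))
     \<le> (fact (Suc K) * norm (a gchoose Suc K) * 2 powr \<bar>Re a - real (Suc K)\<bar>) * x ^ Suc K / fact K"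
proof -
  define f where "f = (\<lambda>j z. fact j * (a gchoose j) * (1 + z) powr (a - of_nat j))"
  let ?S = "closed_segment 0 (1::complex)"
  have S: "\<exists>y. 0 \<le> y \<and> y \<le> 1 \<and> z = of_real y" if "z \<in> ?S" for z
    using that by (auto simp: closed_segment_def scaleR_conv_of_real)
  have rec: "fact (Suc j) * (a gchoose Suc j) = fact j * (a gchoose j) * (a - of_nat j)" for j
    by (simp add: gbinomial_prod_rev del: of_nat_Suc)
  have d: "(f i has_field_derivative f (Suc i) z) (at z within ?S)" if zS: "z \<in> ?S" for i z
  proof -
    obtain y where y: "0 \<le> y" "y \<le> 1" "z = of_real y" using S[OF zS] by auto
    have nz: "1 + z \<notin> \<real>\<^sub>\<le>\<^sub>0" using y by (auto simp: complex_nonpos_Reals_iff)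
    show ?thesis unfolding f_def rec
      by (rule derivative_eq_intros refl | use nz in \<open>simp add: algebra_simps\<close>)+
  qed
  have B: "norm (f (Suc K) z) \<le> fact (Suc K) * norm (a gchoose Suc K) * 2 powr \<bar>Re a - real (Suc K)\<bar>"
    if zS: "z \<in> ?S" for z
  proof -
    obtain y where y: "0 \<le> y" "y \<le> 1" "z = of_real y" using S[OF zS] by auto
    have "norm ((1 + z) powr (a - of_nat (Suc K))) = (1 + y) powr (Re a - real (Suc K))"
      using y norm_powr_real_powr[of "of_real (1+y)" "a - of_nat (Suc K)"] by simp
    also have "\<dots> \<le> (1 + y) powr \<bar>Re a - real (Suc K)\<bar>"
      using y by (intro powr_mono) auto
    also have "\<dots> \<le> 2 powr \<bar>Re a - real (Suc K)\<bar>"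
      using y by (intro powr_mono2) auto
    finally show ?thesis unfolding f_def
      by (simp only: norm_mult norm_fact) (intro mult_left_mono, auto)
  qed
  have x: "of_real x \<in> ?S"
    using assms by (auto simp: closed_segment_def scaleR_conv_of_real)
  have "norm (f 0 (of_real x) - (\<Sum>i\<le>K. f i 0 * (of_real x - 0) ^ i / fact i)) \<le>
     (fact (Suc K) * norm (a gchoose Suc K) * 2 powr \<bar>Re a - real (Suc K)\<bar>) * norm (of_real x - (0::complex)) ^ Suc K / fact K"
    by (rule complex_Taylor[of ?S]) (use d B x in auto)
  thus ?thesis using assms by (simp add: f_def)
qed

lemma zeta_taylor_rem_bound:
  "norm (zeta_taylor_rem K n s) \<le> ((fact (Suc K) * norm ((1-s) gchoose Suc K) * 2 powr \<bar>1 - Re s - real (Suc K)\<bar>) / fact K)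
      * real (Suc n) powr (- Re s - K)"
proof -
  define m where "m = real (Suc n)"
  have m: "m \<ge> 1" by (simp add: m_def)
  have e1: "of_nat (Suc (Suc n)) powr (1 - s) = of_real m powr (1 - s) * (1 + of_real (1/m)) powr (1 - s)"
  proof -
    have "of_nat (Suc (Suc n)) = of_real m * (of_real (1 + 1/m) :: complex)"
      using m by (simp add: m_def field_simps flip: of_nat_Suc of_real_mult)
    thus ?thesis using m by (simp only:) (subst powr_times_real, auto)
  qed
  have e2: "of_nat (Suc n) powr (1 - s - of_nat j) = of_real m powr (1 - s) * of_real (1/m) ^ j" for j
    using m by (simp add: powr_diff m_def powr_nat' power_divide flip: of_nat_Suc)
  have "zeta_taylor_rem K n s = of_real m powr (1 - s) * ((1 + of_real (1/m)) powr (1 - s) -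
     (\<Sum>j\<le>K. ((1 - s) gchoose j) * of_real (1/m) ^ j))"
    unfolding zeta_taylor_rem_def e1 e2 by (simp add: algebra_simps sum_distrib_left)
  also have "norm \<dots> \<le> m powr (1 - Re s) * ((fact (Suc K) * norm ((1-s) gchoose Suc K) * 2 powr \<bar>Re (1 - s) - real (Suc K)\<bar>) * (1/m) ^ Suc K / fact K)"
    unfolding norm_mult using m
    by (intro mult_mono powr_taylor_bound) (auto simp: norm_powr_real_powr)
  also have "\<dots> = ((fact (Suc K) * norm ((1-s) gchoose Suc K) * 2 powr \<bar>1 - Re s - real (Suc K)\<bar>) / fact K)
     * (m powr (1 - Re s) * (1/m) ^ Suc K)"
    by simp
  also have "m powr (1 - Re s) * (1/m) ^ Suc K = m powr (- Re s - K)"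
    using m by (simp add: powr_diff powr_minus powr_realpow field_simps)
  finally show ?thesis by (simp only: m_def)
qed

lemma zeta_taylor_rem_M:
  assumes "Re s0 > 1 - real K"
  shows "\<exists>d>0. cball s0 d \<subseteq> {s. Re s > 1 - real K} \<and>
    uniform_limit (cball s0 d) (\<lambda>N s. \<Sum>n<N. zeta_taylor_rem K n s) (\<lambda>s. \<Sum>n. zeta_taylor_rem K n s) sequentially"
proof -
  define d where "d = (Re s0 - 1 + K) / 2"
  have d: "d > 0" using assms by (simp add: d_def)
  have re: "Re s \<ge> Re s0 - d" if "s \<in> cball s0 d" for s
    using that abs_Re_le_cmod[of "s0 - s"] by (auto simp: dist_norm)
  define B where "B = (\<lambda>s::complex. (fact (Suc K) * norm ((1-s) gchoose Suc K) * 2 powr \<bar>1 - Re s - real (Suc K)\<bar>) / fact K)"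
  have "continuous_on (cball s0 d) B"
    unfolding B_def gbinomial_prod_rev by (intro continuous_intros) (auto simp del: of_nat_Suc)
  hence "bounded (B ` cball s0 d)"
    by (intro compact_imp_bounded compact_continuous_image) auto
  then obtain C where C: "\<And>s. s \<in> cball s0 d \<Longrightarrow> \<bar>B s\<bar> \<le> C"
    unfolding bounded_iff real_norm_def by blast
  have "C \<ge> 0" using C[of s0] d by auto
  have "uniform_limit (cball s0 d) (\<lambda>N s. \<Sum>n<N. zeta_taylor_rem K n s) (\<lambda>s. \<Sum>n. zeta_taylor_rem K n s) sequentially"
  proof (rule Weierstrass_m_test)
    fix n s assume s: "s \<in> cball s0 d"
    have "norm (zeta_taylor_rem K n s) \<le> B s * real (Suc n) powr (- Re s - K)"
      using zeta_taylor_rem_bound[of K n s] by (simp add: B_def)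
    also have "\<dots> \<le> C * real (Suc n) powr (- 1 - d)"
      using C[OF s] re[OF s] \<open>C \<ge> 0\<close> d
      by (intro mult_mono powr_mono) (auto simp: d_def field_simps)
    finally show "norm (zeta_taylor_rem K n s) \<le> C * real (Suc n) powr (- 1 - d)" .
  next
    have "summable (\<lambda>n. real (Suc n) powr (- 1 - d))"
      using d by (subst summable_Suc_iff) (simp add: summable_real_powr_iff)
    thus "summable (\<lambda>n. C * real (Suc n) powr (- 1 - d))" by (rule summable_mult)
  qed
  moreover have "cball s0 d \<subseteq> {s. Re s > 1 - real K}"
    using re assms by (force simp: d_def field_simps)
  ultimately show ?thesis using d by blast
qed

lemma zeta_taylor_rem_sum_holo: "(\<lambda>s. \<Sum>n. zeta_taylor_rem K n s) holomorphic_on {s. Re s > 1 - real K}"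
  by (rule holomorphic_uniform_sequence[where f = "\<lambda>N s. \<Sum>n<N. zeta_taylor_rem K n s"])
     (use zeta_taylor_rem_M in \<open>auto intro!: holomorphic_intros open_halfspace_Re_gt\<close>)

lemma zeta_taylor_rem_sums:
  assumes "Re s > 1"
  shows "(\<Sum>n. zeta_taylor_rem (Suc k) n s) = - 1 + (s - 1) * zeta_series s
     - (\<Sum>i=1..k. ((1 - s) gchoose (Suc i)) * zeta_series (s + of_nat i))"
proof -
  have lim: "(\<lambda>n. of_nat (Suc n) powr (1 - s)) \<longlonglongrightarrow> 0"
  proof (rule tendsto_norm_zero_cancel)
    have "(\<lambda>n. real (Suc n) powr (1 - Re s)) \<longlonglongrightarrow> 0"
      using assms by (intro tendsto_neg_powr filterlim_compose[OF filterlim_real_sequentially filterlim_Suc]) auto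
    thus "(\<lambda>n. norm (of_nat (Suc n) powr (1 - s))) \<longlonglongrightarrow> 0"
      by (simp add: norm_powr_real_powr flip: of_nat_Suc)
  qed
  have 1: "(\<lambda>n. of_nat (Suc (Suc n)) powr (1 - s) - of_nat (Suc n) powr (1 - s)) sums (0 - 1)"
    using telescope_sums[OF lim] by simp
  have 2: "(\<lambda>n. ((1 - s) gchoose (Suc i)) * (1 / of_nat (Suc n) powr (s + of_nat i))) sums
      (((1 - s) gchoose (Suc i)) * zeta_series (s + of_nat i))" for i
    using assms by (intro sums_mult summable_sums summable_zeta_series) auto
  have R: "zeta_taylor_rem (Suc k) n s = (of_nat (Suc (Suc n)) powr (1 - s) - of_nat (Suc n) powr (1 - s))
      - (\<Sum>i\<le>k. ((1 - s) gchoose (Suc i)) * (1 / of_nat (Suc n) powr (s + of_nat i)))" for n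
  proof -
    have "of_nat (Suc n) powr (1 - s - of_nat (Suc i)) = 1 / of_nat (Suc n) powr (s + of_nat i)" for i
      proof -
      have "1 - s - of_nat (Suc i) = - (s + of_nat i)" by simp
      thus ?thesis by (simp only: powr_minus_divide)
    qed
    thus ?thesis unfolding zeta_taylor_rem_def sum.atMost_Suc_shift by simp
  qed
  have "(\<lambda>n. zeta_taylor_rem (Suc k) n s) sums ((0 - 1) - (\<Sum>i\<le>k. ((1 - s) gchoose (Suc i)) * zeta_series (s + of_nat i)))"
    unfolding R by (intro sums_diff 1 sums_sum 2)
  also have "(\<Sum>i\<le>k. ((1 - s) gchoose (Suc i)) * zeta_series (s + of_nat i)) =
    (1 - s) * zeta_series s + (\<Sum>i=1..k. ((1 - s) gchoose (Suc i)) * zeta_series (s + of_nat i))"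
    by (simp add: atMost_atLeast0 sum.atLeast_Suc_atMost)
  finally show ?thesis by (simp add: sums_iff algebra_simps)
qed

lemma ex_zeta_times_pole_factor: "\<exists>g. (k > 0 \<longrightarrow> g holomorphic_on {s. Re s > 1 - real k}) \<and> (\<forall>s. Re s > 1 \<longrightarrow> g s = (s - 1) * zeta_series s)"
proof (induction k)
  case 0 show ?case by (intro exI[of _ "\<lambda>s. (s - 1) * zeta_series s"]) auto
next
  case (Suc k)
  then obtain g where g: "k > 0 \<Longrightarrow> g holomorphic_on {s. Re s > 1 - real k}"
    "\<And>s. Re s > 1 \<Longrightarrow> g s = (s - 1) * zeta_series s" by blast
  define h where "h = (\<lambda>s. 1 - (\<Sum>i=1..k. ((1 - s) gchoose i) / of_nat (Suc i) * g (s + of_nat i)) + (\<Sum>n. zeta_taylor_rem (Suc k) n s))"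
  have "(\<lambda>s. g (s + of_nat i)) holomorphic_on {s. Re s > 1 - real (Suc k)}" if "i \<in> {1..k}" for i
    by (rule holomorphic_on_compose_gen[unfolded o_def, where g = g and f = "\<lambda>s. s + of_nat i", OF _ g(1)])
       (use that in \<open>auto intro!: holomorphic_intros\<close>)
  hence "h holomorphic_on {s. Re s > 1 - real (Suc k)}"
    unfolding h_def gbinomial_prod_rev by (intro holomorphic_intros zeta_taylor_rem_sum_holo) (auto simp del: of_nat_Suc)
  moreover have "h s = (s - 1) * zeta_series s" if s: "Re s > 1" for s
  proof -
    have "((1 - s) gchoose (Suc i)) * zeta_series (s + of_nat i) = - (((1 - s) gchoose i) / of_nat (Suc i) * g (s + of_nat i))"
      if "i \<in> {1..k}" for i
    proof -
      have "g (s + of_nat i) = (s + of_nat i - 1) * zeta_series (s + of_nat i)" using s g(2) by simp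
      moreover have "((1 - s) gchoose (Suc i)) = - ((1 - s) gchoose i) * (s + of_nat i - 1) / of_nat (Suc i)"
        by (simp add: gbinomial_prod_rev divide_simps del: of_nat_Suc) (simp add: algebra_simps)
      ultimately show ?thesis by simp
    qed
    thus ?thesis unfolding h_def zeta_taylor_rem_sums[OF s] by (simp add: sum_negf)
  qed
  ultimately show ?case by blast
qed

lemma ex_zeta_continuation: "\<exists>Z. is_zeta_continuation Z"
proof -
  obtain G where G: "\<And>k. k > 0 \<Longrightarrow> G k holomorphic_on {s. Re s > 1 - real k}"
    "\<And>k s. Re s > 1 \<Longrightarrow> G k s = (s - 1) * zeta_series s" using ex_zeta_times_pole_factor by metis
  have agree: "G k s = G l s" if kl: "0 < k" "k \<le> l" "Re s > 1 - real k" for k l s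
  proof (rule analytic_continuation_open[of "{s. Re s > 1}" "{s. Re s > 1 - real k}" "G k" "G l"])
    show "{s. Re s > 1} \<noteq> {}" by (auto intro: exI[of _ 2])
    show "connected {s. Re s > 1 - real k}" by (intro convex_connected convex_halfspace_Re_gt)
    show "G l holomorphic_on {s. Re s > 1 - real k}"
      using kl by (intro holomorphic_on_subset[OF G(1)]) auto
  qed (use kl G in \<open>auto intro: open_halfspace_Re_gt\<close>)
  define K where "K = (\<lambda>s. Suc (nat \<lceil>2 - Re s\<rceil>))"
  have K: "Re s > 1 - real (K s)" "K s > 0" for s unfolding K_def by linarith+
  define Z where "Z = (\<lambda>s. G (K s) s / (s - 1))"
  have "Z holomorphic_on - {1}"
  proof (rule holomorphic_on_UN_open[where A = "\<lambda>k. {s. Re s > 1 - real (Suc k)} - {1}" and I = UNIV, THEN holomorphic_on_subset])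
    fix k
    have "(\<lambda>s. G (Suc k) s / (s - 1)) holomorphic_on {s. Re s > 1 - real (Suc k)} - {1}"
      by (intro holomorphic_intros holomorphic_on_subset[OF G(1)]) auto
    moreover have "G (Suc k) s = G (K s) s" if "Re s > 1 - real (Suc k)" for s
    proof (cases "Suc k \<le> K s")
      case True thus ?thesis using agree[of "Suc k" "K s" s] that by simp
    next
      case False thus ?thesis using agree[of "K s" "Suc k" s] K[of s] by simp
    qed
    ultimately show "Z holomorphic_on {s. Re s > 1 - real (Suc k)} - {1}"
      unfolding Z_def by (subst holomorphic_cong[OF refl]) auto
    show "open ({s. Re s > 1 - real (Suc k)} - {1})" by (intro open_Diff open_halfspace_Re_gt) auto
  next
    show "- {1} \<subseteq> (\<Union>k. {s. Re s > 1 - real (Suc k)} - {1})"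
    proof
      fix s :: complex assume "s \<in> - {1}"
      moreover have "Re s > 1 - real (Suc (nat \<lceil>2 - Re s\<rceil>))" by linarith
      ultimately show "s \<in> (\<Union>k. {s. Re s > 1 - real (Suc k)} - {1})" by blast
    qed
  qed
  moreover have "(\<lambda>n. 1 / of_nat (Suc n) powr s) sums Z s" if "Re s > 1" for s
  proof -
    have "s \<noteq> 1" using that by auto
    hence "Z s = zeta_series s" using G(2)[OF that] by (simp add: Z_def)
    thus ?thesis using summable_zeta_series[OF that] by (simp only: summable_sums)
  qed
  ultimately show ?thesis unfolding is_zeta_continuation_def by blast
qed

lemma ex1_zeta_continuation: "\<exists>!Z. is_zeta_continuation Z \<and> Z 1 = 0"
proof -
  obtain Z where Z: "is_zeta_continuation Z" using ex_zeta_continuation by blast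
  have "is_zeta_continuation (Z(1 := 0))"
  proof -
    have "Z(1 := 0) holomorphic_on - {1} \<longleftrightarrow> Z holomorphic_on - {1}" by (rule holomorphic_cong) auto
    thus ?thesis using Z unfolding is_zeta_continuation_def by auto
  qed
  moreover have "W = V" if W: "is_zeta_continuation W \<and> W 1 = 0" and V: "is_zeta_continuation V \<and> V 1 = 0" for W V
  proof
    fix s show "W s = V s"
    proof (cases "s = 1")
      case False
      show ?thesis
      proof (rule analytic_continuation_open[of "{s. Re s > 1}" "- {1}" W V])
        show "{s. Re s > 1} \<noteq> {}" by (auto intro: exI[of _ 2])
        show "connected (- {1::complex})" by (rule connected_punctured_universe) simp
        show "W s = V s" if "s \<in> {s. Re s > 1}" for s
          using that W V unfolding is_zeta_continuation_def by (blast intro: sums_unique2)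
      qed (use W V False in \<open>auto simp: is_zeta_continuation_def intro: open_halfspace_Re_gt\<close>)
    qed (use W V in auto)
  qed
  ultimately show ?thesis by (intro ex1I[of _ "Z(1 := 0)"]) auto
qed

text \<open>The value at the pole \<open>s = 1\<close> is a dummy, fixed only to make the description definite;
  existence and uniqueness are \<open>ex1_zeta_continuation\<close>.\<close>

definition riemann_zeta :: "complex \<Rightarrow> complex" where
  "riemann_zeta = (THE Z. is_zeta_continuation Z \<and> Z 1 = 0)"

lemma riemann_zeta: "is_zeta_continuation riemann_zeta" "riemann_zeta 1 = 0"
  using theI'[OF ex1_zeta_continuation] unfolding riemann_zeta_def by blast+

text \<open>The trivial zeros are the negative even integers \<open>-2, -4, \<dots>\<close>.\<close>

definition nontrivial_zeta_zero :: "complex \<Rightarrow> bool" where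
  "nontrivial_zeta_zero s \<longleftrightarrow>
     s \<noteq> 1 \<and> riemann_zeta s = 0 \<and> \<not> (\<exists>k::nat. k \<ge> 1 \<and> s = - (2 * of_nat k))"

definition riemann_hypothesis :: bool where
  "riemann_hypothesis \<longleftrightarrow> (\<forall>s. nontrivial_zeta_zero s \<longrightarrow> Re s = 1 / 2)"

definition moebius_mu :: "nat \<Rightarrow> int" where
  "moebius_mu n =
     (if \<exists>p. prime p \<and> p\<^sup>2 dvd n then 0 else (-1) ^ card (prime_factors n))"

definition mu_poly :: "nat \<Rightarrow> real \<Rightarrow> complex" where
  "mu_poly N t = 1 / complex_of_real (sqrt (real N)) *
     (\<Sum>n=1..N. of_int (moebius_mu n) * exp (2 * of_real pi * \<i> * of_nat n * of_real t))"

definition local_mean :: "real \<Rightarrow> real \<Rightarrow> nat \<Rightarrow> real" where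
  "local_mean q c N =
     (real N / (2 * c) *
        integral {- c / real N .. c / real N} (\<lambda>t. norm (mu_poly N t) powr q)) powr (1 / q)"

end

theory Submission
  imports Defs
begin

text \<open>
  (iii) implies (i): \<open>P_N\<close> is Lipschitz with constant \<open>O(N powr (3/2))\<close>, so a large value at \<open>0\<close>
  persists on an interval of length about \<open>N powr (-3/2)\<close>; the \<open>q\<close>-th mean over \<open>[-c/N, c/N]\<close> then
  loses only a factor \<open>N powr (1 / (2 * q))\<close>, which is negligible for large \<open>q\<close>. This bounds
  \<open>M(N) = \<Sum>n\<le>N. \<mu>(n)\<close> by \<open>N powr (1/2 + \<epsilon>)\<close>, so the Dirichlet series of \<open>1 / \<zeta>\<close> converges for \<open>Re s > 1/2\<close>,
  and the functional equation handles the zeros with \<open>Re s < 1/2\<close>.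

  (i) implies (ii): under the Riemann hypothesis \<open>log \<zeta>\<close> is \<open>o(log \<bar>t\<bar>)\<close> to the right of the critical line
  (Borel-Caratheodory and a comparison of Taylor coefficients on two discs), so \<open>1 / \<zeta>\<close> grows more slowly than any
  power of \<open>\<bar>t\<bar>\<close>. An absolutely convergent Perron formula, smoothed over \<open>[N, N + sqrt N]\<close>, gives
  \<open>M(N) = O(N powr (1/2 + \<epsilon>))\<close>, and Abel summation transfers this to \<open>P_N(t)\<close> for \<open>\<bar>t\<bar> \<le> c / N\<close>.

  The functional equation comes from the identity
  \<open>\<Gamma>(s) * (\<Sum>n\<le>N. n powr -s - N powr (1-s) / (1-s) - N powr -s / 2) = \<integral> x powr (s-1) * (1 - exp (-N x)) * b(x) dx\<close>
  on \<open>(0, \<infinity>)\<close>, for real \<open>-1 < s < 0\<close> and \<open>b(x) = 1 / (exp x - 1) - 1 / x + 1 / 2\<close>: let \<open>N\<close> tend to infinity and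
  integrate the partial fraction expansion of \<open>b\<close> termwise.
\<close>

section \<open>A Mellin transform on the strip \<open>-1 < s < 0\<close>\<close>

text \<open>The functional equation serves only to reflect zeros, so a real segment suffices: the
  identity theorem does the rest. For -1 < s < 0 all integrands involved are nonnegative, so every
  interchange is Tonelli or monotone convergence in \<open>ennreal\<close>, with no integrability to
  check; in return, differences must be arranged as equations between sums of nonnegative terms.

  The defining continuation of zeta says nothing about its size or about its values left of Re s =
  1. Comparing the Dirichlet series with the trapezoidal rule for \<open>x powr (-s)\<close>
  supplies both: a pole-free expression for (s - 1) zeta(s) on Re s > -1, with cubic growth on Re s
  \<ge> 1/2.

  That growth bounds Re log zeta from above only, by a multiple of log |t|. A two-sided bound of
  this order would merely make 1/zeta smaller than some fixed power of |t|, too much for the Perron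
  integral on a line near Re s = 1/2. The arbitrarily small factor in front of log |t| comes from
  the half-plane Re s \<ge> 2, where log |zeta| is bounded.\<close>

lemma nn_integral_powr_tail:
  fixes a u :: real
  assumes "a < 0" "u > 0"
  shows "(\<integral>\<^sup>+x. ennreal (x powr (a - 1)) * indicator {u..} x \<partial>lborel) = ennreal (u powr a / (-a))"
  using nn_integral_has_integral_lebesgue[OF _ has_integral_powr_to_inf[of "a - 1" u]] assms
  by (simp add: ennreal_mult'' mult.commute ennreal_indicator)

text \<open>Integration by parts in the form of Tonelli: \<open>G\<close> is written as the integral
  of \<open>g\<close> over (0, x], and the inner integral of \<open>x powr (a - 1)\<close> over [u,
  \<infinity>) is \<open>u powr a / (-a)\<close>. No boundary terms arise, and both sides may be
  infinite.\<close>

lemma nn_integral_Mellin_primitive: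
  fixes g G :: "real \<Rightarrow> real" and a :: real
  assumes a: "a < 0" and g [measurable]: "g \<in> borel_measurable borel" and nn: "\<And>u. u > 0 \<Longrightarrow> g u \<ge> 0"
    and G: "\<And>x. x > 0 \<Longrightarrow> (\<integral>\<^sup>+u. ennreal (g u) * indicator {0<..x} u \<partial>lborel) = ennreal (G x)"
    and G0: "\<And>x. x > 0 \<Longrightarrow> G x \<ge> 0"
  shows "(\<integral>\<^sup>+x. ennreal (G x * x powr (a - 1)) * indicator {0<..} x \<partial>lborel) =
         (\<integral>\<^sup>+u. ennreal (g u * u powr a / (-a)) * indicator {0<..} u \<partial>lborel)"
proof -
  have "(\<integral>\<^sup>+x. ennreal (G x * x powr (a - 1)) * indicator {0<..} x \<partial>lborel) =
        (\<integral>\<^sup>+x. (\<integral>\<^sup>+u. ennreal (g u) * indicator {0<..x} u * (ennreal (x powr (a-1)) * indicator {0<..} x) \<partial>lborel) \<partial>lborel)"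
    using G G0 by (intro nn_integral_cong) (auto simp: nn_integral_multc ennreal_mult'' split: split_indicator)
  also have "\<dots> = (\<integral>\<^sup>+x. (\<integral>\<^sup>+u. ennreal (g u) * indicator {0<..} u * (ennreal (x powr (a-1)) * (if u \<le> x then 1 else 0)) \<partial>lborel) \<partial>lborel)"
    by (intro nn_integral_cong) (auto split: split_indicator)
  also have "\<dots> = (\<integral>\<^sup>+u. (\<integral>\<^sup>+x. ennreal (g u) * indicator {0<..} u * (ennreal (x powr (a-1)) * (if u \<le> x then 1 else 0)) \<partial>lborel) \<partial>lborel)"
    by (rule lborel_pair.Fubini') measurable
  also have "\<dots> = (\<integral>\<^sup>+u. ennreal (g u) * indicator {0<..} u * (\<integral>\<^sup>+x. (ennreal (x powr (a-1)) * (if u \<le> x then 1 else 0)) \<partial>lborel) \<partial>lborel)"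
    by (intro nn_integral_cong nn_integral_cmult) measurable
  also have "\<dots> = (\<integral>\<^sup>+u. ennreal (g u * u powr a / (-a)) * indicator {0<..} u \<partial>lborel)"
  proof (intro nn_integral_cong)
    fix u :: real
    have "(\<integral>\<^sup>+x. (ennreal (x powr (a-1)) * (if u \<le> x then 1 else 0)) \<partial>lborel) = ennreal (u powr a / (-a))" if "u > 0"
      by (subst nn_integral_powr_tail[OF a that, symmetric]) (intro nn_integral_cong, auto split: split_indicator)
    thus "ennreal (g u) * indicator {0<..} u * (\<integral>\<^sup>+x. (ennreal (x powr (a-1)) * (if u \<le> x then 1 else 0)) \<partial>lborel)
       = ennreal (g u * u powr a / (-a)) * indicator {0<..} u"
      using nn[of u] a by (cases "u > 0") (auto simp: ennreal_mult'[symmetric] divide_nonneg_neg)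
  qed
  finally show ?thesis .
qed

lemma nn_integral_Gamma_scaled:
  fixes y r :: real
  assumes y: "y > 0" and r: "r > 0"
  shows "(\<integral>\<^sup>+t. ennreal (t powr (y - 1) * exp (- r * t)) * indicator {0<..} t \<partial>lborel) = ennreal (Gamma y * r powr (-y))"
proof -
  have "ennreal (Gamma y) = (\<integral>\<^sup>+t. ennreal (indicator {0..} t * t powr (y - 1) / exp t) \<partial>lborel)"
    by (rule Gamma_conv_nn_integral_real[OF y])
  also have "\<dots> = ennreal \<bar>r\<bar> * (\<integral>\<^sup>+t. ennreal (indicator {0..} (0 + r * t) * (0 + r * t) powr (y - 1) / exp (0 + r * t)) \<partial>lborel)"
    using r by (intro nn_integral_real_affine) auto
  also have "(\<integral>\<^sup>+t. ennreal (indicator {0..} (0 + r * t) * (0 + r * t) powr (y - 1) / exp (0 + r * t)) \<partial>lborel) =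
     (\<integral>\<^sup>+t. ennreal (r powr (y - 1)) * (ennreal (t powr (y - 1) * exp (- r * t)) * indicator {0<..} t) \<partial>lborel)"
  proof (intro nn_integral_cong)
    fix t
    show "ennreal (indicator {0..} (0 + r * t) * (0 + r * t) powr (y - 1) / exp (0 + r * t)) =
      ennreal (r powr (y - 1)) * (ennreal (t powr (y - 1) * exp (- r * t)) * indicator {0<..} t)"
      using r by (cases "t > 0"; cases "t = 0")
        (auto simp: indicator_def powr_mult exp_minus field_simps zero_le_mult_iff ennreal_mult'[symmetric])
  qed
  also have "\<dots> = ennreal (r powr (y - 1)) * (\<integral>\<^sup>+t. ennreal (t powr (y - 1) * exp (- r * t)) * indicator {0<..} t \<partial>lborel)" (is "_ = _ * ?I")
    by (rule nn_integral_cmult) auto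
  finally have "ennreal (Gamma y) = ennreal (r powr y) * ?I"
    using r by (simp add: mult.assoc[symmetric] ennreal_mult[symmetric] powr_diff)
  hence "ennreal (r powr (-y)) * ennreal (Gamma y) = ennreal (r powr (-y)) * ennreal (r powr y) * ?I" by (simp add: mult.assoc)
  also have "ennreal (r powr (-y)) * ennreal (r powr y) = 1"
    using r by (simp add: ennreal_mult'[symmetric] powr_minus)
  finally show ?thesis using Gamma_real_pos[OF y] by (simp add: ennreal_mult'[symmetric] mult.commute)
qed

text \<open>The factor \<open>1 - exp (- r * x)\<close> is the primitive of
  \<open>r * exp (- r * u)\<close> that vanishes at 0, which leads to the Gamma integral at
  \<open>s + 1 > 0\<close>. The constant \<open>Gamma (s + 1) / (-s)\<close> is
  \<open>- Gamma s\<close>, written with Gamma at a positive argument.\<close>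

lemma nn_integral_Mellin_1_minus_exp:
  fixes s r :: real
  assumes s: "-1 < s" "s < 0" and r: "r > 0"
  shows "(\<integral>\<^sup>+x. ennreal ((1 - exp (- r * x)) * x powr (s - 1)) * indicator {0<..} x \<partial>lborel) =
         ennreal (r powr (-s) * (Gamma (s + 1) / (-s)))"
proof -
  have "(\<integral>\<^sup>+x. ennreal ((1 - exp (- r * x)) * x powr (s - 1)) * indicator {0<..} x \<partial>lborel) =
     (\<integral>\<^sup>+u. ennreal (r * exp (- r * u) * u powr s / (-s)) * indicator {0<..} u \<partial>lborel)"
  proof (rule nn_integral_Mellin_primitive)
    fix x :: real assume x: "x > 0"
    have "(\<integral>\<^sup>+u. ennreal (r * exp (- r * u)) * indicator {0<..x} u \<partial>lborel) =
          (\<integral>\<^sup>+u. ennreal (r * exp (- r * u)) * indicator {0..x} u \<partial>lborel)"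
      by (intro nn_integral_cong_AE, rule AE_mp[OF AE_lborel_singleton[of 0]]) (auto split: split_indicator)
    also have "\<dots> = ennreal (- exp (- r * x) - (- exp (- r * 0)))"
      using x r by (intro nn_integral_FTC_Icc) (auto intro!: derivative_eq_intros)
    finally show "(\<integral>\<^sup>+u. ennreal (r * exp (- r * u)) * indicator {0<..x} u \<partial>lborel) = ennreal (1 - exp (- r * x))" by simp
  qed (use s r in auto)
  also have "\<dots> = (\<integral>\<^sup>+u. ennreal (r / (-s)) * (ennreal (u powr (s + 1 - 1) * exp (- r * u)) * indicator {0<..} u) \<partial>lborel)"
    using s r by (intro nn_integral_cong) (auto simp: ennreal_mult'[symmetric] field_simps divide_nonneg_neg split: split_indicator)
  also have "\<dots> = ennreal (r / (-s)) * (\<integral>\<^sup>+u. ennreal (u powr (s + 1 - 1) * exp (- r * u)) * indicator {0<..} u \<partial>lborel)"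
    by (rule nn_integral_cmult) auto
  also have "\<dots> = ennreal (r / (-s)) * ennreal (Gamma (s + 1) * r powr (- (s + 1)))"
    using s r by (subst nn_integral_Gamma_scaled) auto
  also have "\<dots> = ennreal (r powr (-s) * (Gamma (s + 1) / (-s)))"
    using s r by (subst ennreal_mult'[symmetric]) (auto simp: powr_diff powr_minus field_simps divide_nonneg_neg powr_add)
  finally show ?thesis .
qed

text \<open>The same reduction one level higher, with exponent \<open>s - 1\<close>: the first
  factor is the primitive of \<open>r * (1 - exp (- r * u))\<close>.\<close>

lemma nn_integral_Mellin_exp_second_difference:
  fixes s r :: real
  assumes s: "-1 < s" "s < 0" and r: "r > 0"
  shows "(\<integral>\<^sup>+x. ennreal ((exp (- r * x) - 1 + r * x) * x powr (s - 2)) * indicator {0<..} x \<partial>lborel) =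
         ennreal (r powr (1 - s) / (1 - s) * (Gamma (s + 1) / (-s)))"
proof -
  have ge: "exp (- r * x) - 1 + r * x \<ge> 0" for x using exp_ge_add_one_self[of "- r * x"] by simp
  have "(\<integral>\<^sup>+x. ennreal ((exp (- r * x) - 1 + r * x) * x powr ((s - 1) - 1)) * indicator {0<..} x \<partial>lborel) =
     (\<integral>\<^sup>+u. ennreal (r * (1 - exp (- r * u)) * u powr (s - 1) / (-(s-1))) * indicator {0<..} u \<partial>lborel)"
  proof (rule nn_integral_Mellin_primitive)
    fix x :: real assume x: "x > 0"
    have "(\<integral>\<^sup>+u. ennreal (r * (1 - exp (- r * u))) * indicator {0<..x} u \<partial>lborel) =
          (\<integral>\<^sup>+u. ennreal (r * (1 - exp (- r * u))) * indicator {0..x} u \<partial>lborel)"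
      by (intro nn_integral_cong_AE, rule AE_mp[OF AE_lborel_singleton[of 0]]) (auto split: split_indicator)
    also have "\<dots> = ennreal ((exp (- r * x) + r * x) - (exp (- r * 0) + r * 0))"
      using x r by (intro nn_integral_FTC_Icc) (auto intro!: derivative_eq_intros simp: algebra_simps)
    finally show "(\<integral>\<^sup>+u. ennreal (r * (1 - exp (- r * u))) * indicator {0<..x} u \<partial>lborel) = ennreal (exp (- r * x) - 1 + r * x)"
      by (simp add: algebra_simps)
  qed (use s r ge in auto)
  also have "\<dots> = (\<integral>\<^sup>+u. ennreal (r / (1 - s)) * (ennreal ((1 - exp (- r * u)) * u powr (s - 1)) * indicator {0<..} u) \<partial>lborel)"
    using s r by (intro nn_integral_cong) (auto simp: ennreal_mult'[symmetric] field_simps split: split_indicator)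
  also have "\<dots> = ennreal (r / (1 - s)) * (\<integral>\<^sup>+u. ennreal ((1 - exp (- r * u)) * u powr (s - 1)) * indicator {0<..} u \<partial>lborel)"
    by (rule nn_integral_cmult) auto
  also have "\<dots> = ennreal (r / (1 - s)) * ennreal (r powr (-s) * (Gamma (s + 1) / (-s)))"
    using s r by (subst nn_integral_Mellin_1_minus_exp) auto
  also have "\<dots> = ennreal (r powr (1 - s) / (1 - s) * (Gamma (s + 1) / (-s)))"
    using s r by (subst ennreal_mult'[symmetric]) (auto simp: powr_diff powr_minus field_simps)
  finally show ?thesis by simp
qed

section \<open>Partial fractions of the Bose kernel\<close>

text \<open>Logarithmic derivative of the reflection formula:
  \<open>Gamma w * Gamma (1 - w) * sin (of_real pi * w)\<close> is constant near \<open>z\<close>,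
  so the derivative given by the product rule vanishes.\<close>

lemma cot_Digamma_reflection:
  fixes z :: complex
  assumes z: "z \<notin> \<int>"
  shows "of_real pi * cos (of_real pi * z) = sin (of_real pi * z) * (Digamma (1 - z) - Digamma z)"
proof -
  have z1: "1 - z \<notin> \<int>" using z by (metis Ints_1 Ints_diff add_diff_cancel_left' diff_add_cancel minus_diff_eq)
  have nz: "z \<notin> \<int>\<^sub>\<le>\<^sub>0" "1 - z \<notin> \<int>\<^sub>\<le>\<^sub>0" using z z1 by (auto dest: nonpos_Ints_Int)
  have sn: "sin (of_real pi * w) \<noteq> 0" if w: "w \<notin> \<int>" for w :: complex
    using w by (subst sin_eq_0) (auto simp: Ints_def)
  have c: "Gamma w * Gamma (1 - w) * sin (of_real pi * w) = of_real pi" if "w \<notin> \<int>" for w :: complex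
    using Gamma_reflection_complex[of w] sn[OF that] by simp
  have "((\<lambda>w. Gamma w * Gamma (1 - w) * sin (of_real pi * w)) has_field_derivative
     (Gamma z * Gamma (1 - z)) * (of_real pi * cos (of_real pi * z) - sin (of_real pi * z) * (Digamma (1 - z) - Digamma z))) (at z)"
    using nz by (auto intro!: derivative_eq_intros simp: algebra_simps)
  moreover have "((\<lambda>w. Gamma w * Gamma (1 - w) * sin (of_real pi * w)) has_field_derivative 0) (at z)"
  proof (subst DERIV_cong_ev[OF refl _ refl])
    have "open (- \<int> :: complex set)" by (simp add: open_Compl)
    hence "eventually (\<lambda>w. w \<in> - \<int>) (nhds z)" using z by (intro eventually_nhds_in_open) auto
    thus "\<forall>\<^sub>F w in nhds z. Gamma w * Gamma (1 - w) * sin (of_real pi * w) = of_real pi"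
      by eventually_elim (use c in auto)
  qed auto
  ultimately have "(Gamma z * Gamma (1 - z)) * (of_real pi * cos (of_real pi * z) - sin (of_real pi * z) * (Digamma (1 - z) - Digamma z)) = 0"
    by (rule DERIV_unique)
  thus ?thesis using nz by (auto simp: Gamma_eq_zero_iff)
qed

text \<open>The logarithms in the limit formulas for the two \<open>Digamma\<close> values cancel.
  The finite sums pair up after shifting one of them by an index, which costs 1/z and a boundary
  term 1/(z + m) tending to 0.\<close>

lemma Digamma_reflection_sums:
  fixes z :: complex
  assumes z: "z \<notin> \<int>"
  shows "(\<lambda>n. 1 / (z + of_nat (Suc n)) + 1 / (z - of_nat (Suc n))) sums (Digamma (1 - z) - Digamma z - 1 / z)"
proof -
  have "z \<noteq> 0" using z by auto
  have "1 - z \<noteq> 0" using z by auto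
  have "(\<lambda>m. (of_real (ln (real m)) - (\<Sum>n<m. inverse (1 - z + of_nat n))) - (of_real (ln (real m)) - (\<Sum>n<m. inverse (z + of_nat n)))) \<longlonglongrightarrow>
    Digamma (1 - z) - Digamma z"
    by (intro tendsto_diff Digamma_LIMSEQ \<open>z \<noteq> 0\<close> \<open>1 - z \<noteq> 0\<close>)
  moreover have "(\<lambda>m. 1 / (z + of_nat m)) \<longlonglongrightarrow> 0"
    by (intro tendsto_divide_0[OF tendsto_const] tendsto_add_filterlim_at_infinity[OF tendsto_const] tendsto_of_nat)
  ultimately have "(\<lambda>m. (of_real (ln (real m)) - (\<Sum>n<m. inverse (1 - z + of_nat n))) - (of_real (ln (real m)) - (\<Sum>n<m. inverse (z + of_nat n)))
      + 1 / (z + of_nat m) - 1 / z) \<longlonglongrightarrow> Digamma (1 - z) - Digamma z + 0 - 1 / z"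
    by (intro tendsto_diff[OF tendsto_add tendsto_const])
  moreover have "(of_real (ln (real m)) - (\<Sum>n<m. inverse (1 - z + of_nat n))) - (of_real (ln (real m)) - (\<Sum>n<m. inverse (z + of_nat n)))
      + 1 / (z + of_nat m) - 1 / z = (\<Sum>n<m. 1 / (z + of_nat (Suc n)) + 1 / (z - of_nat (Suc n)))" for m
  proof -
    have "(\<Sum>n<m. inverse (z + of_nat n)) + 1 / (z + of_nat m) = 1 / z + (\<Sum>n<m. 1 / (z + of_nat (Suc n)))"
      using sum.lessThan_Suc_shift[of "\<lambda>n. 1 / (z + of_nat n)" m] by (simp add: inverse_eq_divide)
    moreover have "inverse (1 - z + of_nat n) = - (1 / (z - of_nat (Suc n)))" for n
      by (simp add: divide_simps) (auto simp: algebra_simps)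
    ultimately show ?thesis by (simp add: sum.distrib sum_negf algebra_simps)
  qed
  ultimately show ?thesis by (simp add: sums_def)
qed

text \<open>This is 1/(exp x - 1) without the part 1/x - 1/2 of its Laurent expansion at 0. It is of
  order x at 0 and tends to 1/2 at infinity, so its Mellin integral converges exactly for -1 < s <
  0.\<close>

definition bose_kernel :: "real \<Rightarrow> real" where
  "bose_kernel x = 1 / (exp x - 1) - 1 / x + 1 / 2"

text \<open>The cotangent expansion at the imaginary point i x/(2 pi): the terms for n and -n
  combine to a multiple of a real fraction, and the cotangent becomes coth(x/2) = 1 + 2/(exp x -
  1).\<close>

lemma bose_kernel_sums:
  assumes x: "x > 0"
  shows "(\<lambda>n. 2 * x / (x\<^sup>2 + (2 * pi * real (Suc n))\<^sup>2)) sums bose_kernel x"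
proof -
  define z where "z = \<i> * of_real (x / (2 * pi))"
  have z: "z \<notin> \<int>"
  proof
    assume "z \<in> \<int>"
    then obtain k where "z = of_int k" by (auto simp: Ints_def)
    hence "Im z = 0" by simp
    thus False using x by (simp add: z_def)
  qed
  have pz: "of_real pi * z = \<i> * of_real (x / 2)" by (simp add: z_def)
  have trm: "1 / (z + of_nat (Suc n)) + 1 / (z - of_nat (Suc n)) =
      (- 2 * pi * \<i>) * of_real (2 * x / (x\<^sup>2 + (2 * pi * real (Suc n))\<^sup>2))" for n
  proof -
    define m where "m = real (Suc n)"
    have m: "m > 0" by (simp add: m_def)
    have nz: "z + of_real m \<noteq> 0" "z - of_real m \<noteq> 0"
      using x by (auto simp: z_def complex_eq_iff)
    have "x\<^sup>2 + (2 * pi * m)\<^sup>2 > 0" using x by (intro add_pos_nonneg) auto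
    hence nz2: "x\<^sup>2 + (2 * pi * m)\<^sup>2 \<noteq> 0" by linarith
    have p: "(z + of_real m) * (z - of_real m) = - of_real ((x\<^sup>2 + (2 * pi * m)\<^sup>2) / (4 * pi\<^sup>2))"
      by (simp add: z_def algebra_simps power2_eq_square add_divide_distrib complex_eq_iff)
    have "1 / (z + of_real m) + 1 / (z - of_real m) = 2 * z / ((z + of_real m) * (z - of_real m))"
      using nz by (simp add: divide_simps)
    also have "\<dots> = (- 2 * pi * \<i>) * of_real (2 * x / (x\<^sup>2 + (2 * pi * m)\<^sup>2))"
      unfolding p using nz2 by (simp add: z_def divide_simps complex_eq_iff power2_eq_square)
    finally show ?thesis by (simp add: m_def)
  qed
  \<comment> \<open>In terms of \<open>y\<close> the sine and cosine at pi z are rational up to a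
    factor i, and \<open>y * y\<close> is \<open>exp x\<close>.\<close>
  define y where "y = exp (x / 2)"
  have y: "y > 1" using x by (simp add: y_def)
  have "y * y > 1" using y by (rule less_1_mult) (use y in auto)
  hence y2: "y * y - 1 \<noteq> 0" by linarith
  have ey: "exp (complex_of_real (x / 2)) = of_real y" unfolding y_def by (rule exp_of_real)
  have cs: "cos (of_real pi * z) = of_real ((y + 1 / y) / 2)" "sin (of_real pi * z) = \<i> * of_real ((y - 1 / y) / 2)"
    unfolding pz cos_i_times sin_i_times ey by (simp_all add: exp_minus ey inverse_eq_divide)
  have ratio: "(y + 1 / y) / (y - 1 / y) = (y * y + 1) / (y * y - 1)" using y y2 by (simp add: divide_simps)
  have sh: "y - 1 / y \<noteq> 0" using y y2 by (simp add: divide_simps)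
  have "Digamma (1 - z) - Digamma z = of_real pi * cos (of_real pi * z) / sin (of_real pi * z)"
    using cot_Digamma_reflection[OF z] sh unfolding cs by (simp add: divide_simps mult.commute)
  also have "\<dots> = - \<i> * of_real (pi * ((y + 1 / y) / (y - 1 / y)))"
    unfolding cs using sh by (simp add: divide_simps)
  finally have D: "Digamma (1 - z) - Digamma z = - \<i> * of_real (pi * ((y * y + 1) / (y * y - 1)))" unfolding ratio .
  have "Digamma (1 - z) - Digamma z - 1 / z = (- 2 * pi * \<i>) * of_real ((y * y + 1) / (y * y - 1) / 2 - 1 / x)"
  proof -
    have "1 / z = - \<i> * of_real (2 * pi / x)" using x by (simp add: z_def divide_simps)
    moreover have "- \<i> * of_real (pi * R) - - \<i> * of_real (2 * pi / x) = (- 2 * pi * \<i>) * of_real (R / 2 - 1 / x)" for R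
      using x by (simp add: complex_eq_iff field_simps)
    ultimately show ?thesis unfolding D by (simp only:)
  qed
  also have "(y * y + 1) / (y * y - 1) / 2 - 1 / x = bose_kernel x"
  proof -
    have e: "exp x = y * y" by (simp add: exp_add[symmetric] y_def)
    have "(y * y + 1) / (y * y - 1) / 2 = 1 / (y * y - 1) + 1 / 2"
      using y2 by (simp add: field_simps)
    thus ?thesis unfolding bose_kernel_def e by simp
  qed
  finally have "(\<lambda>n. (- 2 * pi * \<i>) * of_real (2 * x / (x\<^sup>2 + (2 * pi * real (Suc n))\<^sup>2))) sums
     ((- 2 * pi * \<i>) * of_real (bose_kernel x))" 
    using Digamma_reflection_sums[OF z] unfolding trm by simp
  hence "(\<lambda>n. complex_of_real (2 * x / (x\<^sup>2 + (2 * pi * real (Suc n))\<^sup>2))) sums of_real (bose_kernel x)"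
    by (subst (asm) sums_mult_iff) auto
  thus ?thesis by (simp only: sums_of_real_iff)
qed

text \<open>The sign is visible term by term in the partial fractions. The embedding into
  \<open>ennreal\<close> and monotone convergence rest on it.\<close>

lemma bose_kernel_nonneg: "x > 0 \<Longrightarrow> bose_kernel x \<ge> 0"
  by (rule sums_le[OF _ sums_zero bose_kernel_sums]) auto

lemma bose_kernel_measurable [measurable]: "bose_kernel \<in> borel_measurable borel"
  unfolding bose_kernel_def[abs_def] by measurable

section \<open>Mellin transforms of a Gaussian and of a single partial fraction\<close>

text \<open>The substitution y = x^2 produces a Gamma integral. It is carried out on [0, n] and
  passes to the half-line by monotone convergence.\<close>

lemma nn_integral_powr_gaussian:
  fixes s v :: real
  assumes s: "-1 < s" and v: "v > 0"
  shows "(\<integral>\<^sup>+x. ennreal (x powr s * exp (- v * x\<^sup>2)) * indicator {0<..} x \<partial>lborel) =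
    ennreal (Gamma ((1 + s) / 2) / 2 * v powr (- (1 + s) / 2))"
proof -
  \<comment> \<open>Chosen so that \<open>f (x\<^sup>2) * (2 * x)\<close> is the given integrand for
    x > 0.\<close>
  define f where "f = (\<lambda>y::real. y powr ((s - 1) / 2) * exp (- v * y) / 2)"
  have [measurable]: "f \<in> borel_measurable borel" unfolding f_def by measurable
  have drop0: "(\<integral>\<^sup>+x. h x * indicator {0..} x \<partial>lborel) = (\<integral>\<^sup>+x. h x * indicator {0<..} x \<partial>lborel)" for h :: "real \<Rightarrow> ennreal"
    by (intro nn_integral_cong_AE, rule AE_mp[OF AE_lborel_singleton[of 0]]) (auto split: split_indicator)
  have sub: "(\<integral>\<^sup>+y. ennreal (f y) * indicator {0..(real n)\<^sup>2} y \<partial>lborel) =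
     (\<integral>\<^sup>+x. ennreal (f (x\<^sup>2) * (2 * x)) * indicator {0..real n} x \<partial>lborel)" for n
  proof -
    have "((\<lambda>x. x\<^sup>2) has_real_derivative 2 * x) (at x)" for x :: real
      by (auto intro!: derivative_eq_intros)
    thus ?thesis using nn_integral_substitution[of "\<lambda>x. x\<^sup>2" 0 "real n" f "\<lambda>x. 2 * x"]
      by (simp add: set_borel_measurable_def continuous_on_mult_left ennreal_mult'' ennreal_indicator)
  qed
  have lim: "(\<integral>\<^sup>+y. h y * indicator {0..} y \<partial>lborel) = (SUP n. (\<integral>\<^sup>+y. h y * indicator {0..g n} y \<partial>lborel))"
    if [measurable]: "h \<in> borel_measurable borel" and g: "mono g" "\<And>y. \<exists>n. y \<le> g n" for h :: "real \<Rightarrow> ennreal" and g :: "nat \<Rightarrow> real"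
  proof -
    have "(SUP n. h y * indicator {0..g n} y) = h y * indicator {0..} y" for y
    proof (rule antisym)
      show "(SUP n. h y * indicator {0..g n} y) \<le> h y * indicator {0..} y"
        by (intro SUP_least) (auto split: split_indicator)
      obtain n where "y \<le> g n" using g(2) by blast
      thus "h y * indicator {0..} y \<le> (SUP n. h y * indicator {0..g n} y)"
        by (intro SUP_upper2[of n]) (auto split: split_indicator)
    qed
    hence "(\<integral>\<^sup>+y. h y * indicator {0..} y \<partial>lborel) = (\<integral>\<^sup>+y. (SUP n. h y * indicator {0..g n} y) \<partial>lborel)" by simp
    also have "\<dots> = (SUP n. (\<integral>\<^sup>+y. h y * indicator {0..g n} y \<partial>lborel))"
    proof (rule nn_integral_monotone_convergence_SUP)
      show "incseq (\<lambda>n y. h y * indicator {0..g n} y)"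
        using g(1) by (auto simp: mono_def le_fun_def split: split_indicator intro: order.trans)
    qed measurable
    finally show ?thesis .
  qed
  have ub: "\<exists>n. y \<le> real n" for y by (rule real_arch_simple)
  have ub2: "\<exists>n. y \<le> (real n)\<^sup>2" for y
  proof -
    obtain n where "y \<le> real n" using ub by blast
    moreover have "real n \<le> (real n)\<^sup>2" by (cases "n = 0") (auto intro: self_le_power)
    ultimately show ?thesis by (intro exI[of _ n]) linarith
  qed
  have "(\<integral>\<^sup>+x. ennreal (x powr s * exp (- v * x\<^sup>2)) * indicator {0<..} x \<partial>lborel) =
        (\<integral>\<^sup>+x. ennreal (f (x\<^sup>2) * (2 * x)) * indicator {0<..} x \<partial>lborel)"
  proof (intro nn_integral_cong)
    fix x :: real
    have "f (x\<^sup>2) * (2 * x) = x powr s * exp (- v * x\<^sup>2)" if x: "x > 0"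
    proof -
      have "(x\<^sup>2) powr ((s - 1) / 2) = x powr (s - 1)"
      proof -
        have "2 * ((s - 1) / 2) = s - 1" by simp
        thus ?thesis by (simp only: powr_powr powr_numeral[OF less_imp_le[OF x], symmetric])
      qed
      thus ?thesis using x by (simp add: f_def powr_diff)
    qed
    thus "ennreal (x powr s * exp (- v * x\<^sup>2)) * indicator {0<..} x = ennreal (f (x\<^sup>2) * (2 * x)) * indicator {0<..} x"
      by (cases "x > 0") (simp only:, simp add: indicator_def)
  qed
  also have "\<dots> = (\<integral>\<^sup>+x. ennreal (f (x\<^sup>2) * (2 * x)) * indicator {0..} x \<partial>lborel)" by (rule drop0[symmetric])
  also have "\<dots> = (SUP n. (\<integral>\<^sup>+x. ennreal (f (x\<^sup>2) * (2 * x)) * indicator {0..real n} x \<partial>lborel))"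
    by (rule lim) (use ub in \<open>auto simp: mono_def\<close>)
  also have "\<dots> = (SUP n. (\<integral>\<^sup>+y. ennreal (f y) * indicator {0..(real n)\<^sup>2} y \<partial>lborel))" by (simp only: sub)
  also have "\<dots> = (\<integral>\<^sup>+y. ennreal (f y) * indicator {0..} y \<partial>lborel)"
    by (rule lim[symmetric]) (use ub2 in \<open>auto simp: mono_def power_mono\<close>)
  also have "\<dots> = (\<integral>\<^sup>+y. ennreal (f y) * indicator {0<..} y \<partial>lborel)" by (rule drop0)
  also have "\<dots> = (\<integral>\<^sup>+y. ennreal (1/2) * (ennreal (y powr ((1 + s) / 2 - 1) * exp (- v * y)) * indicator {0<..} y) \<partial>lborel)"
  proof (intro nn_integral_cong)
    fix y :: real
    have e: "(1 + s) / 2 - 1 = (s - 1) / 2" by (simp add: field_simps)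
    show "ennreal (f y) * indicator {0<..} y = ennreal (1/2) * (ennreal (y powr ((1 + s) / 2 - 1) * exp (- v * y)) * indicator {0<..} y)"
      unfolding f_def e mult.assoc[symmetric] by (subst ennreal_mult'[symmetric]) (simp_all add: mult_ac)
  qed
  also have "\<dots> = ennreal (1/2) * (\<integral>\<^sup>+y. ennreal (y powr ((1 + s) / 2 - 1) * exp (- v * y)) * indicator {0<..} y \<partial>lborel)"
    by (rule nn_integral_cmult) auto
  also have "\<dots> = ennreal (1/2) * ennreal (Gamma ((1 + s) / 2) * v powr (- ((1 + s) / 2)))"
    using s v by (subst nn_integral_Gamma_scaled) auto
  also have "\<dots> = ennreal (Gamma ((1 + s) / 2) / 2 * v powr (- (1 + s) / 2))"
    by (subst ennreal_mult'[symmetric]) (simp_all add: minus_divide_left)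
  finally show ?thesis .
qed

text \<open>The denominator is opened up as a Laplace integral: 1/(x^2 + k^2) is the integral of
  exp(-(x^2 + k^2) v) over v > 0. After Tonelli the x-integral is Gaussian and the v-integral is
  again a Gamma integral.\<close>

lemma nn_integral_powr_over_sum_squares:
  fixes s k :: real
  assumes s: "-1 < s" "s < 1" and k: "k > 0"
  shows "(\<integral>\<^sup>+x. ennreal (x powr s / (x\<^sup>2 + k\<^sup>2)) * indicator {0<..} x \<partial>lborel) =
    ennreal (Gamma ((1 + s) / 2) * Gamma ((1 - s) / 2) / 2 * k powr (s - 1))"
proof -
  \<comment> \<open>The factor \<open>v powr (1 - 1)\<close> is 1 for v > 0; it gives the inner
    integral the shape of \<open>nn_integral_Gamma_scaled\<close> at \<open>y = 1\<close>.\<close>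
  have "(\<integral>\<^sup>+x. ennreal (x powr s / (x\<^sup>2 + k\<^sup>2)) * indicator {0<..} x \<partial>lborel) =
    (\<integral>\<^sup>+x. (\<integral>\<^sup>+v. (ennreal (x powr s) * indicator {0<..} x) * (ennreal (v powr (1 - 1) * exp (- (x\<^sup>2 + k\<^sup>2) * v)) * indicator {0<..} v) \<partial>lborel) \<partial>lborel)"
  proof (intro nn_integral_cong)
    fix x :: real
    have p: "x\<^sup>2 + k\<^sup>2 > 0" using k by (simp add: add_nonneg_pos)
    have "(\<integral>\<^sup>+v. (ennreal (x powr s) * indicator {0<..} x) * (ennreal (v powr (1 - 1) * exp (- (x\<^sup>2 + k\<^sup>2) * v)) * indicator {0<..} v) \<partial>lborel)
       = (ennreal (x powr s) * indicator {0<..} x) * (\<integral>\<^sup>+v. (ennreal (v powr (1 - 1) * exp (- (x\<^sup>2 + k\<^sup>2) * v)) * indicator {0<..} v) \<partial>lborel)"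
      by (rule nn_integral_cmult) measurable
    also have "(\<integral>\<^sup>+v. (ennreal (v powr (1 - 1) * exp (- (x\<^sup>2 + k\<^sup>2) * v)) * indicator {0<..} v) \<partial>lborel) = ennreal (Gamma 1 * (x\<^sup>2 + k\<^sup>2) powr (-1))"
      by (rule nn_integral_Gamma_scaled) (use p in auto)
    finally show "ennreal (x powr s / (x\<^sup>2 + k\<^sup>2)) * indicator {0<..} x = (\<integral>\<^sup>+v. (ennreal (x powr s) * indicator {0<..} x) * (ennreal (v powr (1 - 1) * exp (- (x\<^sup>2 + k\<^sup>2) * v)) * indicator {0<..} v) \<partial>lborel)"
      using p by (auto simp: powr_minus_divide ennreal_mult'[symmetric] split: split_indicator)
  qed
  also have "\<dots> = (\<integral>\<^sup>+v. (\<integral>\<^sup>+x. (ennreal (x powr s) * indicator {0<..} x) * (ennreal (v powr (1 - 1) * exp (- (x\<^sup>2 + k\<^sup>2) * v)) * indicator {0<..} v) \<partial>lborel) \<partial>lborel)"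
    by (rule lborel_pair.Fubini') measurable
  also have "\<dots> = (\<integral>\<^sup>+v. ennreal (Gamma ((1 + s) / 2) / 2) * (ennreal (v powr ((1 - s) / 2 - 1) * exp (- k\<^sup>2 * v)) * indicator {0<..} v) \<partial>lborel)"
  proof (intro nn_integral_cong)
    fix v :: real
    show "(\<integral>\<^sup>+x. (ennreal (x powr s) * indicator {0<..} x) * (ennreal (v powr (1 - 1) * exp (- (x\<^sup>2 + k\<^sup>2) * v)) * indicator {0<..} v) \<partial>lborel)
      = ennreal (Gamma ((1 + s) / 2) / 2) * (ennreal (v powr ((1 - s) / 2 - 1) * exp (- k\<^sup>2 * v)) * indicator {0<..} v)"
    proof (cases "v > 0")
      case True
      have "(\<integral>\<^sup>+x. (ennreal (x powr s) * indicator {0<..} x) * (ennreal (v powr (1 - 1) * exp (- (x\<^sup>2 + k\<^sup>2) * v)) * indicator {0<..} v) \<partial>lborel)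
        = (\<integral>\<^sup>+x. ennreal (exp (- k\<^sup>2 * v)) * (ennreal (x powr s * exp (- v * x\<^sup>2)) * indicator {0<..} x) \<partial>lborel)"
        using True by (intro nn_integral_cong) (auto simp: ennreal_mult'[symmetric] exp_add[symmetric] algebra_simps split: split_indicator)
      also have "\<dots> = ennreal (exp (- k\<^sup>2 * v)) * (\<integral>\<^sup>+x. (ennreal (x powr s * exp (- v * x\<^sup>2)) * indicator {0<..} x) \<partial>lborel)"
        by (rule nn_integral_cmult) auto
      also have "\<dots> = ennreal (exp (- k\<^sup>2 * v)) * ennreal (Gamma ((1 + s) / 2) / 2 * v powr (- (1 + s) / 2))"
        using s True by (subst nn_integral_powr_gaussian) auto
      also have "- (1 + s) / 2 = (1 - s) / 2 - 1" by (simp add: field_simps)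
      finally show ?thesis using True Gamma_real_pos[of "(1 + s) / 2"] s
        by (simp add: ennreal_mult'[symmetric] mult_ac)
    qed auto
  qed
  also have "\<dots> = ennreal (Gamma ((1 + s) / 2) / 2) * (\<integral>\<^sup>+v. (ennreal (v powr ((1 - s) / 2 - 1) * exp (- k\<^sup>2 * v)) * indicator {0<..} v) \<partial>lborel)"
    by (rule nn_integral_cmult) auto
  also have "\<dots> = ennreal (Gamma ((1 + s) / 2) / 2) * ennreal (Gamma ((1 - s) / 2) * (k\<^sup>2) powr (- ((1 - s) / 2)))"
    using s k by (subst nn_integral_Gamma_scaled) auto
  also have "(k\<^sup>2) powr (- ((1 - s) / 2)) = k powr (s - 1)"
  proof -
    have "2 * (- ((1 - s) / 2)) = s - 1" by (simp add: field_simps)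
    thus ?thesis using k by (simp only: powr_powr powr_numeral[OF less_imp_le[OF k], symmetric])
  qed
  finally show ?thesis using Gamma_real_pos[of "(1 + s) / 2"] s
    by (simp add: ennreal_mult'[symmetric] mult_ac)
qed

lemma Gamma_half_reflection:
  fixes s :: real
  assumes "-1 < s" "s < 1"
  shows "Gamma ((1 + s) / 2) * Gamma ((1 - s) / 2) = pi / cos (pi * s / 2)"
proof -
  have "complex_of_real (Gamma ((1 + s) / 2) * Gamma ((1 - s) / 2)) = Gamma (of_real ((1 + s) / 2)) * Gamma (1 - of_real ((1 + s) / 2))"
  proof -
    have "1 - complex_of_real ((1 + s) / 2) = of_real ((1 - s) / 2)" by (simp add: complex_eq_iff field_simps)
    thus ?thesis by (simp only: Gamma_complex_of_real of_real_mult)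
  qed
  also have "\<dots> = of_real (pi / sin (pi * ((1 + s) / 2)))"
    by (simp only: Gamma_reflection_complex of_real_divide of_real_mult of_real_numeral sin_of_real[symmetric])
  also have "sin (pi * ((1 + s) / 2)) = cos (pi * s / 2)"
    by (simp add: sin_add add_divide_distrib distrib_left)
  finally show ?thesis by (simp only: of_real_eq_iff)
qed

section \<open>Two evaluations of the Mellin transform of the Bose kernel\<close>

lemma geometric_exp_sum:
  fixes x :: real
  assumes "x > 0"
  shows "(\<Sum>n=1..N. exp (- real n * x)) = (1 - exp (- real N * x)) / (exp x - 1)"
proof (induction N)
  case (Suc N)
  have nz: "exp x - 1 \<noteq> 0" using assms by simp
  have e: "exp (- real N * x) = exp (- real (Suc N) * x) * exp x"
    by (simp add: exp_add[symmetric] algebra_simps)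
  have "(\<Sum>n=1..Suc N. exp (- real n * x)) = (1 - exp (- real (Suc N) * x) * exp x) / (exp x - 1) + exp (- real (Suc N) * x)"
    unfolding e[symmetric] using Suc by (simp del: of_nat_Suc)
  also have "\<dots> = (1 - exp (- real (Suc N) * x)) / (exp x - 1)"
  proof -
    have "(1 - y * e) / (e - 1) + y = (1 - y) / (e - 1)" if "e - 1 \<noteq> 0" for y e :: real
      using that by (simp add: divide_simps) (simp add: algebra_simps)
    thus ?thesis using nz by blast
  qed
  finally show ?case .
qed auto

text \<open>The geometric sum turns \<open>(1 - exp (- real N * x)) / (exp x - 1)\<close> into a
  finite sum of exponentials. For s < 0 these are not separately integrable against
  \<open>x powr (s - 1)\<close> at 0, whereas \<open>1 - exp (- real n * x)\<close> and
  \<open>exp (- real N * x) - 1 + real N * x\<close> have the Mellin transforms computed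
  above.\<close>

lemma nn_integral_bose_kernel_truncated:
  fixes s :: real
  assumes s: "-1 < s" "s < 0" and N: "N > 0"
  shows "(\<integral>\<^sup>+x. ennreal ((1 - exp (- real N * x)) * bose_kernel x * x powr (s - 1)) * indicator {0<..} x \<partial>lborel) =
    ennreal (Gamma (s + 1) / s * ((\<Sum>n=1..N. real n powr (-s)) - real N powr (1 - s) / (1 - s) - real N powr (-s) / 2))"
    (is "?I = _")
proof -
  define g where "g = Gamma (s + 1) / (-s)"
  have g: "g \<ge> 0" using Gamma_real_pos[of "s + 1"] s by (simp add: g_def divide_nonneg_neg)
  let ?J = "\<lambda>n. (\<integral>\<^sup>+x. ennreal ((1 - exp (- real n * x)) * x powr (s - 1)) * indicator {0<..} x \<partial>lborel)"
  let ?K = "(\<integral>\<^sup>+x. ennreal ((exp (- real N * x) - 1 + real N * x) * x powr (s - 2)) * indicator {0<..} x \<partial>lborel)"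
  have J: "?J n = ennreal (real n powr (-s) * g)" if "n > 0" for n
    using nn_integral_Mellin_1_minus_exp[of s "real n"] s that by (simp add: g_def)
  have K: "?K = ennreal (real N powr (1 - s) / (1 - s) * g)"
    using nn_integral_Mellin_exp_second_difference[of s "real N"] s N by (simp add: g_def)
  \<comment> \<open>The terms with a negative sign are moved across, so that both sides are sums of
    nonnegative terms. The N ones on the left match \<open>real N * x / x\<close> on the
    right.\<close>
  have pt: "ennreal ((1 - exp (- real N * x)) * bose_kernel x * x powr (s - 1)) * indicator {0<..} x
      + (\<Sum>n=1..N. ennreal ((1 - exp (- real n * x)) * x powr (s - 1)) * indicator {0<..} x)
     = ennreal ((exp (- real N * x) - 1 + real N * x) * x powr (s - 2)) * indicator {0<..} x
      + ennreal (1 / 2) * (ennreal ((1 - exp (- real N * x)) * x powr (s - 1)) * indicator {0<..} x)" for x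
  proof (cases "x > 0")
    case True
    define E where "E = exp (- real N * x)"
    have E: "E \<le> 1" using True by (simp add: E_def)
    have E2: "E - 1 + real N * x \<ge> 0" using exp_ge_add_one_self[of "- real N * x"] by (simp add: E_def)
    have nz: "exp x - 1 \<noteq> 0" using True by simp
    have S: "(\<Sum>n=1..N. (1 - exp (- real n * x)) * x powr (s - 1)) = (real N - (1 - E) / (exp x - 1)) * x powr (s - 1)"
      unfolding sum_distrib_right[symmetric] sum_subtractf geometric_exp_sum[OF True] E_def by simp
    have id: "(1 - E) * bose_kernel x + (real N - (1 - E) / (exp x - 1)) = (E - 1 + real N * x) / x + 1 / 2 * (1 - E)"
      using True nz by (simp add: bose_kernel_def divide_simps) (simp add: algebra_simps)
    have p2: "x powr (s - 2) = x powr (s - 1) / x"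
    proof -
      have "s - 2 = (s - 1) - 1" by simp
      thus ?thesis using True by (simp only: powr_diff powr_one[OF less_imp_le])
    qed
    have "(1 - E) * bose_kernel x * x powr (s - 1) + (\<Sum>n=1..N. (1 - exp (- real n * x)) * x powr (s - 1))
      = ((1 - E) * bose_kernel x + (real N - (1 - E) / (exp x - 1))) * x powr (s - 1)"
      unfolding S by (simp add: algebra_simps)
    also have "\<dots> = (E - 1 + real N * x) * x powr (s - 2) + 1 / 2 * ((1 - E) * x powr (s - 1))"
    proof -
      have "(A / x + 1 / 2 * B) * p = A * (p / x) + 1 / 2 * (B * p)" for A B p :: real by (simp add: algebra_simps)
      thus ?thesis unfolding id p2 .
    qed
    finally have "ennreal ((1 - E) * bose_kernel x * x powr (s - 1) + (\<Sum>n=1..N. (1 - exp (- real n * x)) * x powr (s - 1)))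
      = ennreal ((E - 1 + real N * x) * x powr (s - 2) + 1 / 2 * ((1 - E) * x powr (s - 1)))" by simp
    moreover have n1: "0 \<le> (1 - E) * bose_kernel x * x powr (s - 1)" using E bose_kernel_nonneg[OF True] by simp
    moreover have n2: "0 \<le> (1 - exp (- real n * x)) * x powr (s - 1)" for n using True by simp
    moreover have n3: "0 \<le> (E - 1 + real N * x) * x powr (s - 2)" "0 \<le> (1 - E) * x powr (s - 1)" using E E2 by auto
    moreover have "(\<Sum>n=1..N. ennreal ((1 - exp (- real n * x)) * x powr (s - 1))) = ennreal (\<Sum>n=1..N. (1 - exp (- real n * x)) * x powr (s - 1))"
      by (rule sum_ennreal) (rule n2)
    moreover have "ennreal (1 / 2 * ((1 - E) * x powr (s - 1))) = ennreal (1 / 2) * ennreal ((1 - E) * x powr (s - 1))"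
      by (rule ennreal_mult') simp
    ultimately have "ennreal ((1 - E) * bose_kernel x * x powr (s - 1)) + (\<Sum>n=1..N. ennreal ((1 - exp (- real n * x)) * x powr (s - 1)))
      = ennreal ((E - 1 + real N * x) * x powr (s - 2)) + ennreal (1 / 2) * ennreal ((1 - E) * x powr (s - 1))"
      by (simp only: ennreal_plus[OF n1 sum_nonneg[OF n2]] ennreal_plus[OF n3(1) mult_nonneg_nonneg[OF _ n3(2)]] zero_le_divide_1_iff zero_le_numeral)
    thus ?thesis using True unfolding E_def[symmetric] by (simp add: indicator_def)
  qed auto
  have "?I + (\<Sum>n=1..N. ?J n) = ?K + ennreal (1 / 2) * ?J N"
  proof -
    define u where "u = (\<lambda>x. ennreal ((1 - exp (- real N * x)) * bose_kernel x * x powr (s - 1)) * indicator {0<..} x)"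
    define v where "v = (\<lambda>n x. ennreal ((1 - exp (- real n * x)) * x powr (s - 1)) * indicator {0<..} x)"
    define w where "w = (\<lambda>x. ennreal ((exp (- real N * x) - 1 + real N * x) * x powr (s - 2)) * indicator {0<..} x)"
    have [measurable]: "u \<in> borel_measurable borel" "v n \<in> borel_measurable borel" "w \<in> borel_measurable borel" for n
      unfolding u_def v_def w_def by measurable
    have "(\<integral>\<^sup>+x. u x + (\<Sum>n=1..N. v n x) \<partial>lborel) = (\<integral>\<^sup>+x. w x + ennreal (1 / 2) * v N x \<partial>lborel)"
      unfolding u_def v_def w_def by (intro nn_integral_cong pt)
    moreover have "(\<integral>\<^sup>+x. u x + (\<Sum>n=1..N. v n x) \<partial>lborel) = integral\<^sup>N lborel u + (\<Sum>n=1..N. integral\<^sup>N lborel (v n))"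
      by (simp add: nn_integral_add nn_integral_sum)
    moreover have "(\<integral>\<^sup>+x. w x + ennreal (1 / 2) * v N x \<partial>lborel) = integral\<^sup>N lborel w + ennreal (1 / 2) * integral\<^sup>N lborel (v N)"
      by (subst nn_integral_add, measurable, subst nn_integral_cmult, measurable)
    ultimately show ?thesis unfolding u_def v_def w_def by simp
  qed
  also have "(\<Sum>n=1..N. ?J n) = (\<Sum>n=1..N. ennreal (real n powr (-s) * g))"
    by (intro sum.cong refl J) auto
  also have "\<dots> = ennreal ((\<Sum>n=1..N. real n powr (-s)) * g)"
    using g by (subst sum_ennreal) (auto simp: sum_distrib_right)
  also have "?K + ennreal (1 / 2) * ?J N = ennreal (real N powr (1 - s) / (1 - s) * g + 1 / 2 * (real N powr (-s) * g))"
    unfolding K J[OF N] using g s by (subst ennreal_mult'[symmetric], simp, subst ennreal_plus[symmetric]) auto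
  finally have "?I + ennreal ((\<Sum>n=1..N. real n powr (-s)) * g) = ennreal (real N powr (1 - s) / (1 - s) * g + 1 / 2 * (real N powr (-s) * g))" .
  note sumeq = this
  \<comment> \<open>Subtraction in \<open>ennreal\<close> undoes the addition because the added term
    is finite.\<close>
  have "?I = ?I + ennreal ((\<Sum>n=1..N. real n powr (-s)) * g) - ennreal ((\<Sum>n=1..N. real n powr (-s)) * g)"
    by (rule ennreal_add_diff_cancel_right[symmetric]) (rule ennreal_neq_top)
  also have "\<dots> = ennreal (real N powr (1 - s) / (1 - s) * g + 1 / 2 * (real N powr (-s) * g)) - ennreal ((\<Sum>n=1..N. real n powr (-s)) * g)"
    by (simp only: sumeq)
  also have "\<dots> = ennreal (real N powr (1 - s) / (1 - s) * g + 1 / 2 * (real N powr (-s) * g) - (\<Sum>n=1..N. real n powr (-s)) * g)"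
    using g by (intro ennreal_minus mult_nonneg_nonneg sum_nonneg) auto
  also have "real N powr (1 - s) / (1 - s) * g + 1 / 2 * (real N powr (-s) * g) - (\<Sum>n=1..N. real n powr (-s)) * g =
    (- g) * ((\<Sum>n=1..N. real n powr (-s)) - real N powr (1 - s) / (1 - s) - real N powr (-s) / 2)"
    by (simp add: algebra_simps)
  also have "- g = Gamma (s + 1) / s" by (simp add: g_def)
  finally show ?thesis .
qed

text \<open>For x > 0 the factor \<open>1 - exp (- real N * x)\<close> increases to 1, so monotone
  convergence applies. The limit \<open>Z\<close> is a regularized sum of a divergent series; it is
  identified with zeta(s) in \<open>riemann_zeta_real_LIMSEQ\<close>.\<close>

lemma nn_integral_bose_kernel_limit:
  fixes s Z :: real
  assumes s: "-1 < s" "s < 0"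
    and Z: "(\<lambda>N. (\<Sum>n=1..N. real n powr (-s)) - real N powr (1 - s) / (1 - s) - real N powr (-s) / 2) \<longlonglongrightarrow> Z"
  shows "(\<integral>\<^sup>+x. ennreal (bose_kernel x * x powr (s - 1)) * indicator {0<..} x \<partial>lborel) = ennreal (Gamma (s + 1) / s * Z)"
proof -
  define f where "f = (\<lambda>N x. ennreal ((1 - exp (- real N * x)) * bose_kernel x * x powr (s - 1)) * indicator {0<..} x)"
  have [measurable]: "f N \<in> borel_measurable borel" for N unfolding f_def by measurable
  have inc: "incseq f"
  proof (intro incseq_SucI le_funI)
    fix N x
    show "f N x \<le> f (Suc N) x"
    proof (cases "x > 0")
      case True
      have "exp (- real (Suc N) * x) \<le> exp (- real N * x)" using True by (simp add: algebra_simps)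
      thus ?thesis unfolding f_def
        using bose_kernel_nonneg[OF True] by (intro mult_right_mono ennreal_leI diff_left_mono) auto
    qed (auto simp: f_def)
  qed
  have "(SUP N. f N x) = ennreal (bose_kernel x * x powr (s - 1)) * indicator {0<..} x" for x
  proof (rule LIMSEQ_unique[OF LIMSEQ_SUP])
    show "incseq (\<lambda>N. f N x)" using inc by (auto simp: incseq_def le_fun_def)
    show "(\<lambda>N. f N x) \<longlonglongrightarrow> ennreal (bose_kernel x * x powr (s - 1)) * indicator {0<..} x"
    proof (cases "x > 0")
      case True
      have "(\<lambda>N. exp (- real N * x)) \<longlonglongrightarrow> 0" using True by real_asymp
      hence "(\<lambda>N. (1 - exp (- real N * x)) * bose_kernel x * x powr (s - 1)) \<longlonglongrightarrow> (1 - 0) * bose_kernel x * x powr (s - 1)"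
        by (intro tendsto_intros)
      thus ?thesis using True by (simp add: f_def tendsto_ennrealI)
    qed (auto simp: f_def)
  qed
  hence "(\<integral>\<^sup>+x. ennreal (bose_kernel x * x powr (s - 1)) * indicator {0<..} x \<partial>lborel) = (\<integral>\<^sup>+x. (SUP N. f N x) \<partial>lborel)" by simp
  also have "\<dots> = (SUP N. (\<integral>\<^sup>+x. f N x \<partial>lborel))"
    by (rule nn_integral_monotone_convergence_SUP[OF inc]) measurable
  finally have 1: "(\<integral>\<^sup>+x. ennreal (bose_kernel x * x powr (s - 1)) * indicator {0<..} x \<partial>lborel) = (SUP N. (\<integral>\<^sup>+x. f N x \<partial>lborel))" .
  have "(\<lambda>N. (\<integral>\<^sup>+x. f N x \<partial>lborel)) \<longlonglongrightarrow> (SUP N. (\<integral>\<^sup>+x. f N x \<partial>lborel))"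
    using inc by (intro LIMSEQ_SUP) (auto simp: incseq_def le_fun_def intro!: nn_integral_mono)
  moreover have "(\<lambda>N. (\<integral>\<^sup>+x. f N x \<partial>lborel)) \<longlonglongrightarrow> ennreal (Gamma (s + 1) / s * Z)"
  proof (rule Lim_transform_eventually)
    show "(\<lambda>N. ennreal (Gamma (s + 1) / s * ((\<Sum>n=1..N. real n powr (-s)) - real N powr (1 - s) / (1 - s) - real N powr (-s) / 2)))
        \<longlonglongrightarrow> ennreal (Gamma (s + 1) / s * Z)"
      by (intro tendsto_ennrealI tendsto_mult_left Z)
    show "\<forall>\<^sub>F N in sequentially. ennreal (Gamma (s + 1) / s * ((\<Sum>n=1..N. real n powr (-s)) - real N powr (1 - s) / (1 - s) - real N powr (-s) / 2)) = (\<integral>\<^sup>+x. f N x \<partial>lborel)"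
      using eventually_gt_at_top[of 0]
      by eventually_elim (simp only: f_def nn_integral_bose_kernel_truncated[OF s])
  qed
  ultimately show ?thesis unfolding 1 by (rule LIMSEQ_unique)
qed

lemma cos_half_pi_pos:
  fixes s :: real
  assumes "-1 < s" "s < 1"
  shows "cos (pi * s / 2) > 0"
proof (rule cos_gt_zero_pi)
  have "pi * (-1) < pi * s" "pi * s < pi * 1" using assms by (intro mult_strict_left_mono; simp)+
  thus "- (pi / 2) < pi * s / 2" "pi * s / 2 < pi / 2" by simp_all
qed

text \<open>Termwise integration of the partial fractions. The n-th one has the scale 2 pi (n + 1),
  and its integral is proportional to this scale to the power s - 1, so the Dirichlet series of zeta
  at 1 - s appears.\<close>

lemma nn_integral_bose_kernel_series:
  fixes s W :: real
  assumes s: "-1 < s" "s < 0" and W: "(\<lambda>n. real (Suc n) powr (s - 1)) sums W"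
  shows "(\<integral>\<^sup>+x. ennreal (bose_kernel x * x powr (s - 1)) * indicator {0<..} x \<partial>lborel) =
     ennreal ((2 * pi) powr (s - 1) * (pi / cos (pi * s / 2)) * W)"
proof -
  define k where "k = (\<lambda>n. 2 * pi * real (Suc n))"
  have k: "k n > 0" for n by (simp add: k_def)
  define f where "f = (\<lambda>n x. ennreal 2 * (ennreal (x powr s / (x\<^sup>2 + (k n)\<^sup>2)) * indicator {0<..} x))"
  have [measurable]: "f N \<in> borel_measurable borel" for N unfolding f_def by measurable
  have "(\<Sum>n. f n x) = ennreal (bose_kernel x * x powr (s - 1)) * indicator {0<..} x" for x
  proof (cases "x > 0")
    case True
    have "f n x = ennreal (2 * x / (x\<^sup>2 + (k n)\<^sup>2) * x powr (s - 1))" for n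
      using True by (simp add: f_def powr_diff ennreal_mult'[symmetric] del: ennreal_numeral)
    moreover have "(\<lambda>n. 2 * x / (x\<^sup>2 + (k n)\<^sup>2) * x powr (s - 1)) sums (bose_kernel x * x powr (s - 1))"
      unfolding k_def by (rule sums_mult2[OF bose_kernel_sums[OF True]])
    ultimately have "(\<Sum>n. f n x) = ennreal (bose_kernel x * x powr (s - 1))"
      using True by (simp only:) (rule suminf_ennreal_eq, auto)
    thus ?thesis using True by simp
  qed (auto simp: f_def)
  hence "(\<integral>\<^sup>+x. ennreal (bose_kernel x * x powr (s - 1)) * indicator {0<..} x \<partial>lborel) = (\<integral>\<^sup>+x. (\<Sum>n. f n x) \<partial>lborel)" by simp
  also have "\<dots> = (\<Sum>n. (\<integral>\<^sup>+x. f n x \<partial>lborel))" by (rule nn_integral_suminf) measurable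
  also have "\<dots> = (\<Sum>n. ennreal ((2 * pi) powr (s - 1) * (pi / cos (pi * s / 2)) * real (Suc n) powr (s - 1)))"
  proof (intro suminf_cong)
    fix n
    have "(\<integral>\<^sup>+x. f n x \<partial>lborel) = ennreal 2 * (\<integral>\<^sup>+x. (ennreal (x powr s / (x\<^sup>2 + (k n)\<^sup>2)) * indicator {0<..} x) \<partial>lborel)"
      unfolding f_def by (rule nn_integral_cmult) measurable
    also have "\<dots> = ennreal 2 * ennreal (Gamma ((1 + s) / 2) * Gamma ((1 - s) / 2) / 2 * k n powr (s - 1))"
      using s k by (subst nn_integral_powr_over_sum_squares) auto
    also have "\<dots> = ennreal (2 * (Gamma ((1 + s) / 2) * Gamma ((1 - s) / 2) / 2 * k n powr (s - 1)))"
      by (rule ennreal_mult'[symmetric]) simp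
    also have "Gamma ((1 + s) / 2) * Gamma ((1 - s) / 2) = pi / cos (pi * s / 2)"
      by (rule Gamma_half_reflection) (use s in auto)
    also have "k n powr (s - 1) = (2 * pi) powr (s - 1) * real (Suc n) powr (s - 1)"
      unfolding k_def by (rule powr_mult)
    finally show "(\<integral>\<^sup>+x. f n x \<partial>lborel) = ennreal ((2 * pi) powr (s - 1) * (pi / cos (pi * s / 2)) * real (Suc n) powr (s - 1))"
      by (simp add: mult_ac)
  qed
  also have "\<dots> = ennreal ((2 * pi) powr (s - 1) * (pi / cos (pi * s / 2)) * W)"
  proof (rule suminf_ennreal_eq[OF _ sums_mult[OF W]])
    have "cos (pi * s / 2) > 0" using s by (intro cos_half_pi_pos) auto
    thus "0 \<le> (2 * pi) powr (s - 1) * (pi / cos (pi * s / 2)) * real (Suc n) powr (s - 1)" for n by simp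
  qed
  finally show ?thesis .
qed

lemma functional_equation_real:
  fixes s Z W :: real
  assumes s: "-1 < s" "s < 0"
    and Z: "(\<lambda>N. (\<Sum>n=1..N. real n powr (-s)) - real N powr (1 - s) / (1 - s) - real N powr (-s) / 2) \<longlonglongrightarrow> Z"
    and W: "(\<lambda>n. real (Suc n) powr (s - 1)) sums W"
  shows "Gamma s * cos (pi * s / 2) * Z = (2 * pi) powr (s - 1) * pi * W"
proof -
  have c: "cos (pi * s / 2) > 0" using s by (intro cos_half_pi_pos) auto
  \<comment> \<open>Since \<open>ennreal\<close> sends every negative real to 0, equality of the two
    \<open>ennreal\<close> values gives equality of the reals only because one side is strictly
    positive.\<close>
  have "W > 0" using suminf_pos[OF sums_summable[OF W]] sums_unique[OF W] by simp
  hence pos: "(2 * pi) powr (s - 1) * (pi / cos (pi * s / 2)) * W > 0" using c by simp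
  have "ennreal (Gamma (s + 1) / s * Z) = ennreal ((2 * pi) powr (s - 1) * (pi / cos (pi * s / 2)) * W)"
    using nn_integral_bose_kernel_limit[OF s Z] nn_integral_bose_kernel_series[OF s W] by simp
  hence "Gamma (s + 1) / s * Z = (2 * pi) powr (s - 1) * (pi / cos (pi * s / 2)) * W"
    using pos by (metis ennreal_inj ennreal_eq_0_iff less_imp_le linorder_not_le)
  moreover have "s \<notin> \<int>\<^sub>\<le>\<^sub>0"
  proof
    assume "s \<in> \<int>\<^sub>\<le>\<^sub>0"
    then obtain n where "s = of_int n" by (auto simp: nonpos_Ints_def)
    thus False using s by simp
  qed
  hence "Gamma (s + 1) = s * Gamma s" by (rule Gamma_plus1)
  ultimately show ?thesis using s c by (simp add: field_simps)
qed

section \<open>The zeta function in \<open>Re s > -1\<close> and the functional equation\<close>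

text \<open>This is (s - 1) times the error of the trapezoidal rule for \<open>x powr (-s)\<close>
  on [n + 1, n + 2]. The factor s - 1 clears the denominator of the integral and with it the pole of
  zeta.\<close>

definition zeta_trapezoid :: "nat \<Rightarrow> complex \<Rightarrow> complex" where
  "zeta_trapezoid n s = (s - 1) * (of_nat (Suc (Suc n)) powr (-s) + of_nat (Suc n) powr (-s)) / 2
     + of_nat (Suc (Suc n)) powr (1 - s) - of_nat (Suc n) powr (1 - s)"

lemma zeta_trapezoid_holo [holomorphic_intros]: "zeta_trapezoid n holomorphic_on A"
  unfolding zeta_trapezoid_def
  by (intro holomorphic_intros) (auto simp: complex_nonpos_Reals_iff simp flip: of_nat_Suc)

text \<open>The trapezoidal error gains two powers of n over the integrand, which gives convergence
  for Re s > -1.\<close>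

lemma zeta_trapezoid_bound:
  assumes s: "Re s \<ge> -2"
  shows "norm (zeta_trapezoid n s) \<le> norm ((s - 1) * s * (s + 1)) / 2 * real (Suc n) powr (- Re s - 2)"
proof -
  define m where "m = real (Suc n)"
  have m: "m \<ge> 1" by (simp add: m_def)
  \<comment> \<open>For i up to 2, \<open>f i\<close> is the i-th derivative of the error as a
    function of the interval length \<open>z\<close>. Both \<open>f 0\<close> and \<open>f 1\<close>
    vanish at 0, so Taylor's formula leaves only the bound on \<open>f 2\<close>.\<close>
  define f where "f = (\<lambda>(i::nat) z. if i = 0 then (s - 1) * ((of_real m + z) powr (-s) + of_real m powr (-s)) * z / 2
       + (of_real m + z) powr (1 - s) - of_real m powr (1 - s)
     else if i = 1 then (s - 1) / 2 * (of_real m powr (-s) - (of_real m + z) powr (-s)) - (s - 1) * s / 2 * z * (of_real m + z) powr (-s-1)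
     else (s - 1) * s * (s + 1) / 2 * z * (of_real m + z) powr (-s-2))"
  let ?S = "closed_segment 0 (1::complex)"
  have S: "\<exists>y. 0 \<le> y \<and> y \<le> 1 \<and> z = of_real y" if "z \<in> ?S" for z
    using that by (auto simp: closed_segment_def scaleR_conv_of_real)
  have d: "(f i has_field_derivative f (Suc i) z) (at z within ?S)" if zS: "z \<in> ?S" and i: "i \<le> 1" for i z
  proof -
    obtain y where y: "0 \<le> y" "y \<le> 1" "z = of_real y" using S[OF zS] by auto
    have nz: "of_real m + z \<notin> \<real>\<^sub>\<le>\<^sub>0" using y m by (auto simp: complex_nonpos_Reals_iff)
    define P where "P = (\<lambda>a z. (of_real m + z) powr a :: complex)"
    have pw: "(P a has_field_derivative a * P (a - 1) z) (at z within ?S)" for a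
      unfolding P_def by (rule derivative_eq_intros refl | use nz in simp)+
    have const: "((\<lambda>z. c) has_field_derivative 0) (at z within ?S)" for c :: complex by (rule DERIV_const)
    have ident: "((\<lambda>z. z) has_field_derivative 1) (at z within ?S)" by (rule DERIV_ident)
    consider "i = 0" | "i = 1" using i by linarith
    thus ?thesis
    proof cases
      case 1
      have "((\<lambda>z. (s - 1) / 2 * ((P (-s) z + P (-s) 0) * z) + P (1 - s) z - P (1 - s) 0) has_field_derivative
         (s - 1) / 2 * ((- s * P (- s - 1) z + 0) * z + 1 * (P (-s) z + P (-s) 0)) + (1 - s) * P (1 - s - 1) z - 0) (at z within ?S)"
        by (intro DERIV_diff DERIV_add DERIV_cmult DERIV_mult pw const ident)
      also have "(s - 1) / 2 * ((- s * P (- s - 1) z + 0) * z + 1 * (P (-s) z + P (-s) 0)) + (1 - s) * P (1 - s - 1) z - 0 = f (Suc 0) z"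
        by (simp add: f_def P_def field_simps)
      also have "(\<lambda>z. (s - 1) / 2 * ((P (-s) z + P (-s) 0) * z) + P (1 - s) z - P (1 - s) 0) = f 0"
        by (simp add: f_def P_def fun_eq_iff)
      finally show ?thesis unfolding 1 .
    next
      case 2
      have "((\<lambda>z. (s - 1) / 2 * (P (-s) 0 - P (-s) z) - (s - 1) * s / 2 * (z * P (- s - 1) z)) has_field_derivative
         (s - 1) / 2 * (0 - (- s) * P (- s - 1) z) - (s - 1) * s / 2 * (1 * P (- s - 1) z + ((- s - 1) * P (- s - 1 - 1) z) * z)) (at z within ?S)"
        by (intro DERIV_diff DERIV_add DERIV_cmult DERIV_mult pw const ident)
      also have "(s - 1) / 2 * (0 - (- s) * P (- s - 1) z) - (s - 1) * s / 2 * (1 * P (- s - 1) z + ((- s - 1) * P (- s - 1 - 1) z) * z) = f (Suc 1) z"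
      proof -
        have "- s - 1 - 1 = - s - 2" by simp
        thus ?thesis by (simp only: f_def P_def) (simp add: field_simps)
      qed
      also have "(\<lambda>z. (s - 1) / 2 * (P (-s) 0 - P (-s) z) - (s - 1) * s / 2 * (z * P (- s - 1) z)) = f 1"
        by (simp add: f_def P_def fun_eq_iff)
      finally show ?thesis unfolding 2 .
    qed
  qed
  have B: "norm (f (Suc 1) z) \<le> norm ((s - 1) * s * (s + 1)) / 2 * m powr (- Re s - 2)" if zS: "z \<in> ?S" for z
  proof -
    obtain y where y: "0 \<le> y" "y \<le> 1" "z = of_real y" using S[OF zS] by auto
    have "norm ((of_real m + z) powr (-s-2)) = (m + y) powr (- Re s - 2)"
      using y m norm_powr_real_powr[of "of_real (m+y)" "-s-2"] by simp
    also have "\<dots> \<le> m powr (- Re s - 2)" using y m s by (intro powr_mono2') auto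
    finally have a: "norm ((of_real m + z) powr (-s-2)) \<le> m powr (- Re s - 2)" .
    have "norm (f (Suc 1) z) = norm ((s - 1) * s * (s + 1)) / 2 * (y * norm ((of_real m + z) powr (-s-2)))"
      using y by (simp add: f_def norm_mult norm_divide)
    also have "\<dots> \<le> norm ((s - 1) * s * (s + 1)) / 2 * (1 * m powr (- Re s - 2))"
      using y a by (intro mult_left_mono mult_mono) auto
    finally show ?thesis by simp
  qed
  have "norm (f 0 1 - (\<Sum>i\<le>1. f i 0 * (1 - 0) ^ i / fact i)) \<le>
     (norm ((s - 1) * s * (s + 1)) / 2 * m powr (- Re s - 2)) * norm (1 - (0::complex)) ^ Suc 1 / fact 1"
    by (rule complex_Taylor[of ?S]) (use d B in auto)
  thus ?thesis using m by (simp add: f_def zeta_trapezoid_def m_def atMost_Suc add_ac)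
qed

lemma zeta_trapezoid_uniform:
  assumes "Re s0 > -1"
  shows "\<exists>d>0. cball s0 d \<subseteq> {s. Re s > -1} \<and>
    uniform_limit (cball s0 d) (\<lambda>N s. \<Sum>n<N. zeta_trapezoid n s) (\<lambda>s. \<Sum>n. zeta_trapezoid n s) sequentially"
proof -
  \<comment> \<open>Half the distance to the line Re s = -1, so that \<open>- Re s - 2\<close> stays
    at most \<open>- 1 - d\<close> on the disc.\<close>
  define d where "d = (Re s0 + 1) / 2"
  have d: "d > 0" using assms by (simp add: d_def)
  have re: "Re s \<ge> Re s0 - d" if "s \<in> cball s0 d" for s
    using that abs_Re_le_cmod[of "s0 - s"] by (auto simp: dist_norm)
  have sub: "cball s0 d \<subseteq> {s. Re s > -1}" using re assms by (force simp: d_def field_simps)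
  define B where "B = (\<lambda>s::complex. norm ((s - 1) * s * (s + 1)) / 2)"
  have "bounded (B ` cball s0 d)"
    unfolding B_def by (intro compact_imp_bounded compact_continuous_image continuous_intros) auto
  then obtain C where C: "\<And>s. s \<in> cball s0 d \<Longrightarrow> \<bar>B s\<bar> \<le> C"
    unfolding bounded_iff real_norm_def by blast
  have "C \<ge> 0" using C[of s0] d by auto
  have "uniform_limit (cball s0 d) (\<lambda>N s. \<Sum>n<N. zeta_trapezoid n s) (\<lambda>s. \<Sum>n. zeta_trapezoid n s) sequentially"
  proof (rule Weierstrass_m_test)
    fix n s assume s: "s \<in> cball s0 d"
    have "norm (zeta_trapezoid n s) \<le> B s * real (Suc n) powr (- Re s - 2)"
      unfolding B_def using sub s by (intro zeta_trapezoid_bound) force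
    also have "\<dots> \<le> C * real (Suc n) powr (- 1 - d)"
      using C[OF s] re[OF s] \<open>C \<ge> 0\<close> d
      by (intro mult_mono powr_mono) (auto simp: d_def field_simps)
    finally show "norm (zeta_trapezoid n s) \<le> C * real (Suc n) powr (- 1 - d)" .
  next
    have "summable (\<lambda>n. real (Suc n) powr (- 1 - d))"
      using d by (subst summable_Suc_iff) (simp add: summable_real_powr_iff)
    thus "summable (\<lambda>n. C * real (Suc n) powr (- 1 - d))" by (rule summable_mult)
  qed
  with sub d show ?thesis by blast
qed

lemma zeta_trapezoid_sum:
  "(\<Sum>n<N. zeta_trapezoid n s) = (s - 1) * ((\<Sum>j=1..Suc N. of_nat j powr (-s)) - 1 / 2 - of_nat (Suc N) powr (-s) / 2)
     + of_nat (Suc N) powr (1 - s) - 1"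
proof (induction N)
  case (Suc N)
  have alg: "(s - 1) * (A - 1 / 2 - B / 2) + D - 1 + ((s - 1) * (B' + B) / 2 + D' - D) = (s - 1) * ((A + B') - 1 / 2 - B' / 2) + D' - 1"
    for A B B' D D' :: complex by (simp add: field_simps)
  have "(\<Sum>j=1..Suc (Suc N). of_nat j powr (-s)) = (\<Sum>j=1..Suc N. of_nat j powr (-s)) + of_nat (Suc (Suc N)) powr (-s)"
    by (subst sum.cl_ivl_Suc) simp
  thus ?case unfolding sum.lessThan_Suc Suc zeta_trapezoid_def[of N] by (simp only: alg)
qed (simp add: zeta_trapezoid_def)

text \<open>Euler-Maclaurin form of (s - 1) zeta(s), meaningful on Re s > -1. The summand (s + 1)/2
  is 1 + (s - 1)/2; it undoes the contributions of the lower endpoint 1 that appear in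
  \<open>zeta_trapezoid_sum\<close>.\<close>

definition zeta_entire_part :: "complex \<Rightarrow> complex" where
  "zeta_entire_part s = (s + 1) / 2 + (\<Sum>n. zeta_trapezoid n s)"

lemma zeta_entire_part_holo: "zeta_entire_part holomorphic_on {s. Re s > -1}"
proof -
  have "(\<lambda>s. \<Sum>n. zeta_trapezoid n s) holomorphic_on {s. Re s > -1}"
    by (rule holomorphic_uniform_sequence[where f = "\<lambda>N s. \<Sum>n<N. zeta_trapezoid n s"])
       (use zeta_trapezoid_uniform in \<open>auto intro!: holomorphic_intros open_halfspace_Re_gt\<close>)
  thus ?thesis unfolding zeta_entire_part_def by (intro holomorphic_intros) auto
qed

text \<open>For Re s < 0 the pieces diverge separately and only the combination converges. In this
  form zeta meets the Mellin computation on -1 < s < 0.\<close>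

lemma zeta_entire_part_LIMSEQ:
  assumes "Re s > -1"
  shows "(\<lambda>N. (s - 1) * ((\<Sum>j=1..N. of_nat j powr (-s)) - of_nat N powr (-s) / 2) + of_nat N powr (1 - s)) \<longlonglongrightarrow> zeta_entire_part s"
proof -
  obtain d where d: "d > 0" "uniform_limit (cball s d) (\<lambda>N s. \<Sum>n<N. zeta_trapezoid n s) (\<lambda>s. \<Sum>n. zeta_trapezoid n s) sequentially"
    using zeta_trapezoid_uniform[OF assms] by blast
  hence "(\<lambda>N. \<Sum>n<N. zeta_trapezoid n s) \<longlonglongrightarrow> (\<Sum>n. zeta_trapezoid n s)"
    by (intro tendsto_uniform_limitI[OF d(2)]) auto
  hence "(\<lambda>N. (s + 1) / 2 + (\<Sum>n<N. zeta_trapezoid n s)) \<longlonglongrightarrow> zeta_entire_part s"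
    unfolding zeta_entire_part_def by (intro tendsto_add tendsto_const)
  also have "(\<lambda>N. (s + 1) / 2 + (\<Sum>n<N. zeta_trapezoid n s)) =
     (\<lambda>N. (s - 1) * ((\<Sum>j=1..Suc N. of_nat j powr (-s)) - of_nat (Suc N) powr (-s) / 2) + of_nat (Suc N) powr (1 - s))"
  proof -
    have "(s + 1) / 2 + ((s - 1) * (A - 1 / 2 - B / 2) + D - 1) = (s - 1) * (A - B / 2) + D" for A B D :: complex
      by (simp add: field_simps)
    thus ?thesis unfolding zeta_trapezoid_sum by (simp only:)
  qed
  finally show ?thesis by (subst (asm) filterlim_sequentially_Suc)
qed

lemma tendsto_of_nat_powr_zero:
  assumes "Re a < 0"
  shows "(\<lambda>N. of_nat N powr a :: complex) \<longlonglongrightarrow> 0"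
proof (rule tendsto_norm_zero_cancel)
  have "(\<lambda>n. real n powr Re a) \<longlonglongrightarrow> 0"
    using assms by (intro tendsto_neg_powr filterlim_real_sequentially) auto
  also have "(\<lambda>n. real n powr Re a) = (\<lambda>n. norm (of_nat n powr a :: complex))"
  proof
    fix n show "real n powr Re a = norm (of_nat n powr a :: complex)"
      using norm_powr_real_powr[of "of_nat n" a] by (cases "n = 0") auto
  qed
  finally show "(\<lambda>n. norm (of_nat n powr a :: complex)) \<longlonglongrightarrow> 0" .
qed

lemma riemann_zeta_sums:
  assumes "Re s > 1"
  shows "(\<lambda>n. of_nat (Suc n) powr (-s)) sums riemann_zeta s"
  using riemann_zeta(1) assms unfolding is_zeta_continuation_def by (simp add: powr_minus_divide)

lemma riemann_zeta_holo: "riemann_zeta holomorphic_on - {1}"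
  using riemann_zeta(1) unfolding is_zeta_continuation_def by blast

text \<open>Identity theorem on the half-plane Re s > -1 punctured at 1, which is still connected.
  At s = 1 itself every trapezoidal term vanishes.\<close>

lemma zeta_entire_part_eq:
  assumes "Re s > -1"
  shows "zeta_entire_part s = (if s = 1 then 1 else (s - 1) * riemann_zeta s)"
proof (cases "s = 1")
  case True
  have "zeta_trapezoid n 1 = 0" for n by (simp add: zeta_trapezoid_def del: of_nat_Suc)
  thus ?thesis using True by (simp add: zeta_entire_part_def)
next
  case False
  have "zeta_entire_part s = (s - 1) * riemann_zeta s"
  proof (rule analytic_continuation_open[of "{s. Re s > 1}" "{s. Re s > -1} - {1}" zeta_entire_part "\<lambda>s. (s - 1) * riemann_zeta s"])
    show "{s. Re s > 1} \<noteq> {}" by (auto intro: exI[of _ 2])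
    show "connected ({s. Re s > -1} - {1})"
      by (intro connected_open_delete convex_connected convex_halfspace_Re_gt open_halfspace_Re_gt) auto
    show "zeta_entire_part holomorphic_on {s. Re s > -1} - {1}"
      by (rule holomorphic_on_subset[OF zeta_entire_part_holo]) auto
    show "(\<lambda>s. (s - 1) * riemann_zeta s) holomorphic_on {s. Re s > -1} - {1}"
      by (intro holomorphic_intros holomorphic_on_subset[OF riemann_zeta_holo]) auto
    show "zeta_entire_part s = (s - 1) * riemann_zeta s" if "s \<in> {s. Re s > 1}" for s
    proof -
      have s: "Re s > 1" using that by simp
      have "(\<lambda>N. \<Sum>n<N. of_nat (Suc n) powr (-s)) \<longlonglongrightarrow> riemann_zeta s"
        using riemann_zeta_sums[OF s] by (simp only: sums_def)
      also have "(\<lambda>N. \<Sum>n<N. of_nat (Suc n) powr (-s)) = (\<lambda>N. \<Sum>j=1..N. of_nat j powr (-s))"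
        by (intro ext sum.reindex_bij_witness[of _ "\<lambda>j. j - 1" Suc]) auto
      finally have "(\<lambda>N. (s - 1) * ((\<Sum>j=1..N. of_nat j powr (-s)) - of_nat N powr (-s) / 2) + of_nat N powr (1 - s)) \<longlonglongrightarrow> (s - 1) * (riemann_zeta s - 0 / 2) + 0"
        using s by (intro tendsto_intros tendsto_of_nat_powr_zero) auto
      moreover have "(\<lambda>N. (s - 1) * ((\<Sum>j=1..N. of_nat j powr (-s)) - of_nat N powr (-s) / 2) + of_nat N powr (1 - s)) \<longlonglongrightarrow> zeta_entire_part s"
        using s by (intro zeta_entire_part_LIMSEQ) auto
      ultimately show ?thesis using LIMSEQ_unique by fastforce
    qed
  qed (use assms False in \<open>auto intro!: open_Diff open_halfspace_Re_gt\<close>)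
  thus ?thesis using False by simp
qed

text \<open>The trapezoidal rule is exact for constants, so all terms of the series vanish at s = 0.
  The value shows that 0, a point excluded from the functional equation, is no zero of zeta.\<close>

lemma riemann_zeta_0: "riemann_zeta 0 = - 1 / 2"
proof -
  have "zeta_trapezoid n 0 = 0" for n by (simp add: zeta_trapezoid_def del: of_nat_Suc) simp
  hence "zeta_entire_part 0 = 1 / 2" by (simp add: zeta_entire_part_def)
  thus ?thesis using zeta_entire_part_eq[of 0] by (simp add: equation_minus_iff)
qed

text \<open>The cube stems from \<open>(s - 1) * s * (s + 1)\<close> in
  \<open>zeta_trapezoid_bound\<close>. Later only the logarithm of the bound matters, so the
  exponent is just a constant factor.\<close>

lemma zeta_entire_part_growth:
  obtains C where "C > 0" "\<And>s. Re s \<ge> 1/2 \<Longrightarrow> norm (zeta_entire_part s) \<le> C * (1 + norm s) ^ 3"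
proof -
  define S where "S = (\<Sum>n. real (Suc n) powr (-5/2))"
  have sm: "summable (\<lambda>n. real (Suc n) powr (-5/2))"
    by (subst summable_Suc_iff) (simp add: summable_real_powr_iff)
  have S: "S \<ge> 0" unfolding S_def by (intro suminf_nonneg sm) auto
  have "norm (zeta_entire_part s) \<le> (1 + S) * (1 + norm s) ^ 3" if s: "Re s \<ge> 1/2" for s
  proof -
    define R where "R = 1 + norm s"
    have R: "R \<ge> 1" by (simp add: R_def)
    have n1: "norm (s - 1) \<le> R" "norm s \<le> R" "norm (s + 1) \<le> R"
      using norm_triangle_ineq4[of s 1] norm_triangle_ineq[of s 1] by (auto simp: R_def)
    have p: "norm ((s - 1) * s * (s + 1)) \<le> R ^ 3"
      unfolding norm_mult power3_eq_cube using n1 R by (intro mult_mono) auto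
    have tb: "norm (zeta_trapezoid n s) \<le> R ^ 3 * real (Suc n) powr (-5/2)" for n
    proof -
      have "norm (zeta_trapezoid n s) \<le> norm ((s - 1) * s * (s + 1)) / 2 * real (Suc n) powr (- Re s - 2)"
        using s by (intro zeta_trapezoid_bound) auto
      also have "\<dots> \<le> R ^ 3 * real (Suc n) powr (-5/2)"
      proof (intro mult_mono powr_mono)
        show "norm ((s - 1) * s * (s + 1)) / 2 \<le> R ^ 3" using p norm_ge_zero[of "(s - 1) * s * (s + 1)"] by linarith
      qed (use s R in auto)
      finally show ?thesis .
    qed
    have "norm (\<Sum>n. zeta_trapezoid n s) \<le> (\<Sum>n. R ^ 3 * real (Suc n) powr (-5/2))"
      by (rule norm_suminf_le[OF tb summable_mult[OF sm]])
    also have "\<dots> = R ^ 3 * S" unfolding S_def by (rule suminf_mult[OF sm])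
    finally have "norm (zeta_entire_part s) \<le> norm (s + 1) / 2 + R ^ 3 * S"
      unfolding zeta_entire_part_def by (intro norm_triangle_le add_mono) (auto simp: norm_divide)
    also have "norm (s + 1) / 2 \<le> R ^ 3" using n1 R self_le_power[of R 3] by simp
    finally show ?thesis by (simp add: R_def algebra_simps)
  qed
  thus ?thesis using that[of "1 + S"] S by simp
qed

lemma riemann_zeta_real_LIMSEQ:
  fixes s :: real
  assumes "-1 < s" "s < 0"
  shows "(\<lambda>N. (\<Sum>n=1..N. real n powr (-s)) - real N powr (1 - s) / (1 - s) - real N powr (-s) / 2) \<longlonglongrightarrow> Re (riemann_zeta (of_real s))"
    and "riemann_zeta (of_real s) \<in> \<real>"
proof -
  have ne: "complex_of_real s \<noteq> 1" "complex_of_real s - 1 \<noteq> 0" using assms by (auto simp: complex_eq_iff)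
  define u where "u = (\<lambda>N. (\<Sum>n=1..N. real n powr (-s)) - real N powr (1 - s) / (1 - s) - real N powr (-s) / 2)"
  have pw: "of_nat j powr (- complex_of_real s) = of_real (real j powr (-s))"
    "of_nat j powr (1 - complex_of_real s) = of_real (real j powr (1-s))" for j
    using powr_of_real[of "real j" "-s"] powr_of_real[of "real j" "1-s"] by simp_all
  have "(\<lambda>N. ((of_real s - 1) * ((\<Sum>j=1..N. of_nat j powr (- of_real s)) - of_nat N powr (- of_real s) / 2) + of_nat N powr (1 - of_real s)) / (of_real s - 1))
     \<longlonglongrightarrow> zeta_entire_part (of_real s) / (of_real s - 1)"
    using assms ne by (intro tendsto_divide zeta_entire_part_LIMSEQ tendsto_const) auto
  also have "zeta_entire_part (of_real s) / (of_real s - 1) = riemann_zeta (of_real s)"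
    using assms ne by (simp add: zeta_entire_part_eq)
  also have "(\<lambda>N. ((of_real s - 1) * ((\<Sum>j=1..N. of_nat j powr (- of_real s)) - of_nat N powr (- of_real s) / 2) + of_nat N powr (1 - of_real s)) / (of_real s - 1)) = (\<lambda>N. complex_of_real (u N))"
  proof
    fix N
    have "u N = ((s - 1) * ((\<Sum>j=1..N. real j powr (- s)) - real N powr (- s) / 2) + real N powr (1 - s)) / (s - 1)"
      using assms unfolding u_def by (simp add: divide_simps) (simp add: algebra_simps)
    thus "((of_real s - 1) * ((\<Sum>j=1..N. of_nat j powr (- of_real s)) - of_nat N powr (- of_real s) / 2) + of_nat N powr (1 - of_real s)) / (of_real s - 1) = complex_of_real (u N)"
      unfolding pw by simp
  qed
  finally have lim: "(\<lambda>N. complex_of_real (u N)) \<longlonglongrightarrow> riemann_zeta (of_real s)" .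
  show "riemann_zeta (of_real s) \<in> \<real>"
    by (rule closed_sequentially[OF closed_complex_Reals _ lim]) auto
  show "(\<lambda>N. (\<Sum>n=1..N. real n powr (-s)) - real N powr (1 - s) / (1 - s) - real N powr (-s) / 2) \<longlonglongrightarrow> Re (riemann_zeta (of_real s))"
    using tendsto_Re[OF lim] by (simp add: u_def)
qed

lemma riemann_zeta_real_sums:
  fixes s :: real
  assumes "s > 1"
  shows "(\<lambda>n. real (Suc n) powr (-s)) sums Re (riemann_zeta (of_real s))" and "riemann_zeta (of_real s) \<in> \<real>"
proof -
  have "of_nat (Suc n) powr (- complex_of_real s) = of_real (real (Suc n) powr (-s))" for n
    using powr_of_real[of "real (Suc n)" "-s"] by simp
  hence "(\<lambda>n. complex_of_real (real (Suc n) powr (-s))) sums riemann_zeta (of_real s)"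
    using riemann_zeta_sums[of "of_real s"] assms by (simp only: Re_complex_of_real)
  note sm = this
  show "(\<lambda>n. real (Suc n) powr (-s)) sums Re (riemann_zeta (of_real s))"
    using sums_Re[OF sm] by simp
  have "riemann_zeta (of_real s) = of_real (Re (riemann_zeta (of_real s)))"
    using sums_unique2[OF sm sums_of_real[OF \<open>(\<lambda>n. real (Suc n) powr (-s)) sums Re (riemann_zeta (of_real s))\<close>]] .
  thus "riemann_zeta (of_real s) \<in> \<real>" by (metis Reals_of_real)
qed

section \<open>The functional equation and the zeros left of the critical line\<close>

lemma connected_punctured_twice: "connected (- {0, 1 :: complex})"
proof -
  have "connected (- {1} - {0 :: complex})"
    by (intro connected_open_delete connected_punctured_universe) auto
  also have "- {1} - {0 :: complex} = - {0, 1}" by auto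
  finally show ?thesis .
qed

text \<open>With \<open>rGamma\<close> instead of a quotient by Gamma, both sides are holomorphic
  off {0, 1}, so the identity theorem extends \<open>functional_equation_real\<close> to the whole
  domain.\<close>

theorem riemann_zeta_functional_equation:
  assumes "s \<noteq> 0" "s \<noteq> 1"
  shows "2 * sin (of_real pi * s / 2) * riemann_zeta (1 - s) = of_real (2 * pi) powr (1 - s) * rGamma (1 - s) * riemann_zeta s"
proof -
  define f where "f = (\<lambda>s. 2 * sin (of_real pi * s / 2) * riemann_zeta (1 - s) - of_real (2 * pi) powr (1 - s) * rGamma (1 - s) * riemann_zeta s)"
  have "f s = 0"
  \<comment> \<open>For real s in (1, 2) the reflected point 1 - s lies in (-1, 0), where the Mellin
    computation applies.\<close>
  proof (rule analytic_continuation[of f "- {0, 1}" "complex_of_real ` {1<..<2}" "of_real (3/2)"])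
    have "(\<lambda>s. riemann_zeta (1 - s)) holomorphic_on - {0, 1}"
      by (rule holomorphic_on_compose_gen[unfolded o_def, OF _ riemann_zeta_holo]) (auto intro!: holomorphic_intros)
    moreover have "riemann_zeta holomorphic_on - {0, 1}"
      by (rule holomorphic_on_subset[OF riemann_zeta_holo]) auto
    moreover have "(\<lambda>s. rGamma (1 - s)) holomorphic_on - {0, 1}"
      by (rule holomorphic_on_compose_gen[unfolded o_def, OF _ holomorphic_rGamma[of UNIV]]) (auto intro!: holomorphic_intros)
    ultimately show "f holomorphic_on - {0, 1}" unfolding f_def by (intro holomorphic_intros) auto
    show "complex_of_real (3/2) islimpt complex_of_real ` {1<..<2}"
    proof (rule islimpt_isCont_image)
      show "(3/2::real) islimpt {1<..<2}" by (rule interior_limit_point) simp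
      show "\<forall>\<^sub>F y in at (3/2). complex_of_real y \<noteq> complex_of_real (3/2)"
        by (simp only: of_real_eq_iff) (simp add: eventually_at_filter)
    qed auto
    show "f z = 0" if "z \<in> complex_of_real ` {1<..<2}" for z
    proof -
      from that obtain x where "z = complex_of_real x" "x \<in> {1<..<2}" by (rule imageE)
      hence x: "z = of_real x" "1 < x" "x < 2" by auto
      define \<sigma> where "\<sigma> = 1 - x"
      have \<sigma>: "-1 < \<sigma>" "\<sigma> < 0" "1 - \<sigma> > 1" using x by (auto simp: \<sigma>_def)
      define Z where "Z = Re (riemann_zeta (of_real \<sigma>))"
      define W where "W = Re (riemann_zeta (of_real (1 - \<sigma>)))"
      have "Gamma \<sigma> * cos (pi * \<sigma> / 2) * Z = (2 * pi) powr (\<sigma> - 1) * pi * W"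
        unfolding Z_def W_def using riemann_zeta_real_sums(1)[OF \<sigma>(3)]
        by (intro functional_equation_real[OF \<sigma>(1,2) riemann_zeta_real_LIMSEQ(1)[OF \<sigma>(1,2)]]) simp
      moreover have "Gamma \<sigma> * rGamma \<sigma> = 1"
      proof -
        have "\<sigma> \<notin> \<int>\<^sub>\<le>\<^sub>0"
        proof
          assume "\<sigma> \<in> \<int>\<^sub>\<le>\<^sub>0"
          then obtain n where "\<sigma> = of_int n" by (auto simp: nonpos_Ints_def)
          thus False using \<sigma> by simp
        qed
        thus ?thesis by (simp add: Gamma_def rGamma_eq_zero_iff)
      qed
      ultimately have "2 * cos (pi * \<sigma> / 2) * Z = 2 * pi * (2 * pi) powr (\<sigma> - 1) * rGamma \<sigma> * W" by algebra
      also have "2 * pi * (2 * pi) powr (\<sigma> - 1) = (2 * pi) powr \<sigma>" by (simp add: powr_diff)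
      also have "cos (pi * \<sigma> / 2) = sin (pi * x / 2)"
        by (simp add: \<sigma>_def cos_diff right_diff_distrib diff_divide_distrib)
      finally have "complex_of_real (2 * sin (pi * x / 2) * Z) = of_real ((2 * pi) powr \<sigma> * rGamma \<sigma> * W)" by simp
      moreover have "of_real Z = riemann_zeta (1 - z)"
        using riemann_zeta_real_LIMSEQ(2)[OF \<sigma>(1,2)] by (simp add: Z_def x \<sigma>_def)
      moreover have "of_real W = riemann_zeta z"
        using riemann_zeta_real_sums(2)[OF \<sigma>(3)] by (simp add: W_def x \<sigma>_def)
      moreover have "complex_of_real ((2 * pi) powr \<sigma>) = of_real (2 * pi) powr (1 - z)"
        using powr_of_real[of "2 * pi" \<sigma>] by (simp add: x \<sigma>_def)
      moreover have "complex_of_real (rGamma \<sigma>) = rGamma (1 - z)"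
        using rGamma_complex_of_real[of \<sigma>] by (simp add: x \<sigma>_def)
      moreover have "complex_of_real (sin (pi * x / 2)) = sin (of_real pi * z / 2)"
        using sin_of_real[of "pi * x / 2", where 'a = complex] by (simp add: x)
      ultimately show ?thesis by (simp only: f_def of_real_mult of_real_numeral) simp
    qed
  qed (use assms connected_punctured_twice in \<open>auto simp: complex_eq_iff\<close>)
  thus ?thesis by (simp add: f_def)
qed

text \<open>If a zero s has Re s < 1/2, then zeta(1 - s) is nonzero, so the sine in the functional
  equation vanishes and s is an even integer. The bound on Re s excludes positive ones,
  \<open>riemann_zeta_0\<close> excludes 0, and the negative ones are the trivial zeros.\<close>

lemma riemann_hypothesis_if_zero_free:
  assumes nz: "\<And>s. Re s > 1/2 \<Longrightarrow> s \<noteq> 1 \<Longrightarrow> riemann_zeta s \<noteq> 0"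
  shows riemann_hypothesis
  unfolding riemann_hypothesis_def
proof (intro allI impI)
  fix s assume s: "nontrivial_zeta_zero s"
  hence z: "s \<noteq> 1" "riemann_zeta s = 0" and nt: "\<And>k. k \<ge> 1 \<Longrightarrow> s \<noteq> - (2 * of_nat k)"
    unfolding nontrivial_zeta_zero_def by blast+
  have s0: "s \<noteq> 0" using z riemann_zeta_0 by auto
  have "\<not> Re s > 1/2" using nz z by blast
  moreover have "\<not> Re s < 1/2"
  proof
    assume less: "Re s < 1/2"
    have "sin (of_real pi * s / 2) * riemann_zeta (1 - s) = 0"
      using riemann_zeta_functional_equation[OF s0 z(1)] z(2) by simp
    moreover have "riemann_zeta (1 - s) \<noteq> 0" using less s0 by (intro nz) auto
    ultimately have "sin (of_real pi * s / 2) = 0" by simp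
    then obtain n where n: "of_real pi * s / 2 = of_real (of_int n * pi)" by (auto simp: sin_eq_0)
    have s2: "s = 2 * of_int n" using n by (simp add: field_simps)
    have "n < 0" using less s0 s2 by auto
    hence "s = - (2 * of_nat (nat (- n)))" using s2 by simp
    moreover have "nat (- n) \<ge> 1" using \<open>n < 0\<close> by linarith
    ultimately show False using nt by blast
  qed
  ultimately show "Re s = 1/2" by simp
qed

section \<open>The Dirichlet series of the Moebius function\<close>

lemma abs_moebius_mu_le_1: "\<bar>moebius_mu n\<bar> \<le> 1"
  by (simp add: moebius_mu_def power_abs)

lemma moebius_mu_1 [simp]: "moebius_mu 1 = 1" "moebius_mu (Suc 0) = 1"
  by (auto simp: moebius_mu_def dest: prime_gt_1_nat)

lemma moebius_mu_prime_times:
  assumes p: "prime p" and d: "\<not> p dvd d"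
  shows "moebius_mu (p * d) = - moebius_mu d"
proof -
  have d0: "d \<noteq> 0" using d by (cases "d = 0") auto
  have p0: "p \<noteq> 0" using p by auto
  have "(\<exists>q. prime q \<and> q\<^sup>2 dvd p * d) \<longleftrightarrow> (\<exists>q. prime q \<and> q\<^sup>2 dvd d)"
  proof (intro ex_cong1 conj_cong refl iffI)
    fix q assume q: "prime q" "q\<^sup>2 dvd p * d"
    show "q\<^sup>2 dvd d"
    proof (cases "q = p")
      case True
      hence "p * p dvd p * d" using q by (simp add: power2_eq_square)
      thus ?thesis using d p0 by simp
    next
      case False
      hence "coprime (q\<^sup>2) p" using p q by (simp add: primes_coprime)
      thus ?thesis using q(2) by (simp add: coprime_dvd_mult_right_iff)
    qed
  qed (rule dvd_mult)
  moreover have "card (prime_factors (p * d)) = Suc (card (prime_factors d))"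
  proof -
    have "prime_factors (p * d) = insert p (prime_factors d)"
      using p d0 p0 by (simp add: prime_factors_product prime_prime_factors)
    moreover have "p \<notin> prime_factors d" using d by auto
    ultimately show ?thesis by simp
  qed
  ultimately show ?thesis by (simp add: moebius_mu_def)
qed

text \<open>Fix a prime p dividing n. The divisors d prime to p cancel against the divisors p * d,
  and every remaining divisor is a multiple of p^2.\<close>

lemma sum_moebius_mu_divisors:
  assumes n: "n > 0"
  shows "(\<Sum>d | d dvd n. moebius_mu d) = (if n = 1 then 1 else 0)"
proof (cases "n = 1")
  case False
  then obtain p where p: "prime p" "p dvd n" using prime_factor_nat by blast
  have p0: "p > 0" using p(1) by (rule prime_gt_0_nat)
  define A where "A = {d. d dvd n \<and> \<not> p dvd d}"
  define B where "B = {d. d dvd n \<and> p dvd d}"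
  have fin: "finite A" "finite B" using n by (auto simp: A_def B_def)
  have "(\<Sum>d | d dvd n. moebius_mu d) = (\<Sum>d\<in>A \<union> B. moebius_mu d)"
    by (rule sum.cong) (auto simp: A_def B_def)
  also have "\<dots> = (\<Sum>d\<in>A. moebius_mu d) + (\<Sum>d\<in>B. moebius_mu d)"
    using fin by (intro sum.union_disjoint) (auto simp: A_def B_def)
  also have "(\<Sum>d\<in>B. moebius_mu d) = (\<Sum>d\<in>(*) p ` A. moebius_mu d)"
  proof (rule sum.mono_neutral_right[OF fin(2)])
    show "(*) p ` A \<subseteq> B"
    proof safe
      fix d assume d: "d \<in> A"
      hence "coprime p d" using p(1) by (auto simp: A_def prime_imp_coprime)
      thus "p * d \<in> B" using d p(2) by (auto simp: A_def B_def divides_mult)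
    qed
    show "\<forall>d\<in>B - (*) p ` A. moebius_mu d = 0"
    proof
      fix d assume d: "d \<in> B - (*) p ` A"
      then obtain e where e: "d = p * e" by (auto simp: B_def)
      have "e dvd n" using d e by (auto simp: B_def intro: dvd_mult_right)
      hence "p dvd e" using d e by (auto simp: A_def)
      hence "p\<^sup>2 dvd d" using e by (simp add: power2_eq_square mult_dvd_mono)
      thus "moebius_mu d = 0" using p(1) by (auto simp: moebius_mu_def)
    qed
  qed
  also have "\<dots> = (\<Sum>d\<in>A. moebius_mu (p * d))"
    using p0 by (subst sum.reindex) (auto simp: inj_on_def)
  also have "\<dots> = (\<Sum>d\<in>A. - moebius_mu d)"
    using p(1) by (intro sum.cong moebius_mu_prime_times refl) (auto simp: A_def)
  finally show ?thesis using False by (simp add: sum_negf)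
qed simp

lemma summable_norm_powr_Suc:
  assumes "Re s > 1"
  shows "summable (\<lambda>n. norm (of_nat (Suc n) powr (-s)))"
proof -
  have "norm (of_nat (Suc n) powr (-s)) = real (Suc n) powr (- Re s)" for n
    by (simp add: norm_powr_real_powr flip: of_nat_Suc)
  moreover have "summable (\<lambda>n. real (Suc n) powr (- Re s))"
    using assms by (subst summable_Suc_iff) (simp add: summable_real_powr_iff)
  ultimately show ?thesis by simp
qed

definition moebius_dirichlet :: "complex \<Rightarrow> complex" where
  "moebius_dirichlet s = (\<Sum>n. of_int (moebius_mu (Suc n)) * of_nat (Suc n) powr (-s))"

lemma norm_moebius_term_le: "norm (of_int (moebius_mu n) * z) \<le> norm (z :: complex)"
  unfolding norm_mult norm_of_int using abs_moebius_mu_le_1[of n]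
  by (intro mult_left_le_one_le) auto

lemma summable_norm_moebius:
  assumes "Re s > 1"
  shows "summable (\<lambda>n. norm (of_int (moebius_mu (Suc n)) * of_nat (Suc n) powr (-s)))"
  by (rule summable_comparison_test'[OF summable_norm_powr_Suc[OF assms]]) (use norm_moebius_term_le in auto)

lemma has_sum_of_abs_summable_Suc:
  fixes f :: "nat \<Rightarrow> complex"
  assumes "summable (\<lambda>n. norm (f (Suc n)))" "(\<lambda>n. f (Suc n)) sums S"
  shows "(f has_sum S) {1..}"
proof -
  have "((f \<circ> Suc) has_sum S) UNIV" using norm_summable_imp_has_sum[OF assms] by (simp add: o_def)
  hence "(f has_sum S) (range Suc)" by (subst has_sum_reindex) auto
  also have "range Suc = {1..}" by (auto simp: image_iff) (metis Suc_pred' gr0_conv_Suc less_eq_Suc_le)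
  finally show ?thesis .
qed

text \<open>The product of the two absolutely convergent series is regrouped by n = d m, where the
  divisor sum of \<open>moebius_mu\<close> leaves only n = 1. With the unordered
  \<open>has_sum\<close>, regrouping is a reindexing along a bijection.\<close>

lemma moebius_dirichlet_times_zeta:
  assumes s: "Re s > 1"
  shows "moebius_dirichlet s * riemann_zeta s = 1"
proof -
  define g where "g = (\<lambda>n::nat. of_int (moebius_mu n) * of_nat n powr (-s))"
  define f where "f = (\<lambda>n::nat. of_nat n powr (-s))"
  have G: "(g has_sum moebius_dirichlet s) {1..}"
    unfolding g_def moebius_dirichlet_def
    by (intro has_sum_of_abs_summable_Suc summable_norm_moebius[OF s] summable_sums summable_norm_cancel[OF summable_norm_moebius[OF s]])
  have F: "(f has_sum riemann_zeta s) {1..}"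
    unfolding f_def by (intro has_sum_of_abs_summable_Suc summable_norm_powr_Suc[OF s] riemann_zeta_sums[OF s])
  have "(\<lambda>n. norm (g n)) summable_on {1..}" "(\<lambda>n. norm (f n)) summable_on {1..}"
    using G F summable_on_iff_abs_summable_on_complex[of g] summable_on_iff_abs_summable_on_complex[of f] by (auto simp: summable_on_def)
  hence "(\<lambda>z. norm ((\<lambda>(d, m). g d * f m) z)) summable_on {1..} \<times> {1..}"
    by (subst Infinite_Sum.abs_summable_on_Sigma_iff)
       (auto simp: norm_mult abs_mult infsum_cmult_right' intro!: summable_on_cmult_right summable_on_cmult_left)
  hence sm: "(\<lambda>(d, m). g d * f m) summable_on {1..} \<times> {1..}"
    by (subst summable_on_iff_abs_summable_on_complex)
  have "((\<lambda>(d, m). g d * f m) has_sum (moebius_dirichlet s * riemann_zeta s)) ({1..} \<times> {1..})"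
    by (rule has_sum_SigmaI[OF _ has_sum_cmult_left[OF G] sm]) (use F in \<open>auto intro!: has_sum_cmult_right\<close>)
  also have "?this \<longleftrightarrow> ((\<lambda>(n, d). g d * f (n div d)) has_sum (moebius_dirichlet s * riemann_zeta s)) (SIGMA n:{1..}. {d. d dvd n})"
    by (rule has_sum_reindex_bij_witness[of _ "\<lambda>(n, d). (d, n div d)" "\<lambda>(d, m). (d * m, d)"])
       (auto elim!: dvdE simp: Suc_le_eq)
  finally have "((\<lambda>n. if n = 1 then 1 else 0) has_sum (moebius_dirichlet s * riemann_zeta s)) {1::nat..}"
  proof (rule has_sum_SigmaD)
    fix n :: nat assume n: "n \<in> {1..}"
    have "(\<Sum>d | d dvd n. g d * f (n div d)) = (\<Sum>d | d dvd n. of_int (moebius_mu d) * of_nat n powr (-s))"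
    proof (rule sum.cong[OF refl])
      fix d assume "d \<in> {d. d dvd n}"
      then obtain m where m: "n = d * m" by auto
      have "d > 0" using n m by (cases "d = 0") auto
      have "of_nat n powr (-s) = (of_nat d :: complex) powr (-s) * of_nat m powr (-s)"
        unfolding m of_nat_mult using powr_times_real[of "of_nat d" "of_nat m" "-s"] by simp
      thus "g d * f (n div d) = of_int (moebius_mu d) * of_nat n powr (-s)"
        using \<open>d > 0\<close> m by (simp add: g_def f_def)
    qed
    also have "\<dots> = of_int (\<Sum>d | d dvd n. moebius_mu d) * of_nat n powr (-s)"
      by (simp add: sum_distrib_right)
    also have "\<dots> = (if n = 1 then 1 else 0)" using n by (subst sum_moebius_mu_divisors) auto
    finally show "((\<lambda>d. case (n, d) of (n, d) \<Rightarrow> g d * f (n div d)) has_sum (if n = 1 then 1 else 0)) {d. d dvd n}"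
      using n by (intro has_sum_finiteI) auto
  qed
  moreover have "((\<lambda>n. if n = 1 then 1 else 0 :: complex) has_sum 1) {1::nat..}"
  proof -
    have "((\<lambda>n. if n = 1 then 1 else 0 :: complex) has_sum 1) {1::nat}" by (intro has_sum_finiteI) auto
    thus ?thesis by (subst (asm) has_sum_cong_neutral[where T = "{1..}" and g = "\<lambda>n. if n = 1 then 1 else 0"]) auto
  qed
  ultimately show ?thesis by (rule has_sum_unique)
qed

section \<open>Growth of \<open>1 / \<zeta>\<close> in a zero-free half-plane\<close>

text \<open>Since Re f < a, the value f(z) is nearer to 0 than to 2 a, so
  \<open>g = f / (2 a - f)\<close> maps the unit disc into itself and fixes 0. The Schwarz lemma
  bounds \<open>g\<close> by \<open>\<rho>\<close>; solving for f gives the estimate.\<close>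

lemma Borel_Caratheodory_unit:
  fixes f :: "complex \<Rightarrow> complex"
  assumes f: "f holomorphic_on ball 0 1" and f0: "f 0 = 0" and a: "\<And>z. norm z < 1 \<Longrightarrow> Re (f z) < a"
    and z: "norm z \<le> \<rho>" "\<rho> < 1"
  shows "norm (f z) \<le> 2 * a * (\<rho> / (1 - \<rho>))"
proof -
  have a0: "a > 0" using a[of 0] f0 by simp
  define g where "g = (\<lambda>z. f z / (2 * of_real a - f z))"
  have nz: "2 * of_real a - f z \<noteq> 0" if "norm z < 1" for z
  proof
    assume "2 * of_real a - f z = 0"
    hence "Re (2 * of_real a - f z) = 0" by simp
    thus False using a[OF that] a0 by simp
  qed
  have lt: "norm (g z) < 1" if z: "norm z < 1" for z
  proof -
    have "(norm (f z))\<^sup>2 < (norm (2 * of_real a - f z))\<^sup>2"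
      using a[OF z] a0 unfolding cmod_power2 by (simp add: power2_eq_square algebra_simps)
    hence "norm (f z) < norm (2 * of_real a - f z)" by (rule power_less_imp_less_base) simp
    thus ?thesis using nz[OF z] by (simp add: g_def norm_divide)
  qed
  have z1: "norm z < 1" using z by linarith
  have "norm (g z) \<le> norm z"
  proof (rule Schwarz_Lemma(1))
    show "g holomorphic_on ball 0 1" unfolding g_def
      by (intro holomorphic_intros f) (use nz in auto)
  qed (use lt z1 f0 in \<open>auto simp: g_def\<close>)
  hence gz: "norm (g z) \<le> \<rho>" using z by linarith
  have "f z = 2 * of_real a * g z - g z * f z"
    using nz[OF z1] by (simp add: g_def divide_simps) (simp add: algebra_simps)
  hence "norm (f z) \<le> norm (2 * of_real a * g z) + norm (g z * f z)" by (metis norm_triangle_ineq4)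
  also have "\<dots> = 2 * a * norm (g z) + norm (g z) * norm (f z)" using a0 by (simp add: norm_mult)
  also have "\<dots> \<le> 2 * a * \<rho> + \<rho> * norm (f z)" using a0 gz by (intro add_mono mult_left_mono mult_right_mono) auto
  finally have "norm (f z) * (1 - \<rho>) \<le> 2 * a * \<rho>" by (simp add: algebra_simps)
  thus ?thesis using z by (simp add: field_simps)
qed

text \<open>Rescaled to the unit disc, \<open>Borel_Caratheodory_unit\<close> bounds f on the circle
  of radius \<open>\<rho> * R\<close>, where Cauchy's inequality is applied. An upper bound on Re f
  alone thus controls all Taylor coefficients.\<close>

lemma Borel_Caratheodory_coeff:
  fixes f :: "complex \<Rightarrow> complex"
  assumes f: "f holomorphic_on ball w R" and f0: "f w = 0" and a: "\<And>z. z \<in> ball w R \<Longrightarrow> Re (f z) < a"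
    and R: "R > 0" and \<rho>: "0 < \<rho>" "\<rho> < 1"
  shows "norm ((deriv ^^ n) f w / fact n) \<le> 2 * a * (\<rho> / (1 - \<rho>)) / (\<rho> * R) ^ n"
proof -
  have img: "w + of_real R * z \<in> ball w R" if "norm z < 1" for z
    using that R by (simp add: dist_norm norm_mult)
  have bnd: "norm (f x) \<le> 2 * a * (\<rho> / (1 - \<rho>))" if x: "norm (w - x) = \<rho> * R" for x
  proof -
    define h where "h = (\<lambda>z. f (w + of_real R * z))"
    have "norm (h ((x - w) / of_real R)) \<le> 2 * a * (\<rho> / (1 - \<rho>))"
    proof (rule Borel_Caratheodory_unit[where f = h])
      show "h holomorphic_on ball 0 1" unfolding h_def
        by (rule holomorphic_on_compose_gen[unfolded o_def, OF _ f]) (use img in \<open>auto intro!: holomorphic_intros\<close>)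
      show "norm ((x - w) / of_real R) \<le> \<rho>" using x R by (simp add: norm_divide norm_minus_commute)
    qed (use f0 a img \<rho> in \<open>auto simp: h_def\<close>)
    thus ?thesis using R by (simp add: h_def)
  qed
  have sub: "cball w (\<rho> * R) \<subseteq> ball w R" using \<rho> R by (subst cball_subset_ball_iff) auto
  have "norm ((deriv ^^ n) f w) \<le> fact n * (2 * a * (\<rho> / (1 - \<rho>))) / (\<rho> * R) ^ n"
  proof (rule Cauchy_inequality[OF _ _ _ bnd])
    show "f holomorphic_on ball w (\<rho> * R)" using sub by (intro holomorphic_on_subset[OF f]) auto
    show "continuous_on (cball w (\<rho> * R)) f" using sub by (intro holomorphic_on_imp_continuous_on holomorphic_on_subset[OF f])
  qed (use \<rho> R in auto)
  hence "norm ((deriv ^^ n) f w) / fact n \<le> fact n * (2 * a * (\<rho> / (1 - \<rho>))) / (\<rho> * R) ^ n / fact n"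
    by (rule divide_right_mono) simp
  thus ?thesis by (simp add: norm_divide)
qed

text \<open>A substitute for the three circles theorem: the low-order Taylor coefficients are controlled by the
  bound \<open>K\<close> on the small disc, the tail by the bound \<open>A\<close> on the large disc times an arbitrarily small factor.\<close>

lemma two_discs_bound:
  fixes r1 r2 R K \<epsilon> :: real
  assumes r: "0 < r1" "r1 \<le> R" "0 < r2" "r2 < R" and K: "K \<ge> 0" and \<epsilon>: "\<epsilon> > 0"
  obtains C where "\<And>w g A z. g holomorphic_on ball w R \<Longrightarrow> (\<And>z. z \<in> ball w R \<Longrightarrow> Re (g z) < A) \<Longrightarrow>
     (\<And>z. z \<in> ball w r1 \<Longrightarrow> \<bar>Re (g z)\<bar> < K) \<Longrightarrow> z \<in> cball w r2 \<Longrightarrow> norm (g z - g w) \<le> C + \<epsilon> * A"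
proof -
  \<comment> \<open>The midpoint of r2/R and 1, which makes the tail ratio \<open>q\<close> below
    smaller than 1.\<close>
  define \<rho> where "\<rho> = (1 + r2 / R) / 2"
  have \<rho>: "0 < \<rho>" "\<rho> < 1" "r2 < \<rho> * R" using r by (auto simp: \<rho>_def field_simps)
  define M where "M = \<rho> / (1 - \<rho>)"
  have M: "M > 0" using \<rho> by (simp add: M_def)
  define q where "q = r2 / (\<rho> * R)"
  have q: "0 < q" "q < 1" using \<rho> r by (auto simp: q_def)
  have "(\<lambda>k. 2 * M / (1 - q) * q ^ k) \<longlonglongrightarrow> 2 * M / (1 - q) * 0"
    using q by (intro tendsto_mult_left LIMSEQ_realpow_zero) auto
  hence "\<forall>\<^sub>F k in sequentially. 2 * M / (1 - q) * q ^ k < \<epsilon>" using \<epsilon> by (intro order_tendstoD(2)[where y = "2 * M / (1 - q) * 0"]) auto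
  then obtain k0 where k0: "2 * M / (1 - q) * q ^ k0 < \<epsilon>" by (auto simp: eventually_sequentially)
  \<comment> \<open>Coefficients below \<open>k0\<close> are bounded through the disc of radius
    \<open>r1\<close>; the ratio \<open>r2 / (\<rho> * r1)\<close> may exceed 1, but finitely many
    powers occur. The summand \<open>\<epsilon> * K\<close> arises because subtracting
    \<open>g w\<close> raises the upper bound from \<open>A\<close> to \<open>A + K\<close>.\<close>
  define C where "C = (\<Sum>k<k0. 2 * (2 * K) * M * (r2 / (\<rho> * r1)) ^ k) + \<epsilon> * K"
  show ?thesis
  proof (rule that[of C])
    fix w g A z
    assume g: "g holomorphic_on ball w R" and A: "\<And>z. z \<in> ball w R \<Longrightarrow> Re (g z) < A"
      and K': "\<And>z. z \<in> ball w r1 \<Longrightarrow> \<bar>Re (g z)\<bar> < K" and z: "z \<in> cball w r2"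
    have w: "\<bar>Re (g w)\<bar> < K" using K' r by simp
    have AK: "A + K > 0" using A[of w] w r by simp
    define f where "f = (\<lambda>z. g z - g w)"
    have f: "f holomorphic_on ball w R" "f w = 0" unfolding f_def by (intro holomorphic_intros g) auto
    have f1: "f holomorphic_on ball w r1" using r by (intro holomorphic_on_subset[OF f(1)]) auto
    define c where "c = (\<lambda>n. (deriv ^^ n) f w / fact n)"
    have cR: "norm (c n) \<le> 2 * (A + K) * M / (\<rho> * R) ^ n" for n unfolding c_def M_def
    proof (rule Borel_Caratheodory_coeff[OF f])
      show "Re (f z) < A + K" if "z \<in> ball w R" for z using A[OF that] w by (simp add: f_def)
    qed (use r \<rho> in auto)
    have c1: "norm (c n) \<le> 2 * (2 * K) * M / (\<rho> * r1) ^ n" for n unfolding c_def M_def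
    proof (rule Borel_Caratheodory_coeff[OF f1 f(2)])
      show "Re (f z) < 2 * K" if "z \<in> ball w r1" for z using K'[OF that] w by (simp add: f_def)
    qed (use r \<rho> in auto)
    have zr: "norm (z - w) \<le> r2" using z by (simp add: dist_norm norm_minus_commute)
    have sm: "(\<lambda>n. c n * (z - w) ^ n) sums f z" unfolding c_def
      by (rule holomorphic_power_series[OF f(1)]) (use z r in auto)
    have "f z = (\<Sum>n. c (n + k0) * (z - w) ^ (n + k0)) + (\<Sum>n<k0. c n * (z - w) ^ n)"
      using sums_unique[OF sm] suminf_split_initial_segment[OF sums_summable[OF sm], of k0] by simp
    also have "norm \<dots> \<le> norm (\<Sum>n. c (n + k0) * (z - w) ^ (n + k0)) + norm (\<Sum>n<k0. c n * (z - w) ^ n)"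
      by (rule norm_triangle_ineq)
    also have "norm (\<Sum>n<k0. c n * (z - w) ^ n) \<le> (\<Sum>k<k0. 2 * (2 * K) * M * (r2 / (\<rho> * r1)) ^ k)"
    proof (rule sum_norm_le)
      fix n
      have "norm (c n * (z - w) ^ n) \<le> 2 * (2 * K) * M / (\<rho> * r1) ^ n * r2 ^ n"
        unfolding norm_mult norm_power using c1[of n] zr K M \<rho> r by (intro mult_mono power_mono) auto
      thus "norm (c n * (z - w) ^ n) \<le> 2 * (2 * K) * M * (r2 / (\<rho> * r1)) ^ n" by (simp add: power_divide)
    qed
    also have "norm (\<Sum>n. c (n + k0) * (z - w) ^ (n + k0)) \<le> (\<Sum>n. 2 * (A + K) * M * q ^ k0 * q ^ n)"
    proof (rule norm_suminf_le)
      fix n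
      have "norm (c (n + k0) * (z - w) ^ (n + k0)) \<le> 2 * (A + K) * M / (\<rho> * R) ^ (n + k0) * r2 ^ (n + k0)"
        unfolding norm_mult norm_power using cR[of "n + k0"] zr AK M \<rho> r by (intro mult_mono power_mono) auto
      also have "\<dots> = 2 * (A + K) * M * q ^ (n + k0)" by (simp add: q_def power_divide)
      finally show "norm (c (n + k0) * (z - w) ^ (n + k0)) \<le> 2 * (A + K) * M * q ^ k0 * q ^ n"
        by (simp add: power_add mult_ac)
    qed (use q in \<open>intro summable_mult summable_geometric, auto\<close>)
    also have "\<dots> = (A + K) * (2 * M / (1 - q) * q ^ k0)"
      using q by (subst suminf_mult) (auto simp: suminf_geometric summable_geometric field_simps)
    also have "\<dots> \<le> (A + K) * \<epsilon>" using AK k0 by (intro mult_left_mono) auto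
    finally show "norm (g z - g w) \<le> C + \<epsilon> * A" by (simp add: f_def C_def algebra_simps)
  qed
qed

section \<open>The reciprocal of zeta in the zero-free half-plane\<close>

text \<open>Working form of the Riemann hypothesis: the trivial zeros lie outside this half-plane,
  so no exception is made for them, and zeros left of the critical line are treated by
  reflection.\<close>

definition zeta_zero_free :: bool where
  "zeta_zero_free \<longleftrightarrow> (\<forall>s. Re s > 1/2 \<longrightarrow> s \<noteq> 1 \<longrightarrow> riemann_zeta s \<noteq> 0)"

lemma riemann_hypothesis_imp_zero_free:
  assumes riemann_hypothesis
  shows zeta_zero_free
  unfolding zeta_zero_free_def
proof (intro allI impI notI)
  fix s assume s: "Re s > 1/2" "s \<noteq> 1" "riemann_zeta s = 0"
  have "nontrivial_zeta_zero s" using s by (auto simp: nontrivial_zeta_zero_def)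
  thus False using assms s unfolding riemann_hypothesis_def by force
qed

text \<open>In this form the reciprocal is visibly holomorphic across s = 1, where the denominator
  is 1 and the numerator gives the value 0; \<open>riemann_zeta 1\<close> is only a dummy.\<close>

definition inv_zeta :: "complex \<Rightarrow> complex" where
  "inv_zeta s = (s - 1) / zeta_entire_part s"

lemma inv_zeta_eq: "Re s > -1 \<Longrightarrow> inv_zeta s = (if s = 1 then 0 else 1 / riemann_zeta s)"
  by (simp add: inv_zeta_def zeta_entire_part_eq)

lemma inv_zeta_holo:
  assumes zeta_zero_free
  shows "inv_zeta holomorphic_on {s. Re s > 1/2}"
proof -
  have "zeta_entire_part s \<noteq> 0" if "Re s > 1/2" for s
    using that assms by (auto simp: zeta_entire_part_eq zeta_zero_free_def)
  moreover have "zeta_entire_part holomorphic_on {s. Re s > 1/2}"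
    by (rule holomorphic_on_subset[OF zeta_entire_part_holo]) auto
  ultimately show ?thesis unfolding inv_zeta_def by (intro holomorphic_intros) auto
qed

lemma inv_zeta_moebius: "Re s > 1 \<Longrightarrow> inv_zeta s = moebius_dirichlet s"
  using moebius_dirichlet_times_zeta[of s] by (auto simp: inv_zeta_eq divide_simps)

text \<open>Zeta and its reciprocal are dominated by the same convergent series, so |log |zeta|| is
  at most \<open>ln S\<close> on Re s \<ge> 2.\<close>

lemma zeta_bounds_right:
  obtains S where "S \<ge> 1" "\<And>s. Re s \<ge> 2 \<Longrightarrow> norm (riemann_zeta s) \<le> S" "\<And>s. Re s \<ge> 2 \<Longrightarrow> norm (inv_zeta s) \<le> S"
proof -
  define S where "S = (\<Sum>n. real (Suc n) powr (-2))"
  have sm: "summable (\<lambda>n. real (Suc n) powr (-2))"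
    by (subst summable_Suc_iff) (simp add: summable_real_powr_iff)
  have le: "norm (of_nat (Suc n) powr (-s)) \<le> real (Suc n) powr (-2)" if "Re s \<ge> 2" for s :: complex and n
  proof -
    have "norm (of_nat (Suc n) powr (-s)) = real (Suc n) powr (- Re s)"
      by (simp add: norm_powr_real_powr flip: of_nat_Suc)
    also have "\<dots> \<le> real (Suc n) powr (-2)" using that by (intro powr_mono) auto
    finally show ?thesis .
  qed
  have z: "norm (riemann_zeta s) \<le> S" if s: "Re s \<ge> 2" for s
  proof -
    have "riemann_zeta s = (\<Sum>n. of_nat (Suc n) powr (-s))" using riemann_zeta_sums[of s] s by (simp add: sums_iff)
    thus ?thesis unfolding S_def using norm_suminf_le[OF le[OF s] sm] by (simp only:)
  qed
  have m: "norm (inv_zeta s) \<le> S" if s: "Re s \<ge> 2" for s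
  proof -
    have "norm (of_int (moebius_mu (Suc n)) * of_nat (Suc n) powr (-s)) \<le> real (Suc n) powr (-2)" for n
      using norm_moebius_term_le[of "Suc n" "of_nat (Suc n) powr (-s)"] le[OF s, of n] by linarith
    thus ?thesis using s unfolding S_def by (simp add: inv_zeta_moebius moebius_dirichlet_def norm_suminf_le[OF _ sm] del: of_nat_Suc)
  qed
  have "S \<ge> 1"
    using sum_le_suminf[OF sm, of "{0}"] by (simp add: S_def del: of_nat_Suc) simp
  with z m show ?thesis using that by blast
qed

lemma zeta_growth:
  obtains C where "C > 0" "\<And>s. Re s \<ge> 1/2 \<Longrightarrow> \<bar>Im s\<bar> \<ge> 1/2 \<Longrightarrow> norm (riemann_zeta s) \<le> C * (1 + norm s) ^ 3"
proof -
  obtain C where C: "C > 0" "\<And>s. Re s \<ge> 1/2 \<Longrightarrow> norm (zeta_entire_part s) \<le> C * (1 + norm s) ^ 3"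
    using zeta_entire_part_growth by blast
  have "norm (riemann_zeta s) \<le> 2 * C * (1 + norm s) ^ 3" if s: "Re s \<ge> 1/2" "\<bar>Im s\<bar> \<ge> 1/2" for s
  proof -
    have "s \<noteq> 1" using s by auto
    hence "norm (s - 1) * norm (riemann_zeta s) \<le> C * (1 + norm s) ^ 3"
      using C(2)[OF s(1)] s by (simp add: zeta_entire_part_eq norm_mult)
    moreover have "norm (s - 1) \<ge> 1/2" using abs_Im_le_cmod[of "s - 1"] s by simp
    hence "1/2 * norm (riemann_zeta s) \<le> norm (s - 1) * norm (riemann_zeta s)" by (intro mult_right_mono) auto
    ultimately show ?thesis by linarith
  qed
  thus ?thesis using that[of "2 * C"] C(1) by simp
qed

text \<open>\<open>two_discs_bound\<close> is applied to a logarithm of zeta on discs about 3 + i Im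
  s. The disc of radius 1 lies in Re s \<ge> 2, where log |zeta| is bounded on both sides; on the
  large disc cubic growth gives at most 3 log t plus a constant, and the 3 is absorbed by
  \<open>\<epsilon> / 3\<close>. The condition on Im s keeps the large disc, of radius below 5/2,
  away from the pole.\<close>

lemma inv_zeta_bound_far:
  assumes zf: zeta_zero_free and \<delta>: "0 < \<delta>" "\<delta> \<le> 1/2" and \<epsilon>: "\<epsilon> > 0"
  obtains C where "\<And>s. 1/2 + \<delta> \<le> Re s \<Longrightarrow> Re s \<le> 3 \<Longrightarrow> \<bar>Im s\<bar> \<ge> 3 \<Longrightarrow> norm (inv_zeta s) \<le> C * \<bar>Im s\<bar> powr \<epsilon>"
proof -
  obtain S where S: "S \<ge> 1" "\<And>s. Re s \<ge> 2 \<Longrightarrow> norm (riemann_zeta s) \<le> S" "\<And>s. Re s \<ge> 2 \<Longrightarrow> norm (inv_zeta s) \<le> S"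
    using zeta_bounds_right by blast
  obtain C0 where C0: "C0 > 0" "\<And>s. Re s \<ge> 1/2 \<Longrightarrow> \<bar>Im s\<bar> \<ge> 1/2 \<Longrightarrow> norm (riemann_zeta s) \<le> C0 * (1 + norm s) ^ 3"
    using zeta_growth by blast
  \<comment> \<open>From the centre at real part 3, radius \<open>R\<close> reaches Re s = 1/2 +
    \<delta>/2, still in the zero-free region, and \<open>r2\<close> reaches Re s = 1/2 +
    \<delta>.\<close>
  define R where "R = 5/2 - \<delta> / 2"
  define r2 where "r2 = 5/2 - \<delta>"
  define K where "K = ln S + 1"
  have K: "K \<ge> 1" using S by (simp add: K_def)
  have rr: "(0::real) < 1" "1 \<le> R" "0 < r2" "r2 < R" using \<delta> by (auto simp: R_def r2_def)
  \<comment> \<open>The 64 is 4^3: on the large disc 1 + |z| \<le> t + 7 \<le> 4 t, as t \<ge> 3.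
    The added 1, like the one in \<open>K\<close>, makes the bound strict.\<close>
  define L where "L = \<bar>ln (C0 * 64)\<bar> + 1"
  have prem: "K \<ge> 0" "\<epsilon> / 3 > 0" using K \<epsilon> by auto
  show ?thesis
  proof (rule two_discs_bound[OF rr prem])
    fix C assume C: "\<And>w g A z. g holomorphic_on ball w R \<Longrightarrow> (\<And>z. z \<in> ball w R \<Longrightarrow> Re (g z) < A) \<Longrightarrow>
       (\<And>z. z \<in> ball w 1 \<Longrightarrow> \<bar>Re (g z)\<bar> < K) \<Longrightarrow> z \<in> cball w r2 \<Longrightarrow> norm (g z - g w) \<le> C + (\<epsilon> / 3) * A"
    show ?thesis
    proof (rule that[of "exp (K + C + \<epsilon> / 3 * L)"])
      fix s assume s: "1/2 + \<delta> \<le> Re s" "Re s \<le> 3" "\<bar>Im s\<bar> \<ge> 3"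
      define t where "t = \<bar>Im s\<bar>"
      have t: "t \<ge> 3" using s by (simp add: t_def)
      define w where "w = Complex 3 (Im s)"
      have reg: "Re z > 1/2" "\<bar>Im z\<bar> \<ge> 1/2" "z \<noteq> 1" "norm z \<le> t + 6" if "z \<in> ball w R" for z
      proof -
        have d: "norm (w - z) < 5/2 - \<delta>/2" using that by (simp add: dist_norm R_def)
        show "Re z > 1/2" using abs_Re_le_cmod[of "w - z"] d \<delta> by (simp add: w_def)
        show im: "\<bar>Im z\<bar> \<ge> 1/2" using abs_Im_le_cmod[of "w - z"] d \<delta> s by (simp add: w_def)
        show "z \<noteq> 1" using im by auto
        have "norm w \<le> 3 + t" using cmod_le[of w] by (simp add: w_def t_def)
        thus "norm z \<le> t + 6" using norm_triangle_sub[of z w] d \<delta> by (simp add: norm_minus_commute)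
      qed
      have nz: "riemann_zeta z \<noteq> 0" if "z \<in> ball w R" for z
        using reg[OF that] zf unfolding zeta_zero_free_def by blast
      have holo: "riemann_zeta holomorphic_on ball w R"
        using reg by (intro holomorphic_on_subset[OF riemann_zeta_holo]) auto
      have "\<exists>g. g holomorphic_on ball w R \<and> (\<forall>z\<in>ball w R. riemann_zeta z = exp (g z))"
        using contractible_imp_holomorphic_log[OF holo convex_imp_contractible[OF convex_ball]] nz by metis
      then obtain g where g: "g holomorphic_on ball w R" "\<And>z. z \<in> ball w R \<Longrightarrow> riemann_zeta z = exp (g z)" by blast
      have Re_g: "Re (g z) = ln (norm (riemann_zeta z))" if "z \<in> ball w R" for z
        using g(2)[OF that] by simp
      have A: "Re (g z) < L + 3 * ln t" if z: "z \<in> ball w R" for z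
      proof -
        have "norm (riemann_zeta z) \<le> C0 * (1 + norm z) ^ 3" using reg[OF z] by (intro C0) auto
        also have "\<dots> \<le> C0 * (4 * t) ^ 3" using reg[OF z] t C0 by (intro mult_left_mono power_mono) auto
        finally have "norm (riemann_zeta z) \<le> (C0 * 64) * t ^ 3" by (simp add: power_mult_distrib mult_ac)
        hence "ln (norm (riemann_zeta z)) \<le> ln ((C0 * 64) * t ^ 3)" using nz[OF z] by (subst ln_le_cancel_iff) (use C0 t in auto)
        also have "\<dots> = ln (C0 * 64) + 3 * ln t" using C0 t by (subst ln_mult) (auto simp: ln_realpow)
        finally show ?thesis unfolding Re_g[OF z] L_def by linarith
      qed
      have Ksm: "\<bar>Re (g z)\<bar> < K" if z: "z \<in> ball w 1" for z
      proof -
        have zR: "z \<in> ball w R" using z rr by auto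
        have re: "Re z \<ge> 2" using z abs_Re_le_cmod[of "w - z"] by (simp add: w_def dist_norm)
        have pos: "norm (riemann_zeta z) > 0" using nz[OF zR] by simp
        have "ln (norm (riemann_zeta z)) \<le> ln S" using S(2)[OF re] pos by (subst ln_le_cancel_iff) (use S in auto)
        moreover have "1 / norm (riemann_zeta z) \<le> S" using S(3)[OF re] reg[OF zR] re by (simp add: inv_zeta_eq norm_divide)
        hence "ln (1 / norm (riemann_zeta z)) \<le> ln S" using pos by (subst ln_le_cancel_iff) (use S in auto)
        hence "- ln (norm (riemann_zeta z)) \<le> ln S" using pos by (simp add: ln_div)
        ultimately show ?thesis unfolding Re_g[OF zR] K_def by linarith
      qed
      have "w - s = of_real (3 - Re s)" by (simp add: w_def complex_eq_iff)
      hence "norm (w - s) = 3 - Re s" using s by (simp add: norm_of_real del: of_real_diff)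
      hence sr: "s \<in> cball w r2" using s by (simp add: dist_norm r2_def)
      hence sR: "s \<in> ball w R" using rr by auto
      have "norm (g s - g w) \<le> C + \<epsilon> / 3 * (L + 3 * ln t)" by (rule C[OF g(1) A Ksm sr])
      hence "\<bar>Re (g s) - Re (g w)\<bar> \<le> C + \<epsilon> / 3 * (L + 3 * ln t)" using abs_Re_le_cmod[of "g s - g w"] by simp
      moreover have "\<bar>Re (g w)\<bar> < K" by (rule Ksm) simp
      ultimately have "- Re (g s) \<le> (K + C + \<epsilon> / 3 * L) + \<epsilon> * ln t" by (simp add: algebra_simps)
      hence "exp (- Re (g s)) \<le> exp (K + C + \<epsilon> / 3 * L) * exp (\<epsilon> * ln t)" by (simp add: exp_add[symmetric])
      also have "exp (\<epsilon> * ln t) = t powr \<epsilon>" using t by (simp add: powr_def)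
      also have "exp (- Re (g s)) = norm (inv_zeta s)"
        using reg[OF sR] g(2)[OF sR] by (simp add: inv_zeta_eq norm_divide exp_minus inverse_eq_divide)
      finally show "norm (inv_zeta s) \<le> exp (K + C + \<epsilon> / 3 * L) * \<bar>Im s\<bar> powr \<epsilon>" by (simp only: t_def)
    qed
  qed
qed

lemma inv_zeta_bound:
  assumes zf: zeta_zero_free and \<delta>: "0 < \<delta>" "\<delta> \<le> 1/2" and \<epsilon>: "\<epsilon> > 0"
  obtains C where "C > 0" "\<And>s. 1/2 + \<delta> \<le> Re s \<Longrightarrow> Re s \<le> 3 \<Longrightarrow> norm (inv_zeta s) \<le> C * (1 + \<bar>Im s\<bar>) powr \<epsilon>"
proof -
  obtain C where C: "\<And>s. 1/2 + \<delta> \<le> Re s \<Longrightarrow> Re s \<le> 3 \<Longrightarrow> \<bar>Im s\<bar> \<ge> 3 \<Longrightarrow> norm (inv_zeta s) \<le> C * \<bar>Im s\<bar> powr \<epsilon>"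
    using inv_zeta_bound_far[OF assms] by blast
  let ?B = "cbox (Complex (1/2 + \<delta>) (-3)) (Complex 3 3)"
  have "continuous_on ?B inv_zeta"
    using \<delta> by (intro holomorphic_on_imp_continuous_on holomorphic_on_subset[OF inv_zeta_holo[OF zf]]) (auto simp: in_cbox_complex_iff)
  hence "bounded (inv_zeta ` ?B)" by (intro compact_imp_bounded compact_continuous_image) auto
  then obtain D where D: "\<And>s. s \<in> ?B \<Longrightarrow> norm (inv_zeta s) \<le> D" unfolding bounded_iff by blast
  show ?thesis
  proof (rule that[of "\<bar>C\<bar> + \<bar>D\<bar> + 1"])
    fix s assume s: "1/2 + \<delta> \<le> Re s" "Re s \<le> 3"
    have p1: "(1 + \<bar>Im s\<bar>) powr \<epsilon> \<ge> 1" using \<epsilon> by (intro ge_one_powr_ge_zero) auto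
    show "norm (inv_zeta s) \<le> (\<bar>C\<bar> + \<bar>D\<bar> + 1) * (1 + \<bar>Im s\<bar>) powr \<epsilon>"
    proof (cases "\<bar>Im s\<bar> \<ge> 3")
      case True
      have "norm (inv_zeta s) \<le> C * \<bar>Im s\<bar> powr \<epsilon>" by (rule C[OF s True])
      also have "\<dots> \<le> (\<bar>C\<bar> + \<bar>D\<bar> + 1) * (1 + \<bar>Im s\<bar>) powr \<epsilon>" using \<epsilon> by (intro mult_mono powr_mono2) auto
      finally show ?thesis .
    next
      case False
      hence "norm (inv_zeta s) \<le> D" using s by (intro D) (auto simp: in_cbox_complex_iff)
      also have "\<dots> \<le> (\<bar>C\<bar> + \<bar>D\<bar> + 1) * 1" by simp
      also have "\<dots> \<le> (\<bar>C\<bar> + \<bar>D\<bar> + 1) * (1 + \<bar>Im s\<bar>) powr \<epsilon>" using p1 by (intro mult_left_mono) auto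
      finally show ?thesis .
    qed
  qed auto
qed

section \<open>Perron's formula\<close>

lemma integrable_one_plus_abs_powr:
  fixes p :: real
  assumes "p > 1"
  shows "integrable lborel (\<lambda>t. (1 + \<bar>t\<bar>) powr (-p))"
proof (rule integrableI_bounded)
  define h where "h = (\<lambda>t. ennreal ((1 + t) powr (-p)) * indicator {0..} t)"
  have [measurable]: "h \<in> borel_measurable borel" unfolding h_def by measurable
  have "integral\<^sup>N lborel h = ennreal (0 - (1 + 0) powr (1 - p) / (1 - p))"
    unfolding h_def
  proof (rule nn_integral_FTC_atLeast)
    show "((\<lambda>t. (1 + t) powr (1 - p) / (1 - p)) has_real_derivative (1 + x) powr (- p)) (at x)" if "0 \<le> x" for x
      using that assms by (auto intro!: derivative_eq_intros)
    show "((\<lambda>t. (1 + t) powr (1 - p) / (1 - p)) \<longlongrightarrow> 0) at_top"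
      using assms by real_asymp
  qed auto
  hence fin: "integral\<^sup>N lborel h < \<infinity>" by simp
  have refl: "(\<integral>\<^sup>+t. h t \<partial>lborel) = (\<integral>\<^sup>+t. h (0 + (-1) * t) \<partial>lborel)"
    by (subst nn_integral_real_affine[of h "-1" 0]) auto
  have "(\<integral>\<^sup>+t. ennreal (norm ((1 + \<bar>t\<bar>) powr (-p))) \<partial>lborel) \<le> (\<integral>\<^sup>+t. h t + h (0 + (-1) * t) \<partial>lborel)"
    by (intro nn_integral_mono) (auto simp: h_def split: split_indicator)
  also have "\<dots> = (\<integral>\<^sup>+t. h t \<partial>lborel) + (\<integral>\<^sup>+t. h (0 + (-1) * t) \<partial>lborel)"
    by (rule nn_integral_add) measurable
  also have "\<dots> < \<infinity>" using fin unfolding refl[symmetric] by simp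
  finally show "(\<integral>\<^sup>+t. ennreal (norm ((1 + \<bar>t\<bar>) powr (-p))) \<partial>lborel) < \<infinity>" .
qed measurable

lemma integrable_vertical_line:
  fixes f :: "real \<Rightarrow> complex"
  assumes p: "p > 1" and cont: "continuous_on UNIV f" and bnd: "\<And>t. norm (f t) \<le> C * (1 + \<bar>t\<bar>) powr (-p)"
  shows "integrable lborel f"
proof (rule Bochner_Integration.integrable_bound)
  show "integrable lborel (\<lambda>t. C * (1 + \<bar>t\<bar>) powr (-p))"
    by (intro integrable_mult_right integrable_one_plus_abs_powr p)
  show "f \<in> borel_measurable lborel" using borel_measurable_continuous_onI[OF cont] by simp
  show "AE t in lborel. norm (f t) \<le> norm (C * (1 + \<bar>t\<bar>) powr (-p))"
    by (intro AE_I2) (auto intro: order.trans[OF bnd abs_ge_self])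
qed

lemma integral_symmetric_interval_tendsto:
  fixes f :: "real \<Rightarrow> complex"
  assumes f: "integrable lborel f"
  shows "(\<lambda>n. integral {- real n..real n} f) \<longlonglongrightarrow> integral\<^sup>L lborel f"
proof -
  have [measurable]: "f \<in> borel_measurable borel" using borel_measurable_integrable[OF f] by simp
  have "(\<lambda>n. LINT t|lborel. indicator {- real n..real n} t *\<^sub>R f t) \<longlonglongrightarrow> integral\<^sup>L lborel f"
  proof (rule integral_dominated_convergence)
    show "integrable lborel (\<lambda>t. norm (f t))" using f by simp
    show "AE t in lborel. (\<lambda>n. indicator {- real n..real n} t *\<^sub>R f t) \<longlonglongrightarrow> f t"
    proof (rule AE_I2)
      fix t :: real
      obtain n0 where n0: "\<bar>t\<bar> \<le> real n0" using real_arch_simple by blast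
      have "\<forall>\<^sub>F n in sequentially. indicator {- real n..real n} t *\<^sub>R f t = f t"
        using eventually_ge_at_top[of n0]
      proof eventually_elim
        case (elim n)
        hence "real n0 \<le> real n" by simp
        hence "t \<in> {- real n..real n}" using n0 by auto
        thus ?case by simp
      qed
      thus "(\<lambda>n. indicator {- real n..real n} t *\<^sub>R f t) \<longlonglongrightarrow> f t" by (rule tendsto_eventually)
    qed
    show "AE t in lborel. norm (indicator {- real n..real n} t *\<^sub>R f t) \<le> norm (f t)" for n
      by (auto split: split_indicator)
  qed measurable
  moreover have "(LINT t|lborel. indicator {- real n..real n} t *\<^sub>R f t) = integral {- real n..real n} f" for n
  proof -
    have "set_integrable lborel {- real n..real n} f"
      unfolding set_integrable_def by (rule integrable_mult_indicator) (use f in auto)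
    from set_borel_integral_eq_integral(2)[OF this] show ?thesis by (simp add: set_lebesgue_integral_def)
  qed
  ultimately show ?thesis by simp
qed

lemma contour_integral_rectpath:
  assumes a: "a < b" and T: "T > 0"
    and cont: "continuous_on (path_image (rectpath (Complex a (-T)) (Complex b T))) f"
  shows "contour_integral (rectpath (Complex a (-T)) (Complex b T)) f =
     contour_integral (linepath (Complex a (-T)) (Complex b (-T))) f + \<i> * integral {-T..T} (\<lambda>t. f (Complex b t))
     - contour_integral (linepath (Complex a T) (Complex b T)) f - \<i> * integral {-T..T} (\<lambda>t. f (Complex a t))"
proof -
  let ?a1 = "Complex a (-T)" and ?a2 = "Complex b (-T)" and ?a3 = "Complex b T" and ?a4 = "Complex a T"
  have im: "path_image (rectpath ?a1 ?a3) = closed_segment ?a1 ?a2 \<union> closed_segment ?a2 ?a3 \<union> closed_segment ?a3 ?a4 \<union> closed_segment ?a4 ?a1"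
    by (simp add: rectpath_def Let_def path_image_join Un_assoc)
  have c: "f contour_integrable_on linepath ?a1 ?a2" "f contour_integrable_on linepath ?a2 ?a3"
    "f contour_integrable_on linepath ?a3 ?a4" "f contour_integrable_on linepath ?a4 ?a1"
    by (intro contour_integrable_continuous_linepath continuous_on_subset[OF cont]; force simp: im)+
  have "contour_integral (rectpath ?a1 ?a3) f = contour_integral (linepath ?a1 ?a2) f + (contour_integral (linepath ?a2 ?a3) f
     + (contour_integral (linepath ?a3 ?a4) f + contour_integral (linepath ?a4 ?a1) f))"
    using c by (simp add: rectpath_def Let_def contour_integrable_joinI valid_path_join)
  moreover have "contour_integral (linepath ?a2 ?a3) f = \<i> * integral {-T..T} (\<lambda>t. f (Complex b t))"
    using T by (intro contour_integral_linepath_same_Re) auto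
  moreover have "contour_integral (linepath ?a4 ?a1) f = - contour_integral (linepath ?a1 ?a4) f"
    using contour_integral_reversepath[of "linepath ?a1 ?a4" f] by simp
  moreover have "contour_integral (linepath ?a1 ?a4) f = \<i> * integral {-T..T} (\<lambda>t. f (Complex a t))"
    using T by (intro contour_integral_linepath_same_Re) auto
  moreover have "contour_integral (linepath ?a3 ?a4) f = - contour_integral (linepath ?a4 ?a3) f"
    using contour_integral_reversepath[of "linepath ?a4 ?a3" f] by simp
  ultimately show ?thesis by simp
qed

text \<open>The horizontal sides of the rectangle vanish as its height grows. Inside the strip
  \<open>f\<close> is controlled only above height \<open>T0\<close>, so poles are allowed there;
  their residues enter through \<open>c\<close>.\<close>

lemma vertical_line_integral_diff:
  fixes f :: "complex \<Rightarrow> complex"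
  assumes ab: "a < b" and p: "p > 1" and T0: "T0 \<ge> 0"
    and cont: "continuous_on {s. Re s = a \<or> Re s = b \<or> (a \<le> Re s \<and> Re s \<le> b \<and> \<bar>Im s\<bar> > T0)} f"
    and bnd: "\<And>s. Re s = a \<or> Re s = b \<or> (a \<le> Re s \<and> Re s \<le> b \<and> \<bar>Im s\<bar> > T0) \<Longrightarrow> norm (f s) \<le> C * (1 + \<bar>Im s\<bar>) powr (-p)"
    and c: "\<And>T. T > T0 \<Longrightarrow> contour_integral (rectpath (Complex a (-T)) (Complex b T)) f = c"
  shows "\<i> * (integral\<^sup>L lborel (\<lambda>t. f (Complex b t)) - integral\<^sup>L lborel (\<lambda>t. f (Complex a t))) = c"
proof -
  define V where "V = {s. Re s = a \<or> Re s = b \<or> (a \<le> Re s \<and> Re s \<le> b \<and> \<bar>Im s\<bar> > T0)}"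
  have cx: "continuous_on UNIV (\<lambda>t. Complex x t)" for x
    unfolding Complex_eq by (intro continuous_intros)
  have int: "integrable lborel (\<lambda>t. f (Complex x t))" if x: "x = a \<or> x = b" for x
  proof (rule integrable_vertical_line[OF p])
    show "continuous_on UNIV (\<lambda>t. f (Complex x t))"
      by (rule continuous_on_compose2[OF cont cx]) (use x in auto)
    show "norm (f (Complex x t)) \<le> C * (1 + \<bar>t\<bar>) powr (-p)" for t
      using bnd[of "Complex x t"] x by auto
  qed
  define B where "B = (\<lambda>T::real. C * (1 + T) powr (-p) * (b - a))"
  have hor: "norm (contour_integral (linepath (Complex a y) (Complex b y)) f) \<le> B \<bar>y\<bar>" if y: "\<bar>y\<bar> > T0" for y
  proof -
    have seg: "Re s \<ge> a \<and> Re s \<le> b \<and> Im s = y" if "s \<in> closed_segment (Complex a y) (Complex b y)" for s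
      using that ab by (auto simp: closed_segment_same_Im closed_segment_eq_real_ivl)
    have sub: "closed_segment (Complex a y) (Complex b y) \<subseteq> V" using seg y by (auto simp: V_def)
    have "norm (contour_integral (linepath (Complex a y) (Complex b y)) f) \<le> C * (1 + \<bar>y\<bar>) powr (-p) * norm (Complex b y - Complex a y)"
    proof (rule contour_integral_bound_linepath)
      show "f contour_integrable_on linepath (Complex a y) (Complex b y)"
        by (intro contour_integrable_continuous_linepath continuous_on_subset[OF cont[folded V_def]] sub)
      show "norm (f s) \<le> C * (1 + \<bar>y\<bar>) powr (-p)" if s: "s \<in> closed_segment (Complex a y) (Complex b y)" for s
        using bnd[of s] seg[OF s] y by auto
      show "0 \<le> C * (1 + \<bar>y\<bar>) powr (-p)"
        using bnd[of "Complex a y"] by (metis complex.sel norm_ge_zero order_trans)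
    qed
    also have "norm (Complex b y - Complex a y) = b - a" using ab by (simp add: cmod_def)
    finally show ?thesis by (simp add: B_def)
  qed
  have "(\<lambda>n. (1 + real n) powr (-p)) \<longlonglongrightarrow> 0"
    using p by real_asymp
  hence B0: "(\<lambda>n. B (real n)) \<longlonglongrightarrow> 0"
    unfolding B_def by (auto intro!: tendsto_mult_left_zero tendsto_mult_right_zero)
  have ev: "\<forall>\<^sub>F n in sequentially. real n > T0 \<and> real n > 0"
  proof -
    obtain n0 where "max T0 0 < real n0" using reals_Archimedean2 by blast
    thus ?thesis by (intro eventually_sequentiallyI[of n0]) auto
  qed
  have h1: "(\<lambda>n. contour_integral (linepath (Complex a (- real n)) (Complex b (- real n))) f) \<longlonglongrightarrow> 0"
    by (rule Lim_null_comparison[OF _ B0]) (use ev hor[of "- real _"] in \<open>auto elim!: eventually_mono\<close>)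
  have h2: "(\<lambda>n. contour_integral (linepath (Complex a (real n)) (Complex b (real n))) f) \<longlonglongrightarrow> 0"
    by (rule Lim_null_comparison[OF _ B0]) (use ev hor[of "real _"] in \<open>auto elim!: eventually_mono\<close>)
  have "(\<lambda>n. contour_integral (linepath (Complex a (- real n)) (Complex b (- real n))) f + \<i> * integral {- real n..real n} (\<lambda>t. f (Complex b t))
     - contour_integral (linepath (Complex a (real n)) (Complex b (real n))) f - \<i> * integral {- real n..real n} (\<lambda>t. f (Complex a t)))
     \<longlonglongrightarrow> 0 + \<i> * integral\<^sup>L lborel (\<lambda>t. f (Complex b t)) - 0 - \<i> * integral\<^sup>L lborel (\<lambda>t. f (Complex a t))"
    by (intro tendsto_intros h1 h2 integral_symmetric_interval_tendsto int) auto
  moreover have "\<forall>\<^sub>F n in sequentially. contour_integral (linepath (Complex a (- real n)) (Complex b (- real n))) f + \<i> * integral {- real n..real n} (\<lambda>t. f (Complex b t))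
     - contour_integral (linepath (Complex a (real n)) (Complex b (real n))) f - \<i> * integral {- real n..real n} (\<lambda>t. f (Complex a t)) = c"
    using ev
  proof eventually_elim
    case (elim n)
    have "path_image (rectpath (Complex a (- real n)) (Complex b (real n))) \<subseteq> V"
    proof -
      have "path_image (rectpath (Complex a (- real n)) (Complex b (real n))) = cbox (Complex a (- real n)) (Complex b (real n)) - box (Complex a (- real n)) (Complex b (real n))"
        using ab elim by (intro path_image_rectpath_cbox_minus_box) auto
      thus ?thesis using elim by (auto simp: V_def in_cbox_complex_iff in_box_complex_iff)
    qed
    thus ?case using contour_integral_rectpath[of a b "real n" f] ab elim c[of "real n"]
      by (simp add: continuous_on_subset[OF cont[folded V_def]])
  qed
  ultimately have "0 + \<i> * integral\<^sup>L lborel (\<lambda>t. f (Complex b t)) - 0 - \<i> * integral\<^sup>L lborel (\<lambda>t. f (Complex a t)) = c"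
    by (rule LIMSEQ_unique[OF _ tendsto_eventually])
  thus ?thesis by (simp add: algebra_simps)
qed

lemma vertical_line_integral_shift:
  fixes f :: "complex \<Rightarrow> complex"
  assumes ab: "a < b" and p: "p > 1" and ca: "c < a"
    and f: "f holomorphic_on {s. Re s > c}"
    and bnd: "\<And>s. a \<le> Re s \<Longrightarrow> Re s \<le> b \<Longrightarrow> norm (f s) \<le> C * (1 + \<bar>Im s\<bar>) powr (-p)"
  shows "integral\<^sup>L lborel (\<lambda>t. f (Complex b t)) = integral\<^sup>L lborel (\<lambda>t. f (Complex a t))"
proof -
  have "\<i> * (integral\<^sup>L lborel (\<lambda>t. f (Complex b t)) - integral\<^sup>L lborel (\<lambda>t. f (Complex a t))) = 0"
  proof (rule vertical_line_integral_diff[OF ab p order.refl])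
    show "continuous_on {s. Re s = a \<or> Re s = b \<or> (a \<le> Re s \<and> Re s \<le> b \<and> \<bar>Im s\<bar> > 0)} f"
      using ab ca by (intro holomorphic_on_imp_continuous_on holomorphic_on_subset[OF f]) auto
    show "contour_integral (rectpath (Complex a (-T)) (Complex b T)) f = 0" if "T > 0" for T
    proof (rule contour_integral_unique, rule Cauchy_theorem_convex_simple[OF f])
      show "path_image (rectpath (Complex a (-T)) (Complex b T)) \<subseteq> {s. Re s > c}"
        using path_image_rectpath_subset_cbox[of "Complex a (-T)" "Complex b T"] ab ca that
        by (auto simp: in_cbox_complex_iff)
    qed (auto intro: convex_halfspace_Re_gt)
  qed (use bnd ab in auto)
  thus ?thesis by simp
qed

section \<open>The smoothed Perron kernel\<close>

text \<open>The quadratic decay of 1/(s (s + 1)) makes the Perron integral absolutely convergent. It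
  yields the ramp \<open>max (y - 1) 0\<close> instead of the unit step that belongs to 1/s.\<close>

definition perron_kernel :: "real \<Rightarrow> complex \<Rightarrow> complex" where
  "perron_kernel y s = of_real y powr (s + 1) / (s * (s + 1))"

lemma of_real_powr_exp: "x > 0 \<Longrightarrow> complex_of_real x powr a = exp (a * of_real (ln x))"
  by (simp add: powr_def Ln_of_real)

lemma norm_of_real_powr: "x > 0 \<Longrightarrow> norm (complex_of_real x powr a) = x powr Re a"
  by (simp add: norm_powr_real_powr)

lemma norm_ge_one_plus_Im:
  assumes "\<bar>Re s\<bar> \<ge> 1/2 \<or> \<bar>Im s\<bar> \<ge> 1"
  shows "(1 + \<bar>Im s\<bar>) / 3 \<le> norm s"
  using assms abs_Re_le_cmod[of s] abs_Im_le_cmod[of s] by auto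

text \<open>The 9 is 3^2: away from the poles, \<open>s\<close> and \<open>s + 1\<close> are each at
  least (1 + |Im s|)/3 in modulus.\<close>

lemma norm_perron_kernel:
  assumes y: "y > 0" and s: "\<bar>Re s\<bar> \<ge> 1/2 \<and> \<bar>Re s + 1\<bar> \<ge> 1/2 \<or> \<bar>Im s\<bar> \<ge> 1"
  shows "norm (perron_kernel y s) \<le> 9 * y powr (Re s + 1) * (1 + \<bar>Im s\<bar>) powr (-2)"
proof -
  define u where "u = 1 + \<bar>Im s\<bar>"
  have u: "u \<ge> 1" by (simp add: u_def)
  have "u / 3 \<le> norm s" "u / 3 \<le> norm (s + 1)"
    using s norm_ge_one_plus_Im[of s] norm_ge_one_plus_Im[of "s + 1"] by (auto simp: u_def)
  hence "u / 3 * (u / 3) \<le> norm s * norm (s + 1)" using u by (intro mult_mono) auto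
  hence "norm (perron_kernel y s) \<le> y powr (Re s + 1) / (u / 3 * (u / 3))"
    unfolding perron_kernel_def norm_divide norm_mult using y u
    by (intro frac_le) (auto simp: norm_of_real_powr)
  also have "\<dots> = 9 * y powr (Re s + 1) * u powr (-2)"
    using u by (simp add: powr_minus powr_numeral power2_eq_square field_simps)
  finally show ?thesis by (simp add: u_def)
qed

lemma perron_kernel_holo [holomorphic_intros]:
  assumes "y > 0" "0 \<notin> A" "-1 \<notin> A"
  shows "perron_kernel y holomorphic_on A"
proof -
  have "s * (s + 1) \<noteq> 0" if "s \<in> A" for s
    using that assms by (auto simp: add_eq_0_iff2)
  thus ?thesis unfolding perron_kernel_def using assms
    by (intro holomorphic_intros) (auto simp: complex_nonpos_Reals_iff)
qed

lemma perron_kernel_line_continuous: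
  assumes "y > 0" "a \<noteq> 0" "a \<noteq> -1"
  shows "continuous_on UNIV (\<lambda>t. perron_kernel y (Complex a t))"
proof -
  have "continuous_on {s. Re s = a} (perron_kernel y)"
    using assms by (intro holomorphic_on_imp_continuous_on perron_kernel_holo) auto
  moreover have "continuous_on UNIV (\<lambda>t. Complex a t)"
    unfolding Complex_eq by (intro continuous_intros)
  ultimately show ?thesis by (rule continuous_on_compose2) auto
qed

lemma integrable_perron_kernel:
  assumes "y > 0" "\<bar>a\<bar> \<ge> 1/2" "\<bar>a + 1\<bar> \<ge> 1/2"
  shows "integrable lborel (\<lambda>t. perron_kernel y (Complex a t))"
  by (rule integrable_vertical_line[of 2 _ "9 * y powr (a + 1)"])
     (use assms norm_perron_kernel[of y "Complex a _"] in \<open>auto intro!: perron_kernel_line_continuous\<close>)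

text \<open>The line can be moved arbitrarily far to the right without crossing a pole, and
  \<open>y powr (b + 1)\<close> tends to 0 there because y < 1.\<close>

lemma perron_kernel_integral_lt_1:
  assumes y: "0 < y" "y < 1"
  shows "integral\<^sup>L lborel (\<lambda>t. perron_kernel y (Complex 2 t)) = 0"
proof -
  define I where "I = integral\<^sup>L lborel (\<lambda>t. perron_kernel y (Complex 2 t))"
  define J where "J = integral\<^sup>L lborel (\<lambda>t::real. (1 + \<bar>t\<bar>) powr (-2))"
  have bd: "norm I \<le> y powr (real n + 4) * (9 * J)" for n
  proof -
    define b where "b = real n + 3"
    have "integral\<^sup>L lborel (\<lambda>t. perron_kernel y (Complex b t)) = I" unfolding I_def
    proof (rule vertical_line_integral_shift[where p = 2 and c = 1 and C = 9])
      show "perron_kernel y holomorphic_on {s. 1 < Re s}" using y by (intro perron_kernel_holo) auto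
      show "norm (perron_kernel y s) \<le> 9 * (1 + \<bar>Im s\<bar>) powr (-2)" if "2 \<le> Re s" for s
      proof -
        have "norm (perron_kernel y s) \<le> 9 * y powr (Re s + 1) * (1 + \<bar>Im s\<bar>) powr (-2)"
          using y that by (intro norm_perron_kernel) auto
        also have "\<dots> \<le> 9 * 1 * (1 + \<bar>Im s\<bar>) powr (-2)"
          using y that powr_mono2[of "Re s + 1" y 1] by (intro mult_right_mono mult_left_mono) auto
        finally show ?thesis by simp
      qed
    qed (auto simp: b_def)
    moreover have "norm (integral\<^sup>L lborel (\<lambda>t. perron_kernel y (Complex b t))) \<le> integral\<^sup>L lborel (\<lambda>t::real. 9 * y powr (b + 1) * (1 + \<bar>t\<bar>) powr (-2))"
    proof (rule Bochner_Integration.integral_norm_bound_integral)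
      show "integrable lborel (\<lambda>t. perron_kernel y (Complex b t))"
        using y by (intro integrable_perron_kernel) (auto simp: b_def)
      show "integrable lborel (\<lambda>t::real. 9 * y powr (b + 1) * (1 + \<bar>t\<bar>) powr (-2))"
        by (intro integrable_mult_right integrable_one_plus_abs_powr) auto
      show "norm (perron_kernel y (Complex b t)) \<le> 9 * y powr (b + 1) * (1 + \<bar>t\<bar>) powr (-2)" for t
        using norm_perron_kernel[of y "Complex b t"] y by (simp add: b_def)
    qed
    ultimately show ?thesis by (simp add: b_def J_def add.commute mult_ac)
  qed
  have "((\<lambda>x. y powr x) \<longlongrightarrow> 0) at_top" using y by real_asymp
  hence "(\<lambda>n. y powr (real n + 4)) \<longlonglongrightarrow> 0"
    by (rule filterlim_compose) real_asymp
  hence "(\<lambda>n. y powr (real n + 4) * (9 * J)) \<longlonglongrightarrow> 0 * (9 * J)" by (intro tendsto_intros)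
  hence "norm I \<le> 0 * (9 * J)" by (rule LIMSEQ_le_const) (use bd in auto)
  thus ?thesis by (simp add: I_def)
qed

text \<open>Moving the line to Re s = -3 crosses the poles 0 and -1, whose residues y and -1 give y
  - 1. The integral on the new line vanishes.\<close>

lemma perron_kernel_integral_gt_1:
  assumes y: "y > 1"
  shows "integral\<^sup>L lborel (\<lambda>t. perron_kernel y (Complex 2 t)) = of_real (2 * pi * (y - 1))"
proof -
  have "\<i> * (integral\<^sup>L lborel (\<lambda>t. perron_kernel y (Complex 2 t)) - integral\<^sup>L lborel (\<lambda>t. perron_kernel y (Complex (-3) t)))
     = 2 * of_real pi * \<i> * of_real (y - 1)"
  proof (rule vertical_line_integral_diff[where p = 2 and ?T0.0 = 1 and C = "9 * y powr 3"])
    show "continuous_on {s. Re s = -3 \<or> Re s = 2 \<or> -3 \<le> Re s \<and> Re s \<le> 2 \<and> 1 < \<bar>Im s\<bar>} (perron_kernel y)"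
      using y by (intro holomorphic_on_imp_continuous_on perron_kernel_holo) auto
    show "norm (perron_kernel y s) \<le> 9 * y powr 3 * (1 + \<bar>Im s\<bar>) powr (-2)"
      if s: "Re s = -3 \<or> Re s = 2 \<or> -3 \<le> Re s \<and> Re s \<le> 2 \<and> 1 < \<bar>Im s\<bar>" for s
    proof -
      have "norm (perron_kernel y s) \<le> 9 * y powr (Re s + 1) * (1 + \<bar>Im s\<bar>) powr (-2)"
        using y s by (intro norm_perron_kernel) auto
      also have "\<dots> \<le> 9 * y powr 3 * (1 + \<bar>Im s\<bar>) powr (-2)"
        using y s by (intro mult_right_mono mult_left_mono powr_mono) auto
      finally show ?thesis .
    qed
    fix T :: real assume T: "T > 1"
    define \<gamma> where "\<gamma> = rectpath (Complex (-3) (-T)) (Complex 2 T)"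
    have im: "path_image \<gamma> = cbox (Complex (-3) (-T)) (Complex 2 T) - box (Complex (-3) (-T)) (Complex 2 T)"
      unfolding \<gamma>_def using T by (intro path_image_rectpath_cbox_minus_box) auto
    have in_box: "0 \<in> box (Complex (-3) (-T)) (Complex 2 T)" "-1 \<in> box (Complex (-3) (-T)) (Complex 2 T)"
      using T by (auto simp: in_box_complex_iff)
    define g where "g = (\<lambda>s. complex_of_real y powr (s + 1))"
    have g: "g holomorphic_on UNIV" unfolding g_def using y
      by (intro holomorphic_intros) (auto simp: complex_nonpos_Reals_iff)
    have cif: "((\<lambda>w. g w / (w - z)) has_contour_integral (2 * of_real pi * \<i> * g z)) \<gamma>"
      if z: "z \<in> box (Complex (-3) (-T)) (Complex 2 T)" for z
    proof -
      have "((\<lambda>w. g w / (w - z)) has_contour_integral (of_real (2 * pi) * \<i> * winding_number \<gamma> z * g z)) \<gamma>"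
        by (rule Cauchy_integral_formula_convex_simple[where S = UNIV, OF _ g]) (use z im in \<open>auto simp: \<gamma>_def\<close>)
      moreover have "winding_number \<gamma> z = 1" unfolding \<gamma>_def by (rule winding_number_rectpath[OF z])
      ultimately show ?thesis by simp
    qed
    have "((\<lambda>w. g w / (w - 0) - g w / (w - (-1))) has_contour_integral (2 * of_real pi * \<i> * g 0 - 2 * of_real pi * \<i> * g (-1))) \<gamma>"
      by (intro has_contour_integral_diff cif in_box)
    hence "(perron_kernel y has_contour_integral (2 * of_real pi * \<i> * g 0 - 2 * of_real pi * \<i> * g (-1))) \<gamma>"
    proof (rule has_contour_integral_eq)
      fix w assume "w \<in> path_image \<gamma>"
      hence "w \<noteq> 0" "w \<noteq> -1" using im in_box by auto
      hence "w \<noteq> 0" "w + 1 \<noteq> 0" by (auto simp: add_eq_0_iff2)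
      thus "g w / (w - 0) - g w / (w - (-1)) = perron_kernel y w"
        unfolding perron_kernel_def g_def by (simp add: field_simps)
    qed
    moreover have "g 0 = of_real y" "g (-1) = 1" using y by (auto simp: g_def)
    ultimately show "contour_integral \<gamma> (perron_kernel y) = 2 * of_real pi * \<i> * of_real (y - 1)"
      by (subst contour_integral_unique) (auto simp: algebra_simps)
  qed auto
  moreover have "integral\<^sup>L lborel (\<lambda>t. perron_kernel y (Complex (-3) t)) = 0"
  proof -
    \<comment> \<open>The reflection of s to -1 - s maps Re s = -3 to Re s = 2, preserves the
      denominator and replaces y by 1/y < 1, so \<open>perron_kernel_integral_lt_1\<close>
      applies.\<close>
    have e: "perron_kernel y (Complex (-3) t) = of_real y * perron_kernel (1 / y) (Complex 2 (0 + (-1) * t))" for t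
    proof -
      define s where "s = Complex (-3) t"
      have c: "Complex 2 (0 + (-1) * t) = -1 - s" by (simp add: s_def complex_eq_iff)
      have "complex_of_real (1 / y) powr (- s) = exp (s * of_real (ln y))"
        using y by (subst of_real_powr_exp) (auto simp: ln_div)
      moreover have "complex_of_real y powr (s + 1) = of_real y * exp (s * of_real (ln y))"
        using y by (subst of_real_powr_exp) (auto simp: ring_distribs exp_add exp_of_real)
      moreover have "- s * (-1 - s) = s * (s + 1)" by (simp add: algebra_simps)
      ultimately show ?thesis unfolding c s_def[symmetric] perron_kernel_def by (simp add: mult.commute)
    qed
    have "integral\<^sup>L lborel (\<lambda>t. perron_kernel (1 / y) (Complex 2 t)) = 0"
      using y by (intro perron_kernel_integral_lt_1) auto
    hence "integral\<^sup>L lborel (\<lambda>t. perron_kernel (1 / y) (Complex 2 (0 + (-1) * t))) = 0"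
      using lborel_integral_real_affine[of "-1" "\<lambda>t. perron_kernel (1 / y) (Complex 2 t)" 0] by simp
    thus ?thesis unfolding e by simp
  qed
  ultimately have "\<i> * integral\<^sup>L lborel (\<lambda>t. perron_kernel y (Complex 2 t)) = \<i> * of_real (2 * pi * (y - 1))"
    by simp
  thus ?thesis by (simp only: mult_cancel_left complex_i_not_zero simp_thms)
qed

lemma perron_kernel_integral:
  assumes "y > 0" "y \<noteq> 1"
  shows "integral\<^sup>L lborel (\<lambda>t. perron_kernel y (Complex 2 t)) = of_real (2 * pi * max (y - 1) 0)"
  using perron_kernel_integral_lt_1[of y] perron_kernel_integral_gt_1[of y] assms by (cases "y < 1") (auto simp: max_def)

text \<open>Termwise integration: the factor m carried by each term converts
  \<open>max (x / m - 1) 0\<close> into \<open>max (x - m) 0\<close>. As the ramp was evaluated only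
  for y \<noteq> 1, \<open>x\<close> must avoid the integers; terms beyond \<open>L\<close> vanish
  because x < L + 1.\<close>

lemma perron_formula_moebius:
  assumes x: "x > 0" "\<And>n::nat. x \<noteq> real n" and L: "x < real L + 1"
  shows "integral\<^sup>L lborel (\<lambda>t. perron_kernel x (Complex 2 t) * moebius_dirichlet (Complex 2 t)) =
    of_real (2 * pi * (\<Sum>m=1..L. of_int (moebius_mu m) * max (x - real m) 0))"
proof -
  define f where "f = (\<lambda>m t. (of_int (moebius_mu (Suc m)) * of_nat (Suc m)) * perron_kernel (x / real (Suc m)) (Complex 2 t))"
  have f: "f m t = perron_kernel x (Complex 2 t) * (of_int (moebius_mu (Suc m)) * of_nat (Suc m) powr (- Complex 2 t))" for m t
  proof -
    define s where "s = Complex 2 t"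
    have "complex_of_real (x / real (Suc m)) powr (s + 1) * of_nat (Suc m) = complex_of_real x powr (s + 1) * of_nat (Suc m) powr (- s)"
    proof -
      have "of_nat (Suc m) powr (- s) = exp (- s * of_real (ln (real (Suc m))))"
        using of_real_powr_exp[of "real (Suc m)" "- s"] by simp
      moreover have "complex_of_nat (Suc m) = exp (of_real (ln (real (Suc m))))" by (simp add: exp_of_real)
      ultimately show ?thesis
        using x by (subst (1 2) of_real_powr_exp) (simp_all add: ln_div exp_add[symmetric] algebra_simps del: of_nat_Suc)
    qed
    thus ?thesis unfolding f_def perron_kernel_def s_def[symmetric]
      by (simp add: field_simps del: of_nat_Suc)
  qed
  have int: "integrable lborel (f m)" for m
    unfolding f_def using x by (intro integrable_mult_right integrable_perron_kernel) auto
  have nf: "norm (f m t) \<le> 9 * x powr 3 * (1 + \<bar>t\<bar>) powr (-2) * real (Suc m) powr (-2)" for m t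
  proof -
    have "norm (of_int (moebius_mu (Suc m)) * of_nat (Suc m) powr (- Complex 2 t)) \<le> norm (of_nat (Suc m) powr (- Complex 2 t))"
      by (rule norm_moebius_term_le)
    also have "\<dots> = real (Suc m) powr (-2)" using norm_of_real_powr[of "real (Suc m)" "- Complex 2 t"] by simp
    finally show ?thesis unfolding f norm_mult[of "perron_kernel x (Complex 2 t)"]
      using norm_perron_kernel[of x "Complex 2 t"] x by (intro mult_mono) auto
  qed
  have sm: "summable (\<lambda>n. real (Suc n) powr (-2))"
    by (subst summable_Suc_iff) (simp add: summable_real_powr_iff)
  have nint: "(\<integral>t. norm (f m t) \<partial>lborel) \<le> (\<integral>t. 9 * x powr 3 * (1 + \<bar>t\<bar>) powr (-2) \<partial>lborel) * real (Suc m) powr (-2)" for m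
  proof -
    have "(\<integral>t. norm (f m t) \<partial>lborel) \<le> (\<integral>t. 9 * x powr 3 * (1 + \<bar>t\<bar>) powr (-2) * real (Suc m) powr (-2) \<partial>lborel)"
      using nf by (intro integral_mono integrable_norm int integrable_mult_left integrable_mult_right integrable_one_plus_abs_powr) auto
    thus ?thesis by simp
  qed
  have "(\<lambda>m. integral\<^sup>L lborel (f m)) sums (\<integral>t. (\<Sum>m. f m t) \<partial>lborel)"
  proof (rule sums_integral[OF int])
    show "AE t in lborel. summable (\<lambda>m. norm (f m t))"
      using nf by (intro AE_I2 summable_comparison_test'[OF summable_mult[OF sm]]) auto
    show "summable (\<lambda>m. \<integral>t. norm (f m t) \<partial>lborel)"
      using nint by (intro summable_comparison_test'[OF summable_mult[OF sm]]) (auto intro: order.trans)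
  qed
  moreover have "(\<Sum>m. f m t) = perron_kernel x (Complex 2 t) * moebius_dirichlet (Complex 2 t)" for t
    unfolding f moebius_dirichlet_def
    by (rule suminf_mult) (rule summable_norm_cancel[OF summable_norm_moebius], simp)
  ultimately have 1: "(\<lambda>m. integral\<^sup>L lborel (f m)) sums integral\<^sup>L lborel (\<lambda>t. perron_kernel x (Complex 2 t) * moebius_dirichlet (Complex 2 t))"
    by simp
  have If: "integral\<^sup>L lborel (f m) = of_real (2 * pi * (of_int (moebius_mu (Suc m)) * max (x - real (Suc m)) 0))" for m
  proof -
    have ne: "x / real (Suc m) \<noteq> 1" using x(2)[of "Suc m"] by (simp add: field_simps)
    have "integral\<^sup>L lborel (f m) = (of_int (moebius_mu (Suc m)) * of_nat (Suc m)) * of_real (2 * pi * max (x / real (Suc m) - 1) 0)"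
      unfolding f_def using perron_kernel_integral[OF _ ne] x by simp
    also have "\<dots> = complex_of_real (2 * pi * (of_int (moebius_mu (Suc m)) * (real (Suc m) * max (x / real (Suc m) - 1) 0)))"
      by (simp del: of_nat_Suc)
    also have "real (Suc m) * max (x / real (Suc m) - 1) 0 = max (x - real (Suc m)) 0"
      by (simp add: max_mult_distrib_left right_diff_distrib del: of_nat_Suc)
    finally show ?thesis .
  qed
  have "(\<lambda>m. integral\<^sup>L lborel (f m)) sums (\<Sum>m<L. integral\<^sup>L lborel (f m))"
    by (rule sums_finite) (use L in \<open>auto simp: If\<close>)
  also have "(\<Sum>m<L. integral\<^sup>L lborel (f m)) = (\<Sum>m=1..L. of_real (2 * pi * (of_int (moebius_mu m) * max (x - real m) 0)))"
    unfolding If by (intro sum.reindex_bij_witness[of _ "\<lambda>m. m - 1" Suc]) auto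
  finally show ?thesis using sums_unique2[OF 1] by (simp add: sum_distrib_left)
qed

lemma norm_powr_diff_le:
  fixes a b :: real
  assumes ab: "0 < a" "a \<le> b" and B: "\<And>u. a \<le> u \<Longrightarrow> u \<le> b \<Longrightarrow> u powr (Re w - 1) \<le> B"
  shows "norm (complex_of_real b powr w - of_real a powr w) \<le> norm w * B * (b - a)"
proof -
  have S: "\<exists>u. a \<le> u \<and> u \<le> b \<and> z = of_real u" if "z \<in> closed_segment (complex_of_real a) (of_real b)" for z
    using that ab by (auto simp: closed_segment_of_real closed_segment_eq_real_ivl)
  have "norm (complex_of_real b powr w - of_real a powr w) \<le> (norm w * B) * norm (complex_of_real b - of_real a)"
  proof (rule field_differentiable_bound[where S = "closed_segment (complex_of_real a) (of_real b)" and f' = "\<lambda>z. w * z powr (w - 1)"])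
    fix z assume z: "z \<in> closed_segment (complex_of_real a) (of_real b)"
    obtain u where u: "a \<le> u" "u \<le> b" "z = of_real u" using S[OF z] by blast
    have "z \<notin> \<real>\<^sub>\<le>\<^sub>0" using u ab by (auto simp: complex_nonpos_Reals_iff)
    thus "((\<lambda>z. z powr w) has_field_derivative w * z powr (w - 1)) (at z within closed_segment (complex_of_real a) (of_real b))"
      by (auto intro!: derivative_eq_intros)
    show "norm (w * z powr (w - 1)) \<le> norm w * B"
      using u ab B[of u] by (simp add: norm_mult norm_of_real_powr mult_left_mono)
  qed auto
  also have "norm (complex_of_real b - of_real a) = b - a"
    using ab by (simp flip: of_real_diff)
  finally show ?thesis .
qed

text \<open>Two estimates are interpolated: the mean value bound \<open>A\<close> is of order h/u,
  which just fails to be integrable, and the trivial bound decays like 1/u^2 but costs another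
  factor x. A share \<open>\<theta>\<close> of the second makes the decay integrable at the price
  \<open>x powr \<theta>\<close>. The condition h \<ge> 1 lets both be expressed through
  \<open>A\<close>.\<close>

lemma perron_kernel_diff_bound:
  assumes s: "Re s \<ge> 1/2" and x: "x \<ge> 1" and h: "1 \<le> h" "h \<le> x" and \<theta>: "0 \<le> \<theta>" "\<theta> \<le> 1"
  shows "norm (perron_kernel (x + h) s - perron_kernel x s) \<le> 18 * h * (2 * x) powr (Re s + \<theta>) * (1 + \<bar>Im s\<bar>) powr (-1 - \<theta>)"
proof -
  define u where "u = 1 + \<bar>Im s\<bar>"
  define \<sigma> where "\<sigma> = Re s"
  define D where "D = norm (perron_kernel (x + h) s - perron_kernel x s)"
  define A where "A = 18 * h * (2 * x) powr \<sigma> / u"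
  define r where "r = 2 * x / u"
  have u: "u \<ge> 1" by (simp add: u_def)
  have A: "A \<ge> 0" using h u x by (simp add: A_def)
  have r: "r > 0" using x u by (simp add: r_def)
  have s1: "s + 1 \<noteq> 0" "s \<noteq> 0" using s by (auto simp: complex_eq_iff)
  have us: "u / 3 \<le> norm s" using norm_ge_one_plus_Im[of s] s by (simp add: u_def)
  have D1: "D \<le> A"
  proof -
    have "norm (complex_of_real (x + h) powr (s + 1) - of_real x powr (s + 1)) \<le> norm (s + 1) * (2 * x) powr \<sigma> * (x + h - x)"
      using x h s by (intro norm_powr_diff_le) (auto simp: \<sigma>_def intro!: powr_mono2)
    hence "norm (complex_of_real (x + h) powr (s + 1) - of_real x powr (s + 1)) / (norm s * norm (s + 1)) \<le> norm (s + 1) * (2 * x) powr \<sigma> * h / (norm s * norm (s + 1))"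
      by (intro divide_right_mono) auto
    also have "\<dots> = (2 * x) powr \<sigma> * h / norm s" using s1 by simp
    also have "\<dots> \<le> (2 * x) powr \<sigma> * h / (u / 3)" using us u h s1 by (intro divide_left_mono mult_nonneg_nonneg mult_pos_pos) auto
    also have "\<dots> \<le> A" using u h x by (simp add: A_def field_simps)
    finally show ?thesis by (simp add: D_def perron_kernel_def diff_divide_distrib[symmetric] norm_divide norm_mult)
  qed
  have D2: "D \<le> A * r"
  proof -
    have k: "norm (perron_kernel y s) \<le> 9 * (2 * x) powr (\<sigma> + 1) * u powr (-2)" if y: "0 < y" "y \<le> 2 * x" for y
    proof -
      have "norm (perron_kernel y s) \<le> 9 * y powr (Re s + 1) * (1 + \<bar>Im s\<bar>) powr (-2)"
        using y s by (intro norm_perron_kernel) auto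
      also have "\<dots> \<le> 9 * (2 * x) powr (\<sigma> + 1) * u powr (-2)"
        unfolding \<sigma>_def u_def using y s by (intro mult_right_mono mult_left_mono powr_mono2) auto
      finally show ?thesis .
    qed
    have "D \<le> norm (perron_kernel (x + h) s) + norm (perron_kernel x s)" unfolding D_def by (rule norm_triangle_ineq4)
    also have "\<dots> \<le> 18 * (2 * x) powr (\<sigma> + 1) * u powr (-2)" using k[of x] k[of "x + h"] x h by simp
    also have "\<dots> = 1 * (18 * (2 * x) powr \<sigma> / u * r)"
      using x u by (simp add: powr_add r_def powr_minus powr_numeral power2_eq_square field_simps)
    also have "\<dots> \<le> h * (18 * (2 * x) powr \<sigma> / u * r)" using h r u by (intro mult_right_mono) auto
    finally show ?thesis by (simp add: A_def mult_ac)
  qed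
  \<comment> \<open>For 0 \<le> \<theta> \<le> 1 the minimum of 1 and r is at most
    \<open>r powr \<theta>\<close>.\<close>
  have "D \<le> A * r powr \<theta>"
  proof (cases "r \<ge> 1")
    case True
    hence "r powr \<theta> \<ge> 1" using \<theta> by (intro ge_one_powr_ge_zero) auto
    thus ?thesis using D1 A mult_left_mono[of 1 "r powr \<theta>" A] by simp
  next
    case False
    hence "r powr 1 \<le> r powr \<theta>" using r \<theta> by (intro powr_mono') auto
    thus ?thesis using D2 A r mult_left_mono[of r "r powr \<theta>" A] by simp
  qed
  also have "A * r powr \<theta> = 18 * h * (2 * x) powr (\<sigma> + \<theta>) * u powr (-1 - \<theta>)"
    using x u by (simp add: A_def r_def powr_add powr_diff powr_divide powr_minus field_simps)
  finally show ?thesis by (simp add: D_def \<sigma>_def u_def)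
qed

section \<open>From zero-freeness to the Mertens function\<close>

definition mertens :: "nat \<Rightarrow> int" where
  "mertens N = (\<Sum>n=1..N. moebius_mu n)"

lemma abs_sum_moebius_le: "\<bar>\<Sum>m\<in>A. of_int (moebius_mu m) * w m\<bar> \<le> (\<Sum>m\<in>A. \<bar>w m\<bar> :: real)"
proof -
  have "\<bar>\<Sum>m\<in>A. of_int (moebius_mu m) * w m\<bar> \<le> (\<Sum>m\<in>A. \<bar>of_int (moebius_mu m) * w m\<bar>)" by (rule sum_abs)
  also have "\<dots> \<le> (\<Sum>m\<in>A. \<bar>w m\<bar>)"
  proof (rule sum_mono)
    fix m
    have "real_of_int \<bar>moebius_mu m\<bar> \<le> 1" using abs_moebius_mu_le_1[of m] by linarith
    thus "\<bar>of_int (moebius_mu m) * w m\<bar> \<le> \<bar>w m\<bar>" unfolding abs_mult by (intro mult_left_le_one_le) auto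
  qed
  finally show ?thesis .
qed

text \<open>The difference of the two ramp sums gives weight exactly \<open>h\<close> to each m
  \<le> N and weight between 0 and \<open>h\<close> to the \<open>h\<close> integers in (N, N + h],
  whence the error \<open>h * h\<close>. The shift 1/2 keeps the arguments off the integers, as
  \<open>perron_formula_moebius\<close> requires.\<close>

lemma smoothed_mertens:
  fixes N h :: nat
  defines "x \<equiv> real N + 1/2"
  shows "\<bar>real h * of_int (mertens N) - ((\<Sum>m=1..N+h. of_int (moebius_mu m) * max (x + real h - real m) 0) -
     (\<Sum>m=1..N+h. of_int (moebius_mu m) * max (x - real m) 0))\<bar> \<le> real h * real h"
proof -
  define w where "w = (\<lambda>m. max (x + real h - real m) 0 - max (x - real m) 0)"
  have "(\<Sum>m=1..N+h. of_int (moebius_mu m) * max (x + real h - real m) 0) -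
     (\<Sum>m=1..N+h. of_int (moebius_mu m) * max (x - real m) 0) = (\<Sum>m=1..N+h. of_int (moebius_mu m) * w m)"
    by (simp add: w_def sum_subtractf right_diff_distrib)
  also have "\<dots> = (\<Sum>m=1..N. of_int (moebius_mu m) * w m) + (\<Sum>m=N+1..N+h. of_int (moebius_mu m) * w m)"
    by (rule sum.ub_add_nat) simp
  also have "(\<Sum>m=1..N. of_int (moebius_mu m) * w m) = (\<Sum>m=1..N. of_int (moebius_mu m) * real h)"
    by (intro sum.cong refl) (auto simp: w_def x_def)
  also have "\<dots> = real h * of_int (mertens N)" by (simp add: mertens_def sum_distrib_left mult.commute)
  finally have "\<bar>real h * of_int (mertens N) - ((\<Sum>m=1..N+h. of_int (moebius_mu m) * max (x + real h - real m) 0) -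
     (\<Sum>m=1..N+h. of_int (moebius_mu m) * max (x - real m) 0))\<bar> = \<bar>\<Sum>m=N+1..N+h. of_int (moebius_mu m) * w m\<bar>" by simp
  also have "\<dots> \<le> (\<Sum>m=N+1..N+h. \<bar>w m\<bar>)" by (rule abs_sum_moebius_le)
  also have "\<dots> \<le> of_nat (card {N+1..N+h}) * real h"
    by (rule sum_bounded_above) (auto simp: w_def x_def)
  finally show ?thesis by simp
qed

lemma mertens_bound_of_zero_free:
  assumes zf: zeta_zero_free and \<eta>: "\<eta> > 0"
  obtains C where "C \<ge> 0" "\<And>N. N \<ge> 1 \<Longrightarrow> \<bar>real_of_int (mertens N)\<bar> \<le> C * real N powr (1/2 + \<eta>)"
proof -
  \<comment> \<open>Exponent budget: the line is Re s = 1/2 + \<theta> and the kernel interpolation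
    costs another \<theta>, so the power of x is 1/2 + 2 \<theta>, at most 1/2 + \<eta>. The growth
    \<theta>/2 of 1/zeta leaves the integrable decay -1 - \<theta>/2.\<close>
  define \<theta> where "\<theta> = min (1/2) (\<eta> / 2)"
  have \<theta>: "0 < \<theta>" "\<theta> \<le> 1/2" "2 * \<theta> \<le> \<eta>" using \<eta> by (auto simp: \<theta>_def)
  obtain C where C: "C > 0" "\<And>s. 1/2 + \<theta> \<le> Re s \<Longrightarrow> Re s \<le> 3 \<Longrightarrow> norm (inv_zeta s) \<le> C * (1 + \<bar>Im s\<bar>) powr (\<theta> / 2)"
    using inv_zeta_bound[OF zf \<theta>(1,2), of "\<theta> / 2"] \<theta> by auto
  define \<sigma> where "\<sigma> = 1/2 + \<theta>"
  have \<sigma>: "1/2 < \<sigma>" "\<sigma> \<le> 1" using \<theta> by (auto simp: \<sigma>_def)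
  define I where "I = integral\<^sup>L lborel (\<lambda>t::real. (1 + \<bar>t\<bar>) powr (-(1 + \<theta> / 2)))"
  have I: "I \<ge> 0" unfolding I_def by (rule integral_nonneg_AE) auto
  define E where "E = \<sigma> + \<theta>"
  have main: "\<bar>real_of_int (mertens N)\<bar> \<le> (1 + 18 * C * I * 3 powr E) * real N powr (1/2 + \<eta>)" if N: "N \<ge> 1" for N
  proof -
    define x where "x = real N + 1/2"
    \<comment> \<open>After division by \<open>h\<close> the smoothing error is \<open>h\<close>
      itself, which is below the target.\<close>
    define h where "h = nat \<lfloor>sqrt (real N)\<rfloor>"
    have sq: "sqrt (real N) \<ge> 1" using N by simp
    have h: "1 \<le> real h" "real h \<le> sqrt (real N)"
      using sq by (auto simp: h_def le_nat_iff le_floor_iff)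
    have "sqrt (real N) \<le> real N" using N by (simp add: real_le_lsqrt self_le_power power2_eq_square)
    hence hx: "real h \<le> x" "1 \<le> x" using h N by (auto simp: x_def)
    define f where "f = (\<lambda>s. (perron_kernel (x + real h) s - perron_kernel x s) * inv_zeta s)"
    have nat_ne: "real N + 1/2 + real k \<noteq> real n" for k n
    proof
      assume "real N + 1/2 + real k = real n"
      hence "real (2 * N + 1 + 2 * k) = real (2 * n)" by simp
      hence "2 * N + 1 + 2 * k = 2 * n" by (simp only: of_nat_eq_iff)
      thus False by presburger
    qed
    have line_int: "integrable lborel (\<lambda>t. perron_kernel y (Complex 2 t) * inv_zeta (Complex 2 t))" if y: "y > 0" for y
    proof (rule integrable_vertical_line[of "3/2" _ "9 * y powr 3 * C"])
      have "continuous_on {s. Re s = 2} (\<lambda>s. perron_kernel y s * inv_zeta s)"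
        using y by (intro continuous_on_mult holomorphic_on_imp_continuous_on perron_kernel_holo holomorphic_on_subset[OF inv_zeta_holo[OF zf]]) auto
      moreover have "continuous_on UNIV (\<lambda>t. Complex 2 t)" unfolding Complex_eq by (intro continuous_intros)
      ultimately show "continuous_on UNIV (\<lambda>t. perron_kernel y (Complex 2 t) * inv_zeta (Complex 2 t))"
        by (rule continuous_on_compose2) auto
      show "norm (perron_kernel y (Complex 2 t) * inv_zeta (Complex 2 t)) \<le> 9 * y powr 3 * C * (1 + \<bar>t\<bar>) powr (-(3/2))" for t
      proof -
        have "norm (perron_kernel y (Complex 2 t) * inv_zeta (Complex 2 t)) \<le> (9 * y powr 3 * (1 + \<bar>t\<bar>) powr (-2)) * (C * (1 + \<bar>t\<bar>) powr (\<theta> / 2))"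
          unfolding norm_mult using norm_perron_kernel[of y "Complex 2 t"] C(2)[of "Complex 2 t"] y \<theta> by (intro mult_mono) auto
        also have "\<dots> = 9 * y powr 3 * C * (1 + \<bar>t\<bar>) powr (-2 + \<theta> / 2)" by (simp add: powr_add[symmetric] mult_ac)
        also have "\<dots> \<le> 9 * y powr 3 * C * (1 + \<bar>t\<bar>) powr (-(3/2))"
          using \<theta> C y by (intro mult_left_mono powr_mono) auto
        finally show ?thesis .
      qed
    qed auto
    define S where "S = (\<lambda>y. \<Sum>m=1..N+h. of_int (moebius_mu m) * max (y - real m) 0)"
    have per: "integral\<^sup>L lborel (\<lambda>t. perron_kernel (x + real k) (Complex 2 t) * inv_zeta (Complex 2 t)) = of_real (2 * pi * S (x + real k))"
      if k: "k \<le> h" for k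
    proof -
      have "integral\<^sup>L lborel (\<lambda>t. perron_kernel (x + real k) (Complex 2 t) * moebius_dirichlet (Complex 2 t)) = of_real (2 * pi * S (x + real k))"
        unfolding S_def by (rule perron_formula_moebius) (use hx k nat_ne[of k] in \<open>auto simp: x_def\<close>)
      thus ?thesis by (simp add: inv_zeta_moebius)
    qed
    have "integral\<^sup>L lborel (\<lambda>t. f (Complex 2 t)) = of_real (2 * pi * S (x + real h)) - of_real (2 * pi * S x)"
    proof -
      have "integral\<^sup>L lborel (\<lambda>t. f (Complex 2 t)) = integral\<^sup>L lborel (\<lambda>t. perron_kernel (x + real h) (Complex 2 t) * inv_zeta (Complex 2 t) - perron_kernel x (Complex 2 t) * inv_zeta (Complex 2 t))"
        by (simp add: f_def left_diff_distrib)
      also have "\<dots> = integral\<^sup>L lborel (\<lambda>t. perron_kernel (x + real h) (Complex 2 t) * inv_zeta (Complex 2 t)) - integral\<^sup>L lborel (\<lambda>t. perron_kernel x (Complex 2 t) * inv_zeta (Complex 2 t))"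
        using hx by (intro Bochner_Integration.integral_diff line_int) auto
      finally show ?thesis using per[of h] per[of 0] by simp
    qed
    \<comment> \<open>To justify the shift only decay in Im s matters, so a crude constant depending
      on \<open>x\<close> suffices; the sharp kernel bound is applied on the line Re s =
      \<sigma>.\<close>
    moreover have "integral\<^sup>L lborel (\<lambda>t. f (Complex 2 t)) = integral\<^sup>L lborel (\<lambda>t. f (Complex \<sigma> t))"
    proof (rule vertical_line_integral_shift[where p = "3/2" and c = "1/2" and C = "18 * (2 * x) powr 3 * C"])
      show "f holomorphic_on {s. 1/2 < Re s}" unfolding f_def using hx
        by (intro holomorphic_intros inv_zeta_holo[OF zf]) auto
      fix s assume s: "\<sigma> \<le> Re s" "Re s \<le> 2"
      define u where "u = 1 + \<bar>Im s\<bar>"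
      have u: "u \<ge> 1" by (simp add: u_def)
      have k: "norm (perron_kernel y s) \<le> 9 * (2 * x) powr 3 * u powr (-2)" if y: "0 < y" "y \<le> 2 * x" for y
      proof -
        have "norm (perron_kernel y s) \<le> 9 * y powr (Re s + 1) * u powr (-2)"
          unfolding u_def using y s \<sigma> by (intro norm_perron_kernel) auto
        also have "\<dots> \<le> 9 * (2 * x) powr (Re s + 1) * u powr (-2)"
          using y s \<sigma> by (intro mult_right_mono mult_left_mono powr_mono2) auto
        also have "\<dots> \<le> 9 * (2 * x) powr 3 * u powr (-2)"
          using s hx by (intro mult_right_mono mult_left_mono powr_mono) auto
        finally show ?thesis .
      qed
      have "norm (f s) \<le> (18 * (2 * x) powr 3 * u powr (-2)) * (C * u powr (\<theta> / 2))"
        unfolding f_def norm_mult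
      proof (rule mult_mono)
        show "norm (perron_kernel (x + real h) s - perron_kernel x s) \<le> 18 * (2 * x) powr 3 * u powr (-2)"
          using norm_triangle_ineq4[of "perron_kernel (x + real h) s" "perron_kernel x s"] k[of x] k[of "x + real h"] hx by simp
        show "norm (inv_zeta s) \<le> C * u powr (\<theta> / 2)" unfolding u_def using s by (intro C) (auto simp: \<sigma>_def)
      qed auto
      also have "\<dots> = 18 * (2 * x) powr 3 * C * u powr (-2 + \<theta> / 2)" by (simp add: powr_add[symmetric] mult_ac)
      also have "\<dots> \<le> 18 * (2 * x) powr 3 * C * u powr (-(3/2))"
        using \<theta> C u by (intro mult_left_mono powr_mono) auto
      finally show "norm (f s) \<le> 18 * (2 * x) powr 3 * C * (1 + \<bar>Im s\<bar>) powr (-(3/2))" by (simp only: u_def)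
    qed (use \<sigma> in auto)
    moreover have "norm (integral\<^sup>L lborel (\<lambda>t. f (Complex \<sigma> t))) \<le> 18 * real h * (2 * x) powr E * C * I"
    proof -
      have bd: "norm (f (Complex \<sigma> t)) \<le> 18 * real h * (2 * x) powr E * C * (1 + \<bar>t\<bar>) powr (-(1 + \<theta> / 2))" for t
      proof -
        have "norm (f (Complex \<sigma> t)) \<le> (18 * real h * (2 * x) powr E * (1 + \<bar>t\<bar>) powr (-1 - \<theta>)) * (C * (1 + \<bar>t\<bar>) powr (\<theta> / 2))"
          unfolding f_def norm_mult
          using perron_kernel_diff_bound[of "Complex \<sigma> t" x "real h" \<theta>] C(2)[of "Complex \<sigma> t"] \<sigma> hx h \<theta>
          by (intro mult_mono) (auto simp: E_def \<sigma>_def)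
        also have "\<dots> = 18 * real h * (2 * x) powr E * C * (1 + \<bar>t\<bar>) powr (-(1 + \<theta> / 2))"
        proof -
          have e: "-(1 + \<theta> / 2) = (-1 - \<theta>) + \<theta> / 2" by simp
          show ?thesis unfolding e powr_add by (simp only: mult_ac)
        qed
        finally show ?thesis .
      qed
      have int_bd: "integrable lborel (\<lambda>t::real. 18 * real h * (2 * x) powr E * C * (1 + \<bar>t\<bar>) powr (-(1 + \<theta> / 2)))"
        using \<theta> by (intro integrable_mult_right integrable_one_plus_abs_powr) auto
      have cont: "continuous_on UNIV (\<lambda>t. f (Complex \<sigma> t))"
      proof (rule continuous_on_compose2[where g = f and s = UNIV and t = "{s. Re s = \<sigma>}"])
        show "continuous_on {s. Re s = \<sigma>} f" unfolding f_def using hx \<sigma>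
          by (intro continuous_intros holomorphic_on_imp_continuous_on perron_kernel_holo holomorphic_on_subset[OF inv_zeta_holo[OF zf]]) auto
        show "continuous_on UNIV (\<lambda>t. Complex \<sigma> t)" unfolding Complex_eq by (intro continuous_intros)
      qed auto
      have "norm (integral\<^sup>L lborel (\<lambda>t. f (Complex \<sigma> t))) \<le> integral\<^sup>L lborel (\<lambda>t::real. 18 * real h * (2 * x) powr E * C * (1 + \<bar>t\<bar>) powr (-(1 + \<theta> / 2)))"
        using \<theta> by (intro Bochner_Integration.integral_norm_bound_integral int_bd bd integrable_vertical_line[OF _ cont bd]) auto
      thus ?thesis by (simp add: I_def)
    qed
    ultimately have "norm (complex_of_real (2 * pi * (S (x + real h) - S x))) \<le> 18 * real h * (2 * x) powr E * C * I"
      by (simp add: right_diff_distrib)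
    hence "2 * pi * \<bar>S (x + real h) - S x\<bar> \<le> real h * (18 * (2 * x) powr E * C * I)"
      by (simp only: norm_of_real abs_mult) (simp add: mult_ac)
    moreover have "1 * \<bar>S (x + real h) - S x\<bar> \<le> 2 * pi * \<bar>S (x + real h) - S x\<bar>"
      using pi_gt3 by (intro mult_right_mono) auto
    ultimately have "1 * \<bar>S (x + real h) - S x\<bar> \<le> real h * (18 * (2 * x) powr E * C * I)"
      by (rule order.trans[rotated])
    hence "\<bar>S (x + real h) - S x\<bar> \<le> real h * (18 * (2 * x) powr E * C * I)" by (simp only: mult_1)
    moreover have "\<bar>real h * of_int (mertens N) - (S (x + real h) - S x)\<bar> \<le> real h * real h"
      using smoothed_mertens[of h N] by (simp add: S_def x_def)
    ultimately have "\<bar>real h * of_int (mertens N)\<bar> \<le> real h * (real h + 18 * (2 * x) powr E * C * I)"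
      by (simp add: distrib_left abs_le_iff)
    hence "real h * \<bar>real_of_int (mertens N)\<bar> \<le> real h * (real h + 18 * (2 * x) powr E * C * I)" by (simp add: abs_mult)
    hence "\<bar>real_of_int (mertens N)\<bar> \<le> real h + 18 * (2 * x) powr E * C * I" using h by (simp add: mult_le_cancel_left)
    also have "real h \<le> real N powr (1/2 + \<eta>)"
    proof -
      have "sqrt (real N) = real N powr (1/2)" using N by (simp add: powr_half_sqrt)
      also have "\<dots> \<le> real N powr (1/2 + \<eta>)" using N \<eta> by (intro powr_mono) auto
      finally show ?thesis using h by linarith
    qed
    also have "18 * (2 * x) powr E * C * I \<le> 18 * C * I * 3 powr E * real N powr (1/2 + \<eta>)"
    proof -
      have "(2 * x) powr E \<le> (3 * real N) powr E" using N \<theta> \<sigma> by (intro powr_mono2) (auto simp: x_def E_def)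
      also have "\<dots> = 3 powr E * real N powr E" by (simp add: powr_mult)
      also have "\<dots> \<le> 3 powr E * real N powr (1/2 + \<eta>)"
        using N \<theta> by (intro mult_left_mono powr_mono) (auto simp: E_def \<sigma>_def)
      finally have "18 * C * I * (2 * x) powr E \<le> 18 * C * I * (3 powr E * real N powr (1/2 + \<eta>))"
        using C I by (intro mult_left_mono) auto
      thus ?thesis by (simp add: mult_ac)
    qed
    finally show ?thesis by (simp add: algebra_simps)
  qed
  show ?thesis by (rule that[OF _ main]) (use C I in auto)
qed

section \<open>The local means\<close>

lemma Abel_summation:
  fixes a f :: "nat \<Rightarrow> 'a :: comm_ring_1"
  shows "(\<Sum>n=1..N. a n * f n) = (\<Sum>n=1..N. a n) * f (Suc N) - (\<Sum>n=1..N. (\<Sum>k=1..n. a k) * (f (Suc n) - f n))"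
  by (induction N) (simp_all add: algebra_simps)

lemma moebius_Abel_summation:
  fixes f :: "nat \<Rightarrow> complex"
  shows "(\<Sum>n=1..N. of_int (moebius_mu n) * f n) =
    of_int (mertens N) * f (Suc N) - (\<Sum>n=1..N. of_int (mertens n) * (f (Suc n) - f n))"
  using Abel_summation[of "\<lambda>n. of_int (moebius_mu n)" f N] by (simp add: mertens_def)

lemma abs_mertens_le: "\<bar>real_of_int (mertens N)\<bar> \<le> real N"
  using abs_sum_moebius_le[of "\<lambda>_. 1" "{1..N}"] by (simp add: mertens_def)

text \<open>Abel summation turns the bound on partial sums into convergence of the Dirichlet series of
  \<open>\<mu>\<close>, hence of \<open>1 / \<zeta>\<close>, in the half-plane \<open>Re s > 1/2\<close>.\<close>

lemma zero_free_of_mertens_bound: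
  assumes M: "\<And>\<eta>. \<eta> > 0 \<Longrightarrow> \<exists>C. \<forall>N\<ge>1. \<bar>real_of_int (mertens N)\<bar> \<le> C * real N powr (1/2 + \<eta>)"
  shows zeta_zero_free
proof -
  \<comment> \<open>Terms of the Abel-summed Dirichlet series, with n standing for n + 1. Under the
    bound on partial sums they are of order n powr (\<eta> - 1/2 - Re s), hence summable for Re s >
    1/2 + \<eta>.\<close>
  define A where "A = (\<lambda>n s. of_int (mertens (Suc n)) * (of_nat (Suc n) powr (-s) - of_nat (Suc (Suc n)) powr (-s)) :: complex)"
  have A_holo: "A n holomorphic_on S" for n S
    unfolding A_def by (intro holomorphic_intros) (auto simp: complex_nonpos_Reals_iff simp flip: of_nat_Suc)
  have diff: "norm (of_nat (Suc n) powr (-s) - of_nat (Suc (Suc n)) powr (-s) :: complex) \<le> norm s * real (Suc n) powr (- Re s - 1)"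
    if s: "Re s > 0" for n s
  proof -
    have "norm (complex_of_real (real (Suc (Suc n))) powr (-s) - complex_of_real (real (Suc n)) powr (-s)) \<le> norm (-s) * real (Suc n) powr (- Re s - 1) * (real (Suc (Suc n)) - real (Suc n))"
      using s by (intro norm_powr_diff_le) (auto intro!: powr_mono2')
    thus ?thesis by (simp add: norm_minus_commute del: of_nat_Suc) simp
  qed
  have unif: "\<exists>d>0. cball s0 d \<subseteq> {s. Re s > 1/2} \<and>
    uniform_limit (cball s0 d) (\<lambda>N s. \<Sum>n<N. A n s) (\<lambda>s. \<Sum>n. A n s) sequentially" if s0: "Re s0 > 1/2" for s0
  proof -
    define d where "d = (Re s0 - 1/2) / 2"
    have d: "d > 0" using s0 by (simp add: d_def)
    have re: "Re s \<ge> 1/2 + d" if "s \<in> cball s0 d" for s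
    proof -
      have "Re s0 - Re s \<le> d" using that abs_Re_le_cmod[of "s0 - s"] by (auto simp: dist_norm)
      thus ?thesis by (simp add: d_def field_simps)
    qed
    \<comment> \<open>On the disc Re s exceeds 1/2 by at least \<open>d\<close>; spending half of
      this margin leaves the exponent -1 - d/2 for the Weierstrass test.\<close>
    obtain C where C: "\<And>N. N \<ge> 1 \<Longrightarrow> \<bar>real_of_int (mertens N)\<bar> \<le> C * real N powr (1/2 + d/2)"
      using M[of "d/2"] d by auto
    have C0: "C \<ge> 0" using C[of 1] by simp
    define K where "K = norm s0 + d"
    have "uniform_limit (cball s0 d) (\<lambda>N s. \<Sum>n<N. A n s) (\<lambda>s. \<Sum>n. A n s) sequentially"
    proof (rule Weierstrass_m_test)
      fix n s assume s: "s \<in> cball s0 d"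
      have "norm s \<le> K" using s norm_triangle_sub[of s s0] by (simp add: K_def dist_norm norm_minus_commute)
      have "norm (A n s) \<le> (C * real (Suc n) powr (1/2 + d/2)) * (norm s * real (Suc n) powr (- Re s - 1))"
        unfolding A_def norm_mult norm_of_int using re[OF s] d C[of "Suc n"] C0 by (intro mult_mono diff) auto
      also have "\<dots> \<le> (C * real (Suc n) powr (1/2 + d/2)) * (K * real (Suc n) powr (- (1/2 + d) - 1))"
        using C0 \<open>norm s \<le> K\<close> re[OF s] norm_ge_zero[of s] by (intro mult_left_mono mult_mono powr_mono) (auto simp: K_def d less_imp_le)
      also have "\<dots> = C * K * (real (Suc n) powr (1/2 + d/2) * real (Suc n) powr (- (1/2 + d) - 1))" by (simp only: mult_ac)
      also have "real (Suc n) powr (1/2 + d/2) * real (Suc n) powr (- (1/2 + d) - 1) = real (Suc n) powr (-1 - d/2)"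
        unfolding powr_add[symmetric] by (rule arg_cong2[where f = "(powr)"]) (simp_all add: field_simps)
      finally show "norm (A n s) \<le> C * K * real (Suc n) powr (-1 - d/2)" .
    next
      have "summable (\<lambda>n. real (Suc n) powr (-1 - d/2))"
        using d by (subst summable_Suc_iff) (simp add: summable_real_powr_iff)
      thus "summable (\<lambda>n. C * K * real (Suc n) powr (-1 - d/2))" by (rule summable_mult)
    qed
    moreover have "cball s0 d \<subseteq> {s. Re s > 1/2}" using re d by force
    ultimately show ?thesis using d by blast
  qed
  define H where "H = (\<lambda>s. \<Sum>n. A n s)"
  have H: "H holomorphic_on {s. Re s > 1/2}" unfolding H_def
  proof (rule holomorphic_uniform_sequence[where f = "\<lambda>N s. \<Sum>n<N. A n s"])
    show "open {s. Re s > 1/2}" by (rule open_halfspace_Re_gt)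
    show "(\<lambda>s. \<Sum>n<N. A n s) holomorphic_on {s. Re s > 1/2}" for N
      by (intro holomorphic_on_sum A_holo)
  qed (use unif in blast)
  have H_eq: "H s = moebius_dirichlet s" if s: "Re s > 1" for s
  proof -
    obtain d where d: "d > 0" "uniform_limit (cball s d) (\<lambda>N s. \<Sum>n<N. A n s) (\<lambda>s. \<Sum>n. A n s) sequentially"
      using unif[of s] s by auto
    have "(\<lambda>N. \<Sum>n<N. A n s) \<longlonglongrightarrow> H s"
      unfolding H_def using d by (intro tendsto_uniform_limitI[OF d(2)]) auto
    \<comment> \<open>The boundary term of Abel summation: for Re s > 1 the trivial bound |M(N)|
      \<le> N already makes it vanish.\<close>
    moreover have "(\<lambda>N. of_int (mertens N) * of_nat (Suc N) powr (-s)) \<longlonglongrightarrow> (0::complex)"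
    proof (rule Lim_null_comparison)
      show "\<forall>\<^sub>F N in sequentially. norm (of_int (mertens N) * of_nat (Suc N) powr (-s) :: complex) \<le> real (Suc N) powr (1 - Re s)"
      proof (rule always_eventually, rule allI)
        fix N
        have "norm (of_int (mertens N) * of_nat (Suc N) powr (-s) :: complex) \<le> real (Suc N) * real (Suc N) powr (- Re s)"
          unfolding norm_mult norm_of_int using abs_mertens_le[of N] norm_of_real_powr[of "real (Suc N)" "-s"]
          by (intro mult_mono) auto
        thus "norm (of_int (mertens N) * of_nat (Suc N) powr (-s) :: complex) \<le> real (Suc N) powr (1 - Re s)"
          by (simp add: powr_diff powr_minus field_simps del: of_nat_Suc)
      qed
      show "(\<lambda>N. real (Suc N) powr (1 - Re s)) \<longlonglongrightarrow> 0"
        using s by (intro tendsto_neg_powr filterlim_compose[OF filterlim_real_sequentially filterlim_Suc]) auto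
    qed
    ultimately have "(\<lambda>N. of_int (mertens N) * of_nat (Suc N) powr (-s) + (\<Sum>n<N. A n s)) \<longlonglongrightarrow> 0 + H s"
      by (intro tendsto_add)
    moreover have "of_int (mertens N) * of_nat (Suc N) powr (-s) + (\<Sum>n<N. A n s) = (\<Sum>n<N. of_int (moebius_mu (Suc n)) * of_nat (Suc n) powr (-s))" for N
    proof -
      have "(\<Sum>n<N. of_int (moebius_mu (Suc n)) * of_nat (Suc n) powr (-s)) = (\<Sum>n=1..N. of_int (moebius_mu n) * of_nat n powr (-s) :: complex)"
        by (intro sum.reindex_bij_witness[of _ "\<lambda>n. n - 1" Suc]) auto
      also have "\<dots> = of_int (mertens N) * of_nat (Suc N) powr (-s) - (\<Sum>n=1..N. of_int (mertens n) * (of_nat (Suc n) powr (-s) - of_nat n powr (-s)))"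
        by (rule moebius_Abel_summation)
      also have "(\<Sum>n=1..N. of_int (mertens n) * (of_nat (Suc n) powr (-s) - of_nat n powr (-s))) = (\<Sum>n<N. - A n s)"
        by (intro sum.reindex_bij_witness[of _ Suc "\<lambda>n. n - 1"]) (auto simp: A_def right_diff_distrib simp del: of_nat_Suc)
      finally show ?thesis by (simp add: sum_negf)
    qed
    ultimately have "(\<lambda>n. of_int (moebius_mu (Suc n)) * of_nat (Suc n) powr (-s)) sums H s" by (simp add: sums_def)
    thus ?thesis by (simp add: moebius_dirichlet_def sums_iff)
  qed
  \<comment> \<open>With \<open>zeta_entire_part\<close> in place of zeta the half-plane needs no
    puncture at 1. The right side vanishes only at 1, so the left factor has no zero
    elsewhere.\<close>
  have eq: "zeta_entire_part s * H s = s - 1" if s: "Re s > 1/2" for s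
  proof (rule analytic_continuation_open[of "{s. Re s > 1}" "{s. Re s > 1/2}" "\<lambda>s. zeta_entire_part s * H s" "\<lambda>s. s - 1"])
    show "{s. Re s > 1} \<noteq> {}" by (auto intro: exI[of _ 2])
    show "open {s. Re s > 1/2}" by (rule open_halfspace_Re_gt)
    show "connected {s. Re s > 1/2}" by (intro convex_connected convex_halfspace_Re_gt)
    show "(\<lambda>s. zeta_entire_part s * H s) holomorphic_on {s. Re s > 1/2}"
      by (intro holomorphic_on_mult H holomorphic_on_subset[OF zeta_entire_part_holo]) auto
    show "zeta_entire_part s * H s = s - 1" if "s \<in> {s. Re s > 1}" for s
      using that H_eq[of s] moebius_dirichlet_times_zeta[of s] by (auto simp: zeta_entire_part_eq mult.commute mult.left_commute)
  qed (use s in \<open>auto intro!: open_halfspace_Re_gt holomorphic_intros\<close>)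
  show ?thesis unfolding zeta_zero_free_def
  proof (intro allI impI notI)
    fix s assume s: "Re s > 1/2" "s \<noteq> 1" "riemann_zeta s = 0"
    hence "zeta_entire_part s = 0" by (simp add: zeta_entire_part_eq)
    thus False using eq[OF s(1)] s(2) by simp
  qed
qed

section \<open>The polynomial near 0 and its local means\<close>

lemma norm_exp_imag_diff_le:
  fixes a b :: real
  shows "norm (exp (\<i> * of_real a) - exp (\<i> * of_real b)) \<le> \<bar>a - b\<bar>"
proof -
  have "norm (exp (\<i> * of_real a) - exp (\<i> * of_real b)) = norm (exp (\<i> * of_real b) * (exp (\<i> * of_real (a - b)) - 1))"
    by (simp add: right_diff_distrib exp_add[symmetric])
  also have "\<dots> = norm (exp (\<i> * of_real (a - b)) - 1)" by (simp add: norm_mult)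
  also have "\<dots> = \<bar>2 * sin ((a - b) / 2)\<bar>"
    using dist_exp_i_1[of "a - b"] by (simp add: abs_mult)
  also have "\<dots> \<le> \<bar>a - b\<bar>" using abs_sin_x_le_abs_x[of "(a - b) / 2"] by (simp add: abs_mult)
  finally show ?thesis .
qed

lemma mu_poly_eq:
  "mu_poly N t = 1 / complex_of_real (sqrt (real N)) * (\<Sum>n=1..N. of_int (moebius_mu n) * exp (\<i> * of_real (2 * pi * real n * t)))"
  by (simp add: mu_poly_def mult_ac)

lemma norm_mu_poly_0: "norm (mu_poly N 0) = \<bar>real_of_int (mertens N)\<bar> / sqrt (real N)"
proof -
  have "mu_poly N 0 = of_int (mertens N) / of_real (sqrt (real N))"
    by (simp add: mu_poly_def mertens_def)
  thus ?thesis by (simp add: norm_divide)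
qed

lemma mu_poly_continuous: "continuous_on A (mu_poly N)"
  unfolding mu_poly_def by (intro continuous_intros)

text \<open>Each of the N terms moves by at most 2 pi N |t|, and the normalization divides by sqrt
  N; this is the origin of the exponent 3/2.\<close>

lemma norm_mu_poly_diff_0:
  assumes N: "N \<ge> 1"
  shows "norm (mu_poly N t - mu_poly N 0) \<le> 2 * pi * real N powr (3/2) * \<bar>t\<bar>"
proof -
  have "mu_poly N t - mu_poly N 0 = 1 / complex_of_real (sqrt (real N)) *
     (\<Sum>n=1..N. of_int (moebius_mu n) * (exp (\<i> * of_real (2 * pi * real n * t)) - exp (\<i> * of_real (2 * pi * real n * 0))))"
    unfolding mu_poly_eq by (simp add: right_diff_distrib sum_subtractf)
  also have "norm \<dots> = 1 / sqrt (real N) * norm (\<Sum>n=1..N. of_int (moebius_mu n) * (exp (\<i> * of_real (2 * pi * real n * t)) - exp (\<i> * of_real (2 * pi * real n * 0))))"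
    by (simp add: norm_mult norm_divide)
  also have "\<dots> \<le> 1 / sqrt (real N) * (\<Sum>n=1..N. 2 * pi * real N * \<bar>t\<bar>)"
  proof (intro mult_left_mono sum_norm_le)
    fix n assume n: "n \<in> {1..N}"
    have "norm (of_int (moebius_mu n) * (exp (\<i> * of_real (2 * pi * real n * t)) - exp (\<i> * of_real (2 * pi * real n * 0)))) \<le> \<bar>2 * pi * real n * t - 2 * pi * real n * 0\<bar>"
      by (rule order.trans[OF norm_moebius_term_le norm_exp_imag_diff_le])
    also have "\<dots> \<le> 2 * pi * real N * \<bar>t\<bar>" using n by (simp add: abs_mult mult_right_mono)
    finally show "norm (of_int (moebius_mu n) * (exp (\<i> * of_real (2 * pi * real n * t)) - exp (\<i> * of_real (2 * pi * real n * 0)))) \<le> 2 * pi * real N * \<bar>t\<bar>" .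
  qed simp
  also have "\<dots> = 2 * pi * (real N * real N / sqrt (real N)) * \<bar>t\<bar>" by simp
  also have "real N * real N / sqrt (real N) = real N powr (3/2)"
  proof -
    have "real N powr (3/2) = real N powr 2 / real N powr (1/2)" using powr_diff[of "real N" 2 "1/2"] by simp
    thus ?thesis using N by (simp add: powr_half_sqrt powr_numeral power2_eq_square)
  qed
  finally show ?thesis .
qed

text \<open>Abel summation against exp(2 pi i n t), whose total variation over n \<le> N is at most
  2 pi N |t| \<le> 2 pi c. On the window |t| \<le> c/N the polynomial is therefore controlled by the
  Mertens sums alone.\<close>

lemma norm_mu_poly_le:
  assumes B: "\<And>n. n \<le> N \<Longrightarrow> \<bar>real_of_int (mertens n)\<bar> \<le> B" and t: "real N * \<bar>t\<bar> \<le> c"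
  shows "norm (mu_poly N t) \<le> B * (1 + 2 * pi * c) / sqrt (real N)"
proof -
  have B0: "B \<ge> 0" using B[of 0] by simp
  define f where "f = (\<lambda>n. exp (\<i> * of_real (2 * pi * real n * t)))"
  have f1: "norm (f n) = 1" for n by (simp add: f_def)
  have fd: "norm (f (Suc n) - f n) \<le> 2 * pi * \<bar>t\<bar>" for n
  proof -
    have "norm (f (Suc n) - f n) \<le> \<bar>2 * pi * real (Suc n) * t - 2 * pi * real n * t\<bar>"
      unfolding f_def by (rule norm_exp_imag_diff_le)
    also have "2 * pi * real (Suc n) * t - 2 * pi * real n * t = 2 * pi * t" by (simp add: algebra_simps)
    finally show ?thesis by (simp add: abs_mult)
  qed
  have "norm (\<Sum>n=1..N. of_int (moebius_mu n) * f n) \<le> norm (of_int (mertens N) * f (Suc N)) + norm (\<Sum>n=1..N. of_int (mertens n) * (f (Suc n) - f n))"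
    unfolding moebius_Abel_summation by (rule norm_triangle_ineq4)
  also have "norm (of_int (mertens N) * f (Suc N)) \<le> B" using B[of N] by (simp add: norm_mult f1)
  also have "norm (\<Sum>n=1..N. of_int (mertens n) * (f (Suc n) - f n)) \<le> (\<Sum>n=1..N. B * (2 * pi * \<bar>t\<bar>))"
    using B B0 fd by (intro sum_norm_le) (auto simp: norm_mult intro!: mult_mono)
  also have "\<dots> = B * (2 * pi * (real N * \<bar>t\<bar>))" by simp
  also have "\<dots> \<le> B * (2 * pi * c)" using B0 t by (intro mult_left_mono) auto
  finally have "norm (\<Sum>n=1..N. of_int (moebius_mu n) * f n) \<le> B * (1 + 2 * pi * c)" by (simp add: algebra_simps)
  hence "norm (\<Sum>n=1..N. of_int (moebius_mu n) * f n) / sqrt (real N) \<le> B * (1 + 2 * pi * c) / sqrt (real N)"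
    by (intro divide_right_mono) auto
  thus ?thesis by (simp add: mu_poly_eq f_def norm_mult norm_divide)
qed

lemma mu_poly_powr_integrable:
  assumes "q > 0"
  shows "(\<lambda>t. norm (mu_poly N t) powr q) integrable_on {a..b}"
  by (rule integrable_continuous_interval)
     (rule continuous_on_powr'[OF continuous_on_norm[OF mu_poly_continuous] continuous_on_const], use assms in auto)

lemma local_mean_le:
  assumes c: "c > 0" and q: "q \<ge> 1" and N: "N \<ge> 1" and B: "\<And>t. \<bar>t\<bar> \<le> c / real N \<Longrightarrow> norm (mu_poly N t) \<le> B"
  shows "local_mean q c N \<le> B"
proof -
  have B0: "B \<ge> 0" using order.trans[OF norm_ge_zero B[of 0]] c by simp
  have "integral {- c / real N..c / real N} (\<lambda>t. norm (mu_poly N t) powr q) \<le> integral {- c / real N..c / real N} (\<lambda>t. B powr q)"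
    using q B by (intro integral_le mu_poly_powr_integrable) (auto intro!: powr_mono2)
  also have "\<dots> = (2 * c / real N) * B powr q" using c by simp
  finally have "real N / (2 * c) * integral {- c / real N..c / real N} (\<lambda>t. norm (mu_poly N t) powr q) \<le> real N / (2 * c) * ((2 * c / real N) * B powr q)"
    using c by (intro mult_left_mono) auto
  also have "\<dots> = B powr q" using c N by simp
  finally have "local_mean q c N \<le> (B powr q) powr (1 / q)"
    unfolding local_mean_def using c q
    by (intro powr_mono2 mult_nonneg_nonneg integral_nonneg mu_poly_powr_integrable) auto
  also have "\<dots> = B" using q B0 by (simp add: powr_powr)
  finally show ?thesis .
qed

text \<open>If |P_N(0)| \<ge> 1, a change of at most 1/2 preserves half of that value. The t for
  which this is guaranteed fill at least the proportion
  \<open>min 1 (1 / (4 * pi * c)) * real N powr (-1/2)\<close> of the window, and the mean loses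
  only the q-th root of it besides the factor 1/2.\<close>

lemma local_mean_ge:
  assumes c: "c > 0" and q: "q \<ge> 1" and N: "N \<ge> 1" and V: "norm (mu_poly N 0) \<ge> 1"
  shows "(min 1 (1 / (4 * pi * c)) * real N powr (-1/2)) powr (1 / q) * (norm (mu_poly N 0) / 2) \<le> local_mean q c N"
proof -
  define V where "V = norm (mu_poly N 0)"
  define \<kappa> where "\<kappa> = min 1 (1 / (4 * pi * c))"
  \<comment> \<open>At the second entry the Lipschitz bound
    \<open>2 * pi * real N powr (3/2) * \<bar>t\<bar>\<close> reaches 1/2; the first keeps [-d, d]
    inside the window when c is small.\<close>
  define d where "d = min (c / real N) (1 / (4 * pi * real N powr (3/2)))"
  have V1: "V \<ge> 1" using V by (simp add: V_def)
  have \<kappa>: "\<kappa> > 0" using c by (simp add: \<kappa>_def)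
  have d: "d > 0" "d \<le> c / real N" using c N by (auto simp: d_def)
  have low: "V / 2 \<le> norm (mu_poly N t)" if t: "\<bar>t\<bar> \<le> d" for t
  proof -
    have "norm (mu_poly N t - mu_poly N 0) \<le> 2 * pi * real N powr (3/2) * \<bar>t\<bar>" by (rule norm_mu_poly_diff_0[OF N])
    also have "\<dots> \<le> 2 * pi * real N powr (3/2) * (1 / (4 * pi * real N powr (3/2)))"
      using t by (intro mult_left_mono) (auto simp: d_def)
    also have "\<dots> = 1/2" using N by simp
    finally have "norm (mu_poly N 0) - norm (mu_poly N t) \<le> 1/2"
      using norm_triangle_ineq2[of "mu_poly N 0" "mu_poly N t"] by (simp add: norm_minus_commute)
    thus ?thesis using V1 by (simp add: V_def)
  qed
  have "2 * d * (V / 2) powr q = integral {-d..d} (\<lambda>t. (V / 2) powr q)" using d by simp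
  also have "\<dots> \<le> integral {-d..d} (\<lambda>t. norm (mu_poly N t) powr q)"
    using q low V1 by (intro integral_le mu_poly_powr_integrable) (auto intro!: powr_mono2)
  also have "\<dots> \<le> integral {- c / real N..c / real N} (\<lambda>t. norm (mu_poly N t) powr q)"
    using d q by (intro integral_subset_le mu_poly_powr_integrable) auto
  finally have 1: "real N / (2 * c) * (2 * d * (V / 2) powr q) \<le> real N / (2 * c) * integral {- c / real N..c / real N} (\<lambda>t. norm (mu_poly N t) powr q)"
    using c by (intro mult_left_mono) auto
  have 2: "\<kappa> * real N powr (-1/2) \<le> real N / (2 * c) * (2 * d)"
  proof -
    have "real N / (2 * c) * (2 * d) = min 1 (real N / c * (1 / (4 * pi * real N powr (3/2))))"
      using c N unfolding d_def by (simp add: min_mult_distrib_left)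
    also have "real N / c * (1 / (4 * pi * real N powr (3/2))) = 1 / (4 * pi * c) * real N powr (-1/2)"
    proof -
      have "real N powr (3/2) = real N * real N powr (1/2)" using N powr_add[of "real N" 1 "1/2"] by simp
      thus ?thesis using N c by (simp add: powr_minus field_simps)
    qed
    finally have e: "real N / (2 * c) * (2 * d) = min 1 (1 / (4 * pi * c) * real N powr (-1/2))" .
    have p: "real N powr (-1/2) \<le> 1" using N powr_mono[of "-1/2" 0 "real N"] by simp
    have "\<kappa> * real N powr (-1/2) \<le> 1 * 1" using \<kappa> p by (intro mult_mono) (auto simp: \<kappa>_def)
    moreover have "\<kappa> * real N powr (-1/2) \<le> 1 / (4 * pi * c) * real N powr (-1/2)" by (intro mult_right_mono) (auto simp: \<kappa>_def)
    ultimately show ?thesis unfolding e by simp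
  qed
  have "(\<kappa> * real N powr (-1/2)) * (V / 2) powr q \<le> real N / (2 * c) * (2 * d) * (V / 2) powr q"
    by (rule mult_right_mono[OF 2]) simp
  also have "\<dots> \<le> real N / (2 * c) * integral {- c / real N..c / real N} (\<lambda>t. norm (mu_poly N t) powr q)"
    using 1 by (simp only: mult.assoc)
  finally have "((\<kappa> * real N powr (-1/2)) * (V / 2) powr q) powr (1 / q) \<le> local_mean q c N"
    unfolding local_mean_def using q \<kappa> by (intro powr_mono2) auto
  also have "((\<kappa> * real N powr (-1/2)) * (V / 2) powr q) powr (1 / q) = (\<kappa> * real N powr (-1/2)) powr (1 / q) * (V / 2)"
    using q \<kappa> V1 by (simp add: powr_mult powr_powr)
  finally show ?thesis by (simp add: \<kappa>_def V_def)
qed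

lemma local_mean_nonneg: "local_mean q c N \<ge> 0"
  by (simp add: local_mean_def)

lemma local_mean_bound_of_zero_free:
  assumes zf: zeta_zero_free and c: "c > 0" and q: "q \<ge> 1" and \<eta>: "\<eta> > 0"
  shows "\<exists>C. \<forall>N\<ge>1. \<bar>local_mean q c N\<bar> \<le> C * real N powr \<eta>"
proof -
  obtain C where C: "C \<ge> 0" "\<And>N. N \<ge> 1 \<Longrightarrow> \<bar>real_of_int (mertens N)\<bar> \<le> C * real N powr (1/2 + \<eta>)"
    using mertens_bound_of_zero_free[OF zf \<eta>] by blast
  have "\<bar>local_mean q c N\<bar> \<le> C * (1 + 2 * pi * c) * real N powr \<eta>" if N: "N \<ge> 1" for N
  proof -
    have B: "\<bar>real_of_int (mertens n)\<bar> \<le> C * real N powr (1/2 + \<eta>)" if "n \<le> N" for n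
    proof (cases "n = 0")
      case True
      thus ?thesis using C(1) by (simp add: mertens_def)
    next
      case False
      hence "\<bar>real_of_int (mertens n)\<bar> \<le> C * real n powr (1/2 + \<eta>)" by (intro C(2)) auto
      also have "\<dots> \<le> C * real N powr (1/2 + \<eta>)" using that C(1) \<eta> by (intro mult_left_mono powr_mono2) auto
      finally show ?thesis .
    qed
    have "local_mean q c N \<le> C * real N powr (1/2 + \<eta>) * (1 + 2 * pi * c) / sqrt (real N)"
    proof (rule local_mean_le[OF c q N])
      fix t assume "\<bar>t\<bar> \<le> c / real N"
      hence "real N * \<bar>t\<bar> \<le> c" using N by (simp add: field_simps)
      thus "norm (mu_poly N t) \<le> C * real N powr (1/2 + \<eta>) * (1 + 2 * pi * c) / sqrt (real N)"
        by (intro norm_mu_poly_le B) auto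
    qed
    also have "\<dots> = C * (1 + 2 * pi * c) * real N powr \<eta>"
      using N by (simp add: powr_add powr_half_sqrt)
    finally show ?thesis using local_mean_nonneg[of q c N] by simp
  qed
  thus ?thesis by blast
qed

text \<open>For q \<ge> 1/\<eta> the loss N powr (1/(2 q)) is at most N powr (\<eta>/2), which
  together with the hypothesis stays within 2 \<eta>. If |P_N(0)| < 1, then |M(N)| < sqrt N and
  there is nothing to lose.\<close>

lemma mertens_bound_of_local_mean_bound:
  assumes c: "c > 0" and \<eta>: "\<eta> > 0" and q: "q \<ge> 1" "q \<ge> 1 / \<eta>"
    and C: "\<And>N. N \<ge> 1 \<Longrightarrow> \<bar>local_mean q c N\<bar> \<le> C * real N powr \<eta>"
  shows "\<exists>D. \<forall>N\<ge>1. \<bar>real_of_int (mertens N)\<bar> \<le> D * real N powr (1/2 + 2 * \<eta>)"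
proof -
  define \<kappa> where "\<kappa> = min 1 (1 / (4 * pi * c))"
  have \<kappa>: "\<kappa> > 0" using c by (simp add: \<kappa>_def)
  define D where "D = 1 + 2 * \<bar>C\<bar> * \<kappa> powr (- 1 / q)"
  have iq: "1 / q \<le> \<eta>" using q \<eta> by (simp add: field_simps)
  have "\<bar>real_of_int (mertens N)\<bar> \<le> D * real N powr (1/2 + 2 * \<eta>)" if N: "N \<ge> 1" for N
  proof -
    define V where "V = norm (mu_poly N 0)"
    have MV: "\<bar>real_of_int (mertens N)\<bar> = V * real N powr (1/2)"
      using N by (simp add: V_def norm_mu_poly_0 powr_half_sqrt)
    have "V \<le> D * real N powr (2 * \<eta>)"
    proof (cases "V \<ge> 1")
      case False
      have "V \<le> 1 * 1" using False by simp
      also have "\<dots> \<le> D * real N powr (2 * \<eta>)"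
        using N \<eta> by (intro mult_mono ge_one_powr_ge_zero) (auto simp: D_def)
      finally show ?thesis .
    next
      case True
      have "(\<kappa> * real N powr (-1/2)) powr (1 / q) * (V / 2) \<le> local_mean q c N"
        unfolding \<kappa>_def V_def by (rule local_mean_ge[OF c q(1) N]) (use True in \<open>simp add: V_def\<close>)
      also have "\<dots> \<le> \<bar>C\<bar> * real N powr \<eta>"
      proof -
        have "C * real N powr \<eta> \<le> \<bar>C\<bar> * real N powr \<eta>" by (intro mult_right_mono) auto
        thus ?thesis using C[OF N] by linarith
      qed
      finally have "\<kappa> powr (1 / q) * real N powr (-1/2 * (1 / q)) * (V / 2) \<le> \<bar>C\<bar> * real N powr \<eta>"
        using \<kappa> by (simp add: powr_mult powr_powr)
      hence "(2 * \<kappa> powr (- 1 / q) * real N powr (1/2 * (1 / q))) * (\<kappa> powr (1 / q) * real N powr (-1/2 * (1 / q)) * (V / 2))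
         \<le> (2 * \<kappa> powr (- 1 / q) * real N powr (1/2 * (1 / q))) * (\<bar>C\<bar> * real N powr \<eta>)"
        by (rule mult_left_mono) simp
      also have "(2 * \<kappa> powr (- 1 / q) * real N powr (1/2 * (1 / q))) * (\<kappa> powr (1 / q) * real N powr (-1/2 * (1 / q)) * (V / 2)) =
         (\<kappa> powr (- 1 / q) * \<kappa> powr (1 / q)) * (real N powr (1/2 * (1 / q)) * real N powr (-1/2 * (1 / q))) * V"
        by (simp only: mult_ac)
      also have "\<dots> = V" using \<kappa> N by (simp flip: powr_add)
      also have "(2 * \<kappa> powr (- 1 / q) * real N powr (1/2 * (1 / q))) * (\<bar>C\<bar> * real N powr \<eta>) =
         (2 * \<bar>C\<bar> * \<kappa> powr (- 1 / q)) * real N powr (1/2 * (1 / q) + \<eta>)"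
        by (simp add: powr_add mult_ac)
      also have "\<dots> \<le> D * real N powr (2 * \<eta>)"
      proof (rule mult_mono)
        have "1 / q \<ge> 0" using q by simp
        hence "1/2 * (1 / q) + \<eta> \<le> 2 * \<eta>" using iq by linarith
        thus "real N powr (1/2 * (1 / q) + \<eta>) \<le> real N powr (2 * \<eta>)" using N by (intro powr_mono) auto
      qed (auto simp: D_def)
      finally show ?thesis .
    qed
    hence "V * real N powr (1/2) \<le> D * real N powr (2 * \<eta>) * real N powr (1/2)" by (rule mult_right_mono) simp
    thus ?thesis unfolding MV by (simp add: powr_add mult_ac)
  qed
  thus ?thesis by blast
qed

lemma unbounded_Ex_ge:
  fixes Q :: "real set"
  assumes "Q \<subseteq> {1..}" "\<not> bounded Q"
  obtains q where "q \<in> Q" "q \<ge> x"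
proof -
  have "\<not> Q \<subseteq> {1..x}" using assms(2) bounded_subset[OF bounded_closed_interval] by blast
  then obtain q where "q \<in> Q" "q \<notin> {1..x}" by blast
  thus ?thesis using that[of q] assms(1) by force
qed

theorem theorem4p1:
  fixes c :: real
  assumes "c > 0"
  shows
    "(riemann_hypothesis \<longleftrightarrow>
       (\<forall>\<eta>::real. \<eta> > 0 \<longrightarrow> (\<forall>q::real. q \<ge> 1 \<longrightarrow>
         (\<exists>C::real. \<forall>N::nat. N \<ge> 1 \<longrightarrow> \<bar>local_mean q c N\<bar> \<le> C * real N powr \<eta>)))) \<and>
     (riemann_hypothesis \<longleftrightarrow>
       (\<forall>\<eta>::real. \<eta> > 0 \<longrightarrow> (\<exists>Q::real set. Q \<subseteq> {1..} \<and> \<not> bounded Q \<and> (\<forall>q\<in>Q.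
         \<exists>C::real. \<forall>N::nat. N \<ge> 1 \<longrightarrow> \<bar>local_mean q c N\<bar> \<le> C * real N powr \<eta>))))"
    (is "(_ \<longleftrightarrow> ?all) \<and> (_ \<longleftrightarrow> ?unb)")
proof -
  have 1: ?all if riemann_hypothesis
    using local_mean_bound_of_zero_free[OF riemann_hypothesis_imp_zero_free[OF that] assms] by blast
  have 2: ?unb if ?all
  proof (intro allI impI exI[of _ "{1..}"] conjI ballI)
    show "\<not> bounded {1::real..}"
    proof
      assume "bounded {1::real..}"
      then obtain B where "\<And>x. x \<ge> 1 \<Longrightarrow> norm (x::real) \<le> B" unfolding bounded_iff by auto
      from this[of "max 1 (B + 1)"] show False by simp
    qed
  qed (use that in auto)
  have 3: riemann_hypothesis if unb: ?unb
  proof -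
    have zeta_zero_free
    proof (rule zero_free_of_mertens_bound)
      fix \<eta> :: real assume \<eta>: "\<eta> > 0"
      \<comment> \<open>\<open>mertens_bound_of_local_mean_bound\<close> doubles the exponent, so it
        is used at \<eta>/2. A single large q from the set belonging to \<eta>/2 suffices.\<close>
      hence \<eta>2: "\<eta> / 2 > 0" by simp
      obtain Q where Q: "Q \<subseteq> {1..}" "\<not> bounded Q"
        "\<And>q. q \<in> Q \<Longrightarrow> \<exists>C. \<forall>N\<ge>1. \<bar>local_mean q c N\<bar> \<le> C * real N powr (\<eta> / 2)"
        using unb[rule_format, OF \<eta>2] by blast
      obtain q where q: "q \<in> Q" "q \<ge> 1 / (\<eta> / 2)" using unbounded_Ex_ge[OF Q(1,2)] .
      obtain C where "\<And>N. N \<ge> 1 \<Longrightarrow> \<bar>local_mean q c N\<bar> \<le> C * real N powr (\<eta> / 2)" using Q(3)[OF q(1)] by blast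
      from mertens_bound_of_local_mean_bound[OF assms \<eta>2 _ q(2) this] q Q(1)
      show "\<exists>C. \<forall>N\<ge>1. \<bar>real_of_int (mertens N)\<bar> \<le> C * real N powr (1/2 + \<eta>)" by auto
    qed
    thus ?thesis using riemann_hypothesis_if_zero_free unfolding zeta_zero_free_def by blast
  qed
  show ?thesis using 1 2 3 by blast
qed

end
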